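(* For all integers $n\ge 1$ and $g\ge 1$, $$2g\,Q(n,g)\le (2n)^3\,Q(n,g-1),$$ where $Q(n,g)$ is the number of rooted bipartite quadrangulations of genus $g$ with $n$ faces.
   Context: A map is the gluing of a finite collection of oriented polygons (the faces) along their sides, forming a compact connected oriented surface; its vertices and edges are the images of the vertices and sides of the polygons, and its genus is the genus of the surface. A bipartite map has vertices coloured black or white, each edge joining a black and a white vertex. Maps are rooted, i.e. carry a distinguished edge (the root), and are counted up to root- and colour-preserving, orientation-preserving homeomorphism. A (bipartite) quadrangulation is a rooted bipartite map all of whose faces are quadrangles; multiple edges are allowed. With $n$ faces and genus $g$ it has $2n$ edges and $n+2-2g$ vertices. *)

theory Defs
  imports "HOL-Combinatorics.Orbits"
begin

text \<open>
  A finite collection of oriented polygons glued along their sides is given by the finite set of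
  all sides of all polygons, the map \<open>nxt\<close> sending a side to the following side of the same
  polygon (with respect to the orientation of the polygon), and the map \<open>glue\<close> sending a side to
  the one it is glued to.  Gluing is along orientation-reversing identifications of the sides,
  which is what makes the resulting closed surface oriented.
\<close>

record gluing =
  sides :: "nat set"
  nxt :: "nat \<Rightarrow> nat"
  glue :: "nat \<Rightarrow> nat"

definition polygon_gluing :: "'a gluing_scheme \<Rightarrow> bool" where
  "polygon_gluing M \<longleftrightarrow>
     finite (sides M) \<and> sides M \<noteq> {} \<and>
     nxt M permutes sides M \<and> glue M permutes sides M \<and>
     (\<forall>s\<in>sides M. glue M s \<noteq> s \<and> glue M (glue M s) = s)"

definition faces :: "'a gluing_scheme \<Rightarrow> nat set set" where
  "faces M = orbit (nxt M) ` sides M"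

definition edges :: "'a gluing_scheme \<Rightarrow> nat set set" where
  "edges M = (\<lambda>s. {s, glue M s}) ` sides M"

text \<open>
  A corner of a polygon is represented by the side that starts there, so the side \<open>s\<close> runs from
  corner \<open>s\<close> to corner \<open>nxt M s\<close>.  Gluing \<open>s\<close> to \<open>glue M s\<close> identifies the start of \<open>s\<close> with the end
  of \<open>glue M s\<close>, that is, corner \<open>s\<close> with corner \<open>nxt M (glue M s)\<close>; these identifications
  generate the equivalence whose classes are the vertices.
\<close>

definition vertex_of :: "'a gluing_scheme \<Rightarrow> nat \<Rightarrow> nat set" where
  "vertex_of M s = orbit (nxt M \<circ> glue M) s"

definition vertices :: "'a gluing_scheme \<Rightarrow> nat set set" where
  "vertices M = vertex_of M ` sides M"

text \<open>
  The glued surface is connected iff any two sides are linked by moves within a polygon and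
  across glued sides.  Both moves are permutations of a finite set, so that reachability is
  symmetric.
\<close>

definition connected_gluing :: "'a gluing_scheme \<Rightarrow> bool" where
  "connected_gluing M \<longleftrightarrow>
     (\<forall>s\<in>sides M. \<forall>t\<in>sides M.
        (s, t) \<in> {(x, y). x \<in> sides M \<and> (y = nxt M x \<or> y = glue M x)}\<^sup>*)"

definition is_map :: "'a gluing_scheme \<Rightarrow> bool" where
  "is_map M \<longleftrightarrow> polygon_gluing M \<and> connected_gluing M"

definition euler_char :: "'a gluing_scheme \<Rightarrow> int" where
  "euler_char M = int (card (vertices M)) - int (card (edges M)) + int (card (faces M))"

text \<open>The genus of a closed connected oriented surface is read off its Euler characteristic.\<close>

definition has_genus :: "'a gluing_scheme \<Rightarrow> nat \<Rightarrow> bool" where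
  "has_genus M g \<longleftrightarrow> euler_char M = 2 - 2 * int g"

text \<open>Here \<open>black\<close> is the set of black vertices; all other vertices are white.\<close>

record rooted_bicoloured = gluing +
  black :: "nat set set"
  root_edge :: "nat set"

definition rooted_bipartite_map :: "rooted_bicoloured \<Rightarrow> bool" where
  "rooted_bipartite_map M \<longleftrightarrow>
     is_map M \<and> black M \<subseteq> vertices M \<and>
     (\<forall>s\<in>sides M. vertex_of M s \<in> black M \<longleftrightarrow> vertex_of M (nxt M s) \<notin> black M) \<and>
     root_edge M \<in> edges M"

text \<open>
  Combinatorial form of an orientation-preserving homeomorphism between the glued surfaces that
  carries vertices, edges, faces, colours and root of one map to those of the other.
\<close>

definition map_isomorphism ::
    "(nat \<Rightarrow> nat) \<Rightarrow> rooted_bicoloured \<Rightarrow> rooted_bicoloured \<Rightarrow> bool" where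
  "map_isomorphism h M N \<longleftrightarrow>
     bij_betw h (sides M) (sides N) \<and>
     (\<forall>s\<in>sides M. h (nxt M s) = nxt N (h s) \<and> h (glue M s) = glue N (h s)) \<and>
     (`) h ` black M = black N \<and>
     h ` root_edge M = root_edge N"

definition map_iso_rel :: "(rooted_bicoloured \<times> rooted_bicoloured) set" where
  "map_iso_rel =
     {(M, N). rooted_bipartite_map M \<and> rooted_bipartite_map N \<and> (\<exists>h. map_isomorphism h M N)}"

definition bipartite_quadrangulation :: "rooted_bicoloured \<Rightarrow> bool" where
  "bipartite_quadrangulation M \<longleftrightarrow>
     rooted_bipartite_map M \<and> (\<forall>f\<in>faces M. card f = 4)"

definition quadrangulations :: "nat \<Rightarrow> nat \<Rightarrow> rooted_bicoloured set" where
  "quadrangulations n g =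
     {M. bipartite_quadrangulation M \<and> card (faces M) = n \<and> has_genus M g}"

definition num_quadrangulations :: "nat \<Rightarrow> nat \<Rightarrow> nat" where
  "num_quadrangulations n g = card (quadrangulations n g // map_iso_rel)"

lemma rooted_bipartite_map_sets:
  assumes "rooted_bipartite_map M"
  shows "\<Union>(black M) \<subseteq> sides M" "root_edge M \<subseteq> sides M"
proof -
  have "nxt M permutes sides M" "glue M permutes sides M"
    using assms by (auto simp: rooted_bipartite_map_def is_map_def polygon_gluing_def)
  then have "orbit (nxt M \<circ> glue M) s \<subseteq> sides M" if "s \<in> sides M" for s
    using that permutes_orbit_subset permutes_compose by metis
  then show "\<Union>(black M) \<subseteq> sides M"
    using assms by (fastforce simp: rooted_bipartite_map_def vertices_def vertex_of_def)
  show "root_edge M \<subseteq> sides M"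
    using assms \<open>glue M permutes sides M\<close>
    by (auto simp: rooted_bipartite_map_def edges_def permutes_in_image)
qed

lemma equiv_map_iso_rel: "equiv {M. rooted_bipartite_map M} map_iso_rel"
proof (rule equivI)
  show "map_iso_rel \<subseteq> {M. rooted_bipartite_map M} \<times> {M. rooted_bipartite_map M}"
    by (auto simp: map_iso_rel_def)
  have "map_isomorphism id M M" for M
    by (auto simp: map_isomorphism_def image_image)
  then show "refl_on {M. rooted_bipartite_map M} map_iso_rel"
    by (auto simp: refl_on_def map_iso_rel_def)
  show "sym map_iso_rel"
  proof (rule symI)
    fix M N assume "(M, N) \<in> map_iso_rel"
    then obtain h where rb: "rooted_bipartite_map M" "rooted_bipartite_map N"
      and h: "map_isomorphism h M N"
      by (auto simp: map_iso_rel_def)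
    define k where "k = inv_into (sides M) h"
    have bij: "bij_betw h (sides M) (sides N)"
      using h by (simp add: map_isomorphism_def)
    have k: "bij_betw k (sides N) (sides M)"
      unfolding k_def by (rule bij_betw_inv_into[OF bij])
    have kh: "k (h s) = s" if "s \<in> sides M" for s
      unfolding k_def using bij that by (simp add: bij_betw_def)
    have hk: "h (k s) = s" if "s \<in> sides N" for s
      unfolding k_def using bij that by (rule bij_betw_inv_into_right)
    have kin: "k s \<in> sides M" if "s \<in> sides N" for s
      using k that by (auto simp: bij_betw_def)
    have kimg: "k ` h ` A = A" if "A \<subseteq> sides M" for A
      using that kh by (force simp: image_image)
    have perm: "nxt M s \<in> sides M" "glue M s \<in> sides M" if "s \<in> sides M" for s
      using rb(1) that
      by (auto simp: rooted_bipartite_map_def is_map_def polygon_gluing_def permutes_in_image)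
    have comm: "k (nxt N s) = nxt M (k s) \<and> k (glue N s) = glue M (k s)" if "s \<in> sides N" for s
    proof -
      have "h (nxt M (k s)) = nxt N s \<and> h (glue M (k s)) = glue N s"
        using h kin[OF that] hk[OF that] by (simp add: map_isomorphism_def)
      then show ?thesis using kh perm kin[OF that] by metis
    qed
    have blk: "(`) k ` black N = black M"
    proof -
      have "(`) k ` black N = (\<lambda>A. k ` h ` A) ` black M"
        using h image_image[of "(`) k" "(`) h" "black M"] by (simp add: map_isomorphism_def)
      also have "\<dots> = (\<lambda>A. A) ` black M"
        using rooted_bipartite_map_sets(1)[OF rb(1)] by (intro image_cong kimg) auto
      finally show ?thesis by simp
    qed
    have "k ` root_edge N = root_edge M"
      using h kimg[OF rooted_bipartite_map_sets(2)[OF rb(1)]] by (simp add: map_isomorphism_def)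
    then have "map_isomorphism k N M"
      using k comm blk by (auto simp: map_isomorphism_def)
    then show "(N, M) \<in> map_iso_rel" using rb by (auto simp: map_iso_rel_def)
  qed
  show "trans map_iso_rel"
  proof (rule transI)
    fix L M N assume "(L, M) \<in> map_iso_rel" "(M, N) \<in> map_iso_rel"
    then obtain h k where rb: "rooted_bipartite_map L" "rooted_bipartite_map N"
      and h: "map_isomorphism h L M" and k: "map_isomorphism k M N"
      by (auto simp: map_iso_rel_def)
    have mem: "h s \<in> sides M" if "s \<in> sides L" for s
      using h that by (auto simp: map_isomorphism_def bij_betw_def)
    have "(`) (k \<circ> h) ` black L = (`) k ` (`) h ` black L"
      by (simp add: image_image image_comp)
    then have "(`) (k \<circ> h) ` black L = black N"
      using h k by (simp only: map_isomorphism_def)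
    moreover have "(k \<circ> h) ` root_edge L = root_edge N"
      using h k by (simp only: map_isomorphism_def image_comp[symmetric])
    ultimately have "map_isomorphism (k \<circ> h) L N"
      using h k mem by (auto simp: map_isomorphism_def intro: bij_betw_trans)
    then show "(L, N) \<in> map_iso_rel" using rb by (auto simp: map_iso_rel_def)
  qed
qed

end

theory Submission imports Defs begin

text \<open>
  The idea is to cut the surface open along geodesics so that a map with a single face remains, to
  lower the genus of that map by cutting one of its vertices into three, and to close it again.

  Distinguish a vertex, the sink, and label each vertex by its distance from the sink.  Because the map
  is bipartite, the label changes by one along each edge, and the sink is the only vertex without a
  lower neighbour.  Each face has exactly two sides along which the label descends.  Joining the starts
  of these two sides in every face gives a map with \<open>n\<close> edges on the vertices other than the sink.
  This is the construction of Cori, Vauquelin, Marcus and Schaeffer: the new map has a single face and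
  the same genus, its labels vary by at most one along edges, and together with the labels it
  determines the quadrangulation.  The lemmas \<open>card_quads_le\<close> and \<open>card_schemes_le\<close> are the two
  directions.

  In a one-face map with \<open>n\<close> edges, number the \<open>2 * n\<close> darts along the boundary of the face.  The
  rotation \<open>\<sigma>\<close> around the vertices has exactly \<open>n + 1\<close> ascents.  One ascent per vertex leads to
  the dart of largest number at that vertex.  In genus \<open>g\<close> there are \<open>n + 1 - 2 * g\<close> vertices, so
  \<open>2 * g\<close> ascents are left over; these are the trisections of Chapuy.  For a trisection \<open>x\<close>, and a dart
  \<open>m\<close> at the same vertex numbered higher than \<open>\<sigma> x\<close>, composing \<open>\<sigma>\<close> with a three-cycle on
  \<open>x\<close>, \<open>\<sigma> x\<close> and \<open>m\<close> cuts the vertex into three and permutes the blocks of the face boundary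
  without breaking it up.  The genus drops by one, and the labels stay valid, since all pieces come from
  one vertex.  The three-cycle can be undone, and it is described by three of the \<open>(2 * n) ^ 3\<close>
  triples of darts.  Hence \<open>3 * (2 * g)\<close> times the number of labelled one-face maps of genus \<open>g\<close> is at most
  \<open>(2 * n) ^ 3\<close> times the number of those of genus \<open>g - 1\<close> (\<open>card_schemes_step\<close>, in terms of the number
  of vertices).

  For quadrangulations this gives the claim with a factor \<open>3\<close> to spare, but for pointed
  quadrangulations.  Forgetting the sink divides by the number of vertices.  If there are \<open>v\<close> vertices in
  genus \<open>g\<close>, there are \<open>v + 2 \<le> 3 * v\<close> in genus \<open>g - 1\<close>, and this uses up the factor.

  All of this happens on a fixed set of sides with a fixed gluing, fixed labels, colours and root; only
  the cyclic order of the sides of the faces changes.  Passing from such labelled objects to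
  isomorphism classes divides both counts by \<open>(4 * n)!\<close>, as rooted coloured maps have no nontrivial
  automorphisms (\<open>card_labelled_quads\<close>).
\<close>

section \<open>Cycles of a permutation\<close>

lemma orbit_perm_sym:
  assumes "permutation p" "y \<in> orbit p x" shows "x \<in> orbit p y"
  using assms by (meson orbit_swap permutation_self_in_orbit)

lemma orbit_perm_eq:
  assumes "permutation p" "y \<in> orbit p x" shows "orbit p y = orbit p x"
  using assms orbit_perm_sym orbit_trans by (metis subsetI subset_antisym)

lemma orbit_subset_closed:
  assumes "x \<in> X" "\<And>z. z \<in> X \<Longrightarrow> p z \<in> X" shows "orbit p x \<subseteq> X"
proof
  fix y assume "y \<in> orbit p x" then show "y \<in> X"
    by induction (auto simp: assms)
qed

lemma permutation_transpose_comp: "permutation p \<Longrightarrow> permutation (transpose x y \<circ> p)"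
  by (intro permutation_compose permutation_swap_id)

definition ncyc :: "('a \<Rightarrow> 'a) \<Rightarrow> 'a set \<Rightarrow> nat" where
  "ncyc p A = card (orbit p ` A)"

text \<open>
  Write the cycle of \<open>x\<close> as \<open>x, p x, \<dots>, w, y, \<dots>\<close>.  After composition with the transposition
  the point \<open>w\<close> is sent to \<open>x\<close> instead of \<open>y\<close>, so that the initial segment closes up on its own and
  the rest of the cycle becomes the cycle of \<open>y\<close>.
\<close>

lemma transpose_splits_cycle:
  assumes p: "permutation p" and y: "y \<in> orbit p x" and xy: "x \<noteq> y"
  defines "q \<equiv> transpose x y \<circ> p"
  shows "orbit q x \<union> orbit q y = orbit p x" (is ?un)
    and "y \<notin> orbit q x" (is ?disj)
    and "\<And>z. z \<notin> orbit p x \<Longrightarrow> orbit q z = orbit p z"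
proof -
  have q: "permutation q" unfolding q_def by (rule permutation_transpose_comp[OF p])
  have x: "x \<in> orbit p x" and xq: "x \<in> orbit q x" "y \<in> orbit q y"
    by (intro permutation_self_in_orbit p q)+
  define k where "k = funpow_dist1 p x y"
  have k0: "0 < k" and kx: "(p ^^ k) x = y"
    using funpow_dist1_prop[OF y] by (auto simp: k_def)
  have kmin: "(p ^^ i) x \<noteq> y" if "i < k" for i
    using funpow_dist1_least[of i p x y] that xy unfolding k_def by (cases i) auto
  have nox: "(p ^^ i) x \<noteq> x" if "0 < i" "i < k" for i
  proof
    assume "(p ^^ i) x = x"
    then have "(p ^^ (k - i)) x = y"
    proof -
      have "(p ^^ (k - i)) ((p ^^ i) x) = (p ^^ (k - i + i)) x" by (simp only: funpow_add o_apply)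
      then show ?thesis using kx that \<open>(p ^^ i) x = x\<close> by simp
    qed
    then show False using kmin[of "k - i"] that by auto
  qed
  let ?X = "{(p ^^ i) x | i. i < k}"
  have "orbit q x \<subseteq> ?X"
  proof (rule orbit_subset_closed)
    show "x \<in> ?X" using k0 by (auto intro!: exI[of _ 0])
    fix z assume "z \<in> ?X"
    then obtain i where i: "i < k" "z = (p ^^ i) x" by auto
    have qz: "q z = transpose x y ((p ^^ Suc i) x)" by (simp add: q_def i)
    show "q z \<in> ?X"
    proof (cases "Suc i = k")
      case True
      then have "q z = x" using qz kx by simp
      then show ?thesis using k0 by (auto intro!: exI[of _ 0])
    next
      case False
      then have "Suc i < k" using i by auto
      then have "q z = (p ^^ Suc i) x"
        using qz nox[of "Suc i"] kmin[of "Suc i"] by (metis transpose_apply_other zero_less_Suc)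
      then show ?thesis using \<open>Suc i < k\<close> by blast
    qed
  qed
  then show ?disj using kmin by auto
  have cl: "q z \<in> orbit p x" if "z \<in> orbit p x" for z
    using that y x by (auto simp: q_def transpose_def intro: orbit.step)
  have "orbit q x \<subseteq> orbit p x" "orbit q y \<subseteq> orbit p x"
    using orbit_subset_closed[of _ "orbit p x" q, OF _ cl] x y by blast+
  moreover have "orbit p x \<subseteq> orbit q x \<union> orbit q y"
  proof (rule orbit_subset_closed)
    show "x \<in> orbit q x \<union> orbit q y" using xq by auto
    fix z assume "z \<in> orbit q x \<union> orbit q y"
    then have "q z \<in> orbit q x \<union> orbit q y" by (auto intro: orbit.step)
    moreover have "p z = transpose x y (q z)" by (simp add: q_def)
    ultimately show "p z \<in> orbit q x \<union> orbit q y"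
      using xq by (auto simp: transpose_def)
  qed
  ultimately show ?un by auto
  show "orbit q z = orbit p z" if z: "z \<notin> orbit p x" for z
  proof (rule orbit_cong[OF permutation_self_in_orbit[OF p]])
    fix s assume s: "s \<in> orbit p z"
    then have "p s \<in> orbit p z" by (rule orbit.step)
    moreover have "x \<notin> orbit p z" using z orbit_perm_sym[OF p] by auto
    moreover have "y \<notin> orbit p z"
    proof
      assume "y \<in> orbit p z"
      then have "z \<in> orbit p y" by (rule orbit_perm_sym[OF p])
      then show False using z y by (blast intro: orbit_trans)
    qed
    ultimately show "q s = p s" by (auto simp: q_def transpose_def)
  qed
qed

lemma ncyc_transpose_split:
  assumes p: "permutation p" and A: "finite A" "x \<in> A" "y \<in> A"
    and y: "y \<in> orbit p x" and xy: "x \<noteq> y"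
  shows "ncyc (transpose x y \<circ> p) A = ncyc p A + 1"
proof -
  define q where "q = transpose x y \<circ> p"
  have q: "permutation q" unfolding q_def by (rule permutation_transpose_comp[OF p])
  note sp = transpose_splits_cycle[OF p y xy, folded q_def]
  have self: "z \<in> orbit p z" "z \<in> orbit q z" for z
    using permutation_self_in_orbit[OF p] permutation_self_in_orbit[OF q] by auto
  have "orbit q ` A = (orbit p ` A - {orbit p x}) \<union> {orbit q x, orbit q y}" (is "?L = ?R")
  proof (intro equalityI subsetI)
    fix C assume "C \<in> ?L"
    then obtain z where z: "z \<in> A" "C = orbit q z" by auto
    show "C \<in> ?R"
    proof (cases "z \<in> orbit p x")
      case True
      then have "z \<in> orbit q x \<or> z \<in> orbit q y" using sp(1) by auto
      then show ?thesis using z orbit_perm_eq[OF q] by auto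
    next
      case False
      then have "orbit p z \<noteq> orbit p x" using self by metis
      then show ?thesis using sp(3)[OF False] z by auto
    qed
  next
    fix C assume "C \<in> ?R"
    then consider "C = orbit q x" | "C = orbit q y" | "C \<in> orbit p ` A" "C \<noteq> orbit p x" by auto
    then show "C \<in> ?L"
    proof cases
      case 3
      then obtain z where z: "z \<in> A" "C = orbit p z" by auto
      then have "z \<notin> orbit p x" using 3 orbit_perm_eq[OF p] by metis
      then show ?thesis using sp(3) z by (metis image_eqI)
    qed (use A in auto)
  qed
  moreover have "orbit q x \<noteq> orbit q y" using sp(2) self by metis
  moreover have "orbit q x \<notin> orbit p ` A - {orbit p x}" "orbit q y \<notin> orbit p ` A - {orbit p x}"
  proof -
    have "C = orbit p x" if "C \<in> orbit p ` A" "x \<in> C \<or> y \<in> C" for C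
      using that orbit_perm_eq[OF p] y by blast
    then show "orbit q x \<notin> orbit p ` A - {orbit p x}" "orbit q y \<notin> orbit p ` A - {orbit p x}"
      using self(2) by blast+
  qed
  moreover have "card (orbit p ` A - {orbit p x}) + 1 = card (orbit p ` A)"
    using A card.remove[of "orbit p ` A" "orbit p x"] by simp
  ultimately show ?thesis using A by (simp add: ncyc_def flip: q_def)
qed

section \<open>First passage and induced permutations\<close>

text \<open>
  First passage: \<open>z\<close> is the first point of \<open>A\<close> met when iterating \<open>p\<close> from \<open>x\<close>, where \<open>x\<close> itself
  counts.  A return to \<open>A\<close> is therefore a first passage that starts from \<open>p x\<close>.  The relation is
  inductive because all later arguments run along the path.
\<close>

inductive first_in :: "('a \<Rightarrow> 'a) \<Rightarrow> 'a set \<Rightarrow> 'a \<Rightarrow> 'a \<Rightarrow> bool" for p A where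
  stop: "x \<in> A \<Longrightarrow> first_in p A x x"
| move: "x \<notin> A \<Longrightarrow> first_in p A (p x) z \<Longrightarrow> first_in p A x z"

lemma first_in_mem: "first_in p A x z \<Longrightarrow> z \<in> A"
  by (induction rule: first_in.induct)

lemma first_in_unique: "first_in p A x z \<Longrightarrow> first_in p A x z' \<Longrightarrow> z = z'"
proof (induction arbitrary: z' rule: first_in.induct)
  case (stop x)
  from stop.prems stop.hyps show ?case by (cases rule: first_in.cases) auto
next
  case (move x z)
  from move.prems move.hyps(1) have "first_in p A (p x) z'" by (cases rule: first_in.cases) auto
  then show ?case by (rule move.IH)
qed

lemma first_in_from_mem: "x \<in> A \<Longrightarrow> first_in p A x z \<longleftrightarrow> z = x"
  using first_in_unique stop by metis

text \<open>
  As \<open>B\<close> is contained in \<open>A\<close>, a walk cannot meet \<open>B\<close> before it first meets \<open>A\<close>.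
\<close>

lemma first_in_trans:
  "first_in p A x y \<Longrightarrow> B \<subseteq> A \<Longrightarrow> first_in p B y z \<Longrightarrow> first_in p B x z"
  by (induction rule: first_in.induct) (auto intro: first_in.intros)

lemma first_in_mono:
  assumes "first_in p A x z" "B \<subseteq> A" "z \<in> B" shows "first_in p B x z"
  using assms first_in_trans[OF assms(1,2)] stop by fast

lemma first_in_orbit: "first_in p A x z \<Longrightarrow> z = x \<or> z \<in> orbit p x"
  by (induction rule: first_in.induct) (auto intro: orbit.base orbit_subset)

lemma first_in_ex:
  assumes "z \<in> A" "(p ^^ k) x = z" shows "\<exists>z. first_in p A x z"
  using assms(2)
proof (induction k arbitrary: x)
  case 0 then show ?case using assms(1) stop by fastforce
next
  case (Suc k)
  then have "(p ^^ k) (p x) = z" by (simp add: funpow_swap1)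
  with Suc.IH[of "p x"] show ?case
    by (cases "x \<in> A") (auto intro: stop move)
qed

lemma first_in_ex_orbit:
  assumes "z \<in> A" "z \<in> orbit p x" shows "\<exists>z. first_in p A (p x) z"
proof -
  obtain n where "0 < n" "(p ^^ n) x = z" using assms(2) by (auto simp: orbit_altdef)
  then have "(p ^^ (n - 1)) (p x) = z" by (cases n) (auto simp: funpow_swap1)
  then show ?thesis using first_in_ex assms(1) by metis
qed

lemma first_in_funpow:
  assumes "first_in p A x z"
  shows "\<exists>k. (p ^^ k) x = z \<and> (\<forall>i<k. (p ^^ i) x \<notin> A)"
  using assms
proof (induction rule: first_in.induct)
  case (stop x) then show ?case by (intro exI[of _ 0]) auto
next
  case (move x z)
  then obtain k where k: "(p ^^ k) (p x) = z" "\<forall>i<k. (p ^^ i) (p x) \<notin> A" by auto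
  have "(p ^^ i) x \<notin> A" if "i < Suc k" for i
    using that move.hyps(1) k(2) by (cases i) (auto simp: funpow_swap1)
  then show ?case using k(1) by (intro exI[of _ "Suc k"]) (auto simp: funpow_swap1)
qed

text \<open>
  The first return map of \<open>p\<close> to \<open>A\<close>.
\<close>

definition induced :: "('a \<Rightarrow> 'a) \<Rightarrow> 'a set \<Rightarrow> 'a \<Rightarrow> 'a" where
  "induced p A x = (if x \<in> A then THE z. first_in p A (p x) z else x)"

lemma induced_eqI: "x \<in> A \<Longrightarrow> first_in p A (p x) z \<Longrightarrow> induced p A x = z"
  using first_in_unique unfolding induced_def by (auto intro!: the_equality)

lemma first_in_induced:
  assumes "permutation p" "x \<in> A" shows "first_in p A (p x) (induced p A x)"
  using first_in_ex_orbit[of x A p x] permutation_self_in_orbit[OF assms(1), of x] assms(2)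
    induced_eqI by metis

lemma induced_permutes:
  assumes p: "permutation p" and A: "finite A"
  shows "induced p A permutes A"
proof (rule inj_imp_permutes)
  have key: "x = y" if xy: "x \<in> A" "y \<in> A" "(p ^^ Suc k) x = (p ^^ Suc l) y" "k \<le> l"
    and l: "\<forall>i<l. (p ^^ i) (p y) \<notin> A" for x y k l
  proof -
    have "inj (p ^^ Suc k)" using p permutation_bijective bij_is_inj by (metis inj_fn)
    moreover have "(p ^^ Suc k) x = (p ^^ Suc k) ((p ^^ (l - k)) y)"
    proof -
      have "(p ^^ Suc k) ((p ^^ (l - k)) y) = (p ^^ (Suc k + (l - k))) y"
        by (simp only: funpow_add o_apply)
      also have "Suc k + (l - k) = Suc l" using xy(4) by simp
      finally show ?thesis using xy(3) by simp
    qed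
    ultimately have "x = (p ^^ (l - k)) y" by (rule injD)
    then show ?thesis using l[rule_format, of "l - k - 1"] xy(1,4)
      by (cases "l - k") (auto simp: funpow_swap1)
  qed
  show "inj_on (induced p A) A"
  proof (rule inj_onI)
    fix x y assume xy: "x \<in> A" "y \<in> A" "induced p A x = induced p A y"
    obtain k where k: "(p ^^ k) (p x) = induced p A x" "\<forall>i<k. (p ^^ i) (p x) \<notin> A"
      using first_in_funpow[OF first_in_induced[OF p xy(1)]] by auto
    obtain l where l: "(p ^^ l) (p y) = induced p A y" "\<forall>i<l. (p ^^ i) (p y) \<notin> A"
      using first_in_funpow[OF first_in_induced[OF p xy(2)]] by auto
    have e: "(p ^^ Suc k) x = (p ^^ Suc l) y" using k l xy(3) by (simp add: funpow_swap1)
    show "x = y"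
      using key[OF xy(1,2) e _ l(2)] key[OF xy(2,1) e[symmetric] _ k(2)] by (metis nat_le_linear)
  qed
  show "induced p A x \<in> A" if "x \<in> A" for x
    using first_in_mem first_in_induced[OF p that] by metis
qed (use A in \<open>auto simp: induced_def\<close>)

lemma orbit_induced:
  assumes p: "permutation p" and x: "x \<in> A"
  shows "orbit (induced p A) x = orbit p x \<inter> A"
proof (intro equalityI subsetI)
  fix y assume "y \<in> orbit (induced p A) x"
  then show "y \<in> orbit p x \<inter> A"
  proof induction
    case base
    have "first_in p A (p x) (induced p A x)" by (rule first_in_induced[OF p x])
    then show ?case using first_in_orbit first_in_mem by (metis IntI orbit.base orbit_subset)
  next
    case (step y)
    then have "first_in p A (p y) (induced p A y)" by (intro first_in_induced[OF p]) auto
    then show ?case using first_in_orbit first_in_mem step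
      by (metis IntD1 IntI orbit.step orbit_trans)
  qed
next
  fix y assume y: "y \<in> orbit p x \<inter> A"
  have "z \<in> orbit (induced p A) x" if "y \<in> orbit p x" "first_in p A y z" for y z
    using that
  proof (induction arbitrary: z rule: orbit.induct)
    case base
    then show ?case using induced_eqI[OF x] by (metis orbit.base)
  next
    case (step y)
    show ?case
    proof (cases "y \<in> A")
      case True
      then show ?thesis using step induced_eqI[OF True] stop by (metis orbit.step)
    next
      case False
      then show ?thesis using step move by metis
    qed
  qed
  then show "y \<in> orbit (induced p A) x" using y stop by fastforce
qed

text \<open>
  A cycle that meets \<open>A\<close> leaves exactly one cycle of the first return map; the others disappear.
\<close>

lemma ncyc_induced:
  assumes p: "permutation p" and A: "finite S" "A \<subseteq> S"
  shows "ncyc p S = ncyc (induced p A) A + card {C \<in> orbit p ` S. C \<inter> A = {}}"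
proof -
  let ?T = "{C \<in> orbit p ` S. C \<inter> A \<noteq> {}}" and ?U = "{C \<in> orbit p ` S. C \<inter> A = {}}"
  have "bij_betw (\<lambda>C. C \<inter> A) ?T (orbit (induced p A) ` A)"
  proof (rule bij_betwI')
    fix C C' assume C: "C \<in> ?T" "C' \<in> ?T"
    show "(C \<inter> A = C' \<inter> A) \<longleftrightarrow> (C = C')"
    proof
      assume e: "C \<inter> A = C' \<inter> A"
      obtain z where "z \<in> C" "z \<in> A" using C by auto
      then have "z \<in> C'" using e by auto
      obtain s s' where "C = orbit p s" "C' = orbit p s'" using C by auto
      then show "C = C'" using \<open>z \<in> C\<close> \<open>z \<in> C'\<close> orbit_perm_eq[OF p] by metis
    qed auto
  next
    fix C assume "C \<in> ?T"
    then obtain s z where s: "C = orbit p s" "z \<in> C" "z \<in> A" by auto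
    then have "C = orbit p z" using orbit_perm_eq[OF p] by auto
    then show "C \<inter> A \<in> orbit (induced p A) ` A" using s(3) orbit_induced[OF p s(3)] by auto
  next
    fix C assume "C \<in> orbit (induced p A) ` A"
    then obtain z where z: "z \<in> A" "C = orbit (induced p A) z" by auto
    then have "C = orbit p z \<inter> A" "orbit p z \<in> ?T"
      using orbit_induced[OF p z(1)] permutation_self_in_orbit[OF p, of z] A by auto
    then show "\<exists>C'\<in>?T. C = C' \<inter> A" by auto
  qed
  then have "card ?T = ncyc (induced p A) A" by (simp add: bij_betw_same_card ncyc_def)
  moreover have "orbit p ` S = ?T \<union> ?U" "?T \<inter> ?U = {}" by auto
  moreover have "finite ?T" "finite ?U" using A by auto
  ultimately show ?thesis by (metis (no_types, lifting) ncyc_def card_Un_disjoint)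
qed


section \<open>Quadrangulations with height labels and their one-face schemes\<close>

lemma involution_permutes:
  assumes "finite A" "\<And>x. x \<in> A \<Longrightarrow> p x \<in> A" "\<And>x. x \<in> A \<Longrightarrow> p (p x) = x" "\<And>x. x \<notin> A \<Longrightarrow> p x = x"
  shows "p permutes A"
  by (rule inj_imp_permutes) (use assms in \<open>auto intro: inj_on_inverseI\<close>)

lemma orbit_card_4:
  assumes "s \<in> orbit f s" "card (orbit f s) = 4"
  shows "f (f (f (f s))) = s" "distinct [s, f s, f (f s), f (f (f s))]"
proof -
  define k where "k = funpow_dist1 f s s"
  have inj: "inj_on (\<lambda>n. (f ^^ n) s) {0..<k}"
    unfolding k_def by (rule inj_on_funpow_dist1[OF assms(1)])
  have "card (orbit f s) = k"
    using orbit_conv_funpow_dist1[OF assms(1)] card_image[OF inj] by (simp add: k_def)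
  then have k: "k = 4" using assms(2) by simp
  have "(f ^^ 4) s = s" using funpow_dist1_prop[OF assms(1)] k unfolding k_def by metis
  then show "f (f (f (f s))) = s" by (simp add: numeral_eq_Suc)
  have "(f ^^ i) s \<noteq> (f ^^ j) s" if "i < j" "j < 4" for i j
    using inj_onD[OF inj, of i j] that k by auto
  from this[of 0 1] this[of 0 2] this[of 0 3] this[of 1 2] this[of 1 3] this[of 2 3]
  show "distinct [s, f s, f (f s), f (f (f s))]" by (simp add: numeral_eq_Suc)
qed

text \<open>
  The setting kept fixed while a quadrangulation is opened, cut and closed again: the sides \<open>S\<close>, their
  gluing \<open>gl\<close>, and for each side \<open>s\<close> the label \<open>h s\<close> of the vertex where \<open>s\<close> starts.  The side \<open>gl s\<close>
  runs backwards along the same edge, hence \<open>h (gl s)\<close> is the label of the end of \<open>s\<close>.  The set \<open>D\<close>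
  collects the sides along which the label descends; each edge contributes one of them, and they
  serve as the darts of the one-face map.
\<close>

locale height_sides =
  fixes S :: "'a set" and gl :: "'a \<Rightarrow> 'a" and h :: "'a \<Rightarrow> int"
  assumes finite_S: "finite S" and nonempty_S: "S \<noteq> {}" and gl: "gl permutes S"
    and gl_gl: "\<And>s. s \<in> S \<Longrightarrow> gl (gl s) = s"
    and height_gl: "\<And>s. s \<in> S \<Longrightarrow> \<bar>h (gl s) - h s\<bar> = 1"
begin

definition D :: "'a set" where "D = {s \<in> S. h (gl s) = h s - 1}"

text \<open>
  Here \<open>f\<close> sends a side to the next side of its face, and \<open>f \<circ> gl\<close> turns around vertices; so the
  third conjunct says that labels are constant around vertices.  The last conjunct says that
  exactly one vertex, called the sink, is the start of no descending side.
\<close>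

definition quad :: "('a \<Rightarrow> 'a) \<Rightarrow> bool" where
  "quad f \<longleftrightarrow> f permutes S \<and> (\<forall>s\<in>S. card (orbit f s) = 4) \<and> (\<forall>s\<in>S. h (f s) = h (gl s)) \<and>
     card {C \<in> orbit (f \<circ> gl) ` S. C \<inter> D = {}} = 1"

text \<open>
  A labelled one-face map: \<open>\<sigma>\<close> turns around its vertices, \<open>\<alpha>\<close> exchanges the two
  darts of an edge, and the cycle of \<open>inv \<sigma> \<circ> \<alpha>\<close> is the boundary of its only face.
\<close>

definition scheme :: "('a \<Rightarrow> 'a) \<Rightarrow> ('a \<Rightarrow> 'a) \<Rightarrow> bool" where
  "scheme \<sigma> \<alpha> \<longleftrightarrow> \<sigma> permutes D \<and> \<alpha> permutes D \<and>
     (\<forall>d\<in>D. \<alpha> (\<alpha> d) = d \<and> \<alpha> d \<noteq> d \<and> \<bar>h (\<alpha> d) - h d\<bar> \<le> 1 \<and> h (\<sigma> d) = h d) \<and>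
     cyclic_on (inv \<sigma> \<circ> \<alpha>) D"

lemma D_subset: "D \<subseteq> S" and finite_D: "finite D"
  using finite_S by (auto simp: D_def)

lemma gl_gl': "gl (gl s) = s"
  using gl gl_gl permutes_not_in by metis

lemma gl_in_S: "gl s \<in> S \<longleftrightarrow> s \<in> S"
  by (rule permutes_in_image[OF gl])

lemma down: "d \<in> D \<Longrightarrow> h (gl d) = h d - 1" and down_S: "d \<in> D \<Longrightarrow> d \<in> S"
  by (auto simp: D_def)

lemma up: "u \<in> S \<Longrightarrow> u \<notin> D \<Longrightarrow> h (gl u) = h u + 1"
  using height_gl[of u] by (auto simp: D_def)

lemma gl_down: "d \<in> D \<Longrightarrow> gl d \<notin> D"
  by (auto simp: D_def gl_gl')

lemma gl_up: "u \<in> S \<Longrightarrow> u \<notin> D \<Longrightarrow> gl u \<in> D"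
  using up[of u] by (auto simp: D_def gl_gl' gl_in_S)

lemma D_nonempty: "D \<noteq> {}"
  using nonempty_S gl_up by auto

lemma permutation_D: "p permutes D \<Longrightarrow> permutation p"
  using finite_D permutation_permutes by auto

lemma permutation_S: "p permutes S \<Longrightarrow> permutation p"
  using finite_S permutation_permutes by auto

lemma orbit_singleton_card: "card {C \<in> X. C \<inter> D = {}} = 1 \<Longrightarrow> A \<in> X \<Longrightarrow> A \<inter> D = {} \<Longrightarrow>
   B \<in> X \<Longrightarrow> B \<inter> D = {} \<Longrightarrow> A = B"
  by (metis (mono_tags, lifting) card_1_singletonE mem_Collect_eq singletonD)

end

locale height_quad = height_sides +
  fixes f :: "'a \<Rightarrow> 'a"
  assumes quad: "quad f"
begin

lemma f: "f permutes S" and card_face: "\<And>s. s \<in> S \<Longrightarrow> card (orbit f s) = 4"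
  and height_f: "\<And>s. s \<in> S \<Longrightarrow> h (f s) = h (gl s)"
  and sink: "card {C \<in> orbit (f \<circ> gl) ` S. C \<inter> D = {}} = 1"
  using quad by (auto simp: quad_def)

lemma f_in_S: "f s \<in> S \<longleftrightarrow> s \<in> S"
  by (rule permutes_in_image[OF f])

lemma face: "s \<in> S \<Longrightarrow> f (f (f (f s))) = s" "s \<in> S \<Longrightarrow> distinct [s, f s, f (f s), f (f (f s))]"
  using orbit_card_4[OF permutation_self_in_orbit[OF permutation_S[OF f]] card_face] by auto

abbreviation \<rho> where "\<rho> \<equiv> f \<circ> gl"

lemma rho: "permutation \<rho>"
  using f gl finite_S permutes_compose permutation_permutes by metis

lemma height_rho: "h (\<rho> s) = h s"
  using height_f[of "gl s"] gl_gl' gl_in_S permutes_not_in[OF f] permutes_not_in[OF gl]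
  by (cases "s \<in> S") auto

lemma height_down: "d \<in> D \<Longrightarrow> h (f d) = h d - 1"
  using height_f down down_S by auto

lemma height_up: "u \<in> S \<Longrightarrow> u \<notin> D \<Longrightarrow> h (f u) = h u + 1"
  using height_f up by auto

text \<open>
  The label moves by one along each of the four sides of a face and returns to its initial value, so a
  face has two descending sides, which are either consecutive or opposite.
\<close>

lemma face_cases:
  assumes d: "d \<in> D"
  obtains (first) "f d \<in> D" "f (f d) \<notin> D" "f (f (f d)) \<notin> D"
  | (second) "f d \<notin> D" "f (f d) \<notin> D" "f (f (f d)) \<in> D"
  | (level) "f d \<notin> D" "f (f d) \<in> D" "f (f (f d)) \<notin> D"
proof -
  have S: "d \<in> S" "f d \<in> S" "f (f d) \<in> S" "f (f (f d)) \<in> S" using d down_S f_in_S by auto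
  have step: "h (f s) = (if s \<in> D then h s - 1 else h s + 1)" if "s \<in> S" for s
    using that height_down height_up by auto
  have "h (f (f (f (f d)))) = h d" using face(1)[OF S(1)] by simp
  then show ?thesis
    using step[OF S(1)] step[OF S(2)] step[OF S(3)] step[OF S(4)] d that
    by (auto split: if_splits)
qed

text \<open>
  Each face carries one edge of the one-face map.  It joins the starts of the two descending sides of
  the face, and \<open>mate\<close> exchanges these two sides.
\<close>

definition mate :: "'a \<Rightarrow> 'a" where
  "mate d = (if d \<notin> D then d else if f d \<in> D then f d else if f (f d) \<in> D then f (f d)
     else f (f (f d)))"

text \<open>
  The rotation of the one-face map skips the ascending sides around each vertex of the quadrangulation.
\<close>

definition rot :: "'a \<Rightarrow> 'a" where "rot = induced \<rho> D"

definition tour :: "'a \<Rightarrow> 'a" where "tour = inv rot \<circ> mate"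

lemma mate_eqs:
  assumes "d \<in> D"
  shows "f d \<in> D \<Longrightarrow> mate d = f d \<and> h (mate d) = h d - 1"
    and "f d \<notin> D \<Longrightarrow> f (f d) \<in> D \<Longrightarrow> mate d = f (f d) \<and> h (mate d) = h d"
    and "f d \<notin> D \<Longrightarrow> f (f d) \<notin> D \<Longrightarrow>
      mate d = f (f (f d)) \<and> f (f (f d)) \<in> D \<and> h (mate d) = h d + 1"
proof -
  have S: "d \<in> S" "f d \<in> S" "f (f d) \<in> S" "f (f (f d)) \<in> S" using assms down_S f_in_S by auto
  show "f d \<in> D \<Longrightarrow> mate d = f d \<and> h (mate d) = h d - 1"
    using assms height_down by (auto simp: mate_def)
  show "f d \<notin> D \<Longrightarrow> f (f d) \<in> D \<Longrightarrow> mate d = f (f d) \<and> h (mate d) = h d"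
    using assms height_down[OF assms] height_up[OF S(2)] by (auto simp: mate_def)
  assume *: "f d \<notin> D" "f (f d) \<notin> D"
  then show "mate d = f (f (f d)) \<and> f (f (f d)) \<in> D \<and> h (mate d) = h d + 1"
    using assms height_down[of "f (f (f d))"] face(1)[OF S(1)]
    by (cases rule: face_cases[OF assms]) (auto simp: mate_def)
qed

lemma mate_height: "d \<in> D \<Longrightarrow> \<bar>h (mate d) - h d\<bar> \<le> 1"
  using mate_eqs[of d] by fastforce

lemma mate_invol:
  assumes "d \<in> D" shows "mate d \<in> D" "mate (mate d) = d" "mate d \<noteq> d"
proof -
  have S: "d \<in> S" using assms down_S by auto
  note fc = face(1)[OF S] face(2)[OF S]
  from assms have "mate d \<in> D \<and> mate (mate d) = d \<and> mate d \<noteq> d"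
  proof (cases rule: face_cases)
    case first
    then have "mate d = f d" using assms by (simp add: mate_def)
    then show ?thesis using first assms fc by (auto simp: mate_def)
  next
    case second
    then have "mate d = f (f (f d))" using assms by (simp add: mate_def)
    then show ?thesis using second assms fc by (auto simp: mate_def)
  next
    case level
    then have "mate d = f (f d)" using assms by (simp add: mate_def)
    then show ?thesis using level assms fc by (auto simp: mate_def)
  qed
  then show "mate d \<in> D" "mate (mate d) = d" "mate d \<noteq> d" by auto
qed

lemma mate_permutes: "mate permutes D"
  by (rule involution_permutes) (use finite_D mate_invol in \<open>auto simp: mate_def\<close>)

lemma rot_permutes: "rot permutes D"
  unfolding rot_def by (rule induced_permutes[OF rho finite_D])

lemma first_in_height: "first_in \<rho> D x z \<Longrightarrow> h z = h x"
  by (induction rule: first_in.induct) (use height_rho in auto)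

lemma rot_first: "d \<in> D \<Longrightarrow> first_in \<rho> D (\<rho> d) (rot d)"
  unfolding rot_def by (rule first_in_induced[OF rho])

lemma rot_height: "h (rot d) = h d"
proof (cases "d \<in> D")
  case True
  then show ?thesis using first_in_height[OF rot_first[OF True]] height_rho by simp
qed (use permutes_not_in[OF rot_permutes] in auto)

lemma rot_eqI: "d \<in> D \<Longrightarrow> first_in \<rho> D (\<rho> d) z \<Longrightarrow> inv rot z = d"
  using induced_eqI rot_permutes permutes_inv_eq unfolding rot_def by metis

lemma inv_rot_height: "h (inv rot d) = h d"
  using rot_height[of "inv rot d"] permutes_inverses(1)[OF rot_permutes] by metis

lemma tour_permutes: "tour permutes D"
  unfolding tour_def using mate_permutes rot_permutes permutes_inv permutes_compose by metis

lemma tour_in: "tour d \<in> D \<longleftrightarrow> d \<in> D"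
  by (rule permutes_in_image[OF tour_permutes])

lemma tour_height: "h (tour d) = h (mate d)"
  by (simp add: tour_def inv_rot_height)

lemma tour_level:
  assumes "d \<in> D" "f d \<notin> D" "f (f d) \<in> D"
  shows "tour d = gl (f d)"
proof -
  have "f d \<in> S" using assms(1) down_S f_in_S by auto
  then have "gl (f d) \<in> D" using gl_up assms by auto
  moreover have "first_in \<rho> D (\<rho> (gl (f d))) (f (f d))" using assms by (auto simp: gl_gl' intro: stop)
  ultimately show ?thesis using rot_eqI mate_eqs(2)[OF assms] by (auto simp: tour_def)
qed

lemma tour_second:
  assumes "d \<in> D" "f d \<notin> D" "f (f d) \<notin> D"
  shows "tour d = gl (f (f d))" "tour d \<in> D" "h (tour d) = h d + 1"
proof -
  have "f (f d) \<in> S" using assms(1) down_S f_in_S by auto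
  then have u: "gl (f (f d)) \<in> D" using gl_up assms by auto
  moreover have "first_in \<rho> D (\<rho> (gl (f (f d)))) (f (f (f d)))"
    using mate_eqs(3)[OF assms] by (auto simp: gl_gl' intro: stop)
  ultimately show "tour d = gl (f (f d))"
    using rot_eqI mate_eqs(3)[OF assms] by (auto simp: tour_def)
  show "tour d \<in> D" using assms tour_in by auto
  show "h (tour d) = h d + 1" using tour_height[of d] mate_eqs(3)[OF assms] by linarith
qed

text \<open>
  Around the end of \<open>y\<close>, let \<open>z\<close> be the first descending side after \<open>gl y\<close>; then \<open>inv rot z\<close> is
  the descending side just before \<open>gl y\<close>, that is, the corner of the one-face map into which \<open>y\<close>
  points.  The claim is that this is the first corner lower than \<open>y\<close> that the tour meets.  The
  ascending sides between \<open>gl y\<close> and \<open>z\<close> are crossed one at a time, each by one return of the tour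
  to the level of \<open>y\<close>.
\<close>

lemma first_descent_step:
  assumes "first_in \<rho> D (gl y) z" "y \<in> D"
    and level: "\<And>y'. y' \<in> D \<Longrightarrow> h y' = h y \<Longrightarrow> f y' \<notin> D \<Longrightarrow>
      first_in tour {w. h w \<le> h y'} (tour y') (gl (f y'))"
  shows "first_in tour {w. h w \<le> h y - 1} y (inv rot z)"
  using assms
proof (induction "gl y" z arbitrary: y rule: first_in.induct)
  case stop
  then show ?case using gl_down by auto
next
  case (move z)
  have y: "y \<in> D" by fact
  have ry: "\<rho> (gl y) = f y" by (simp add: gl_gl')
  have nin: "y \<notin> {w. h w \<le> h y - 1}" by auto
  show ?case
  proof (cases "f y \<in> D")
    case True
    then have "z = f y" using move.hyps(2) ry first_in_from_mem by metis
    then have "inv rot z = tour y" using mate_eqs(1)[OF y True] by (simp add: tour_def)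
    moreover have "h (tour y) = h y - 1" using mate_eqs(1)[OF y True] tour_height[of y] by linarith
    ultimately show ?thesis
      using nin by (auto intro!: first_in.move stop)
  next
    case False
    define y' where "y' = gl (f y)"
    have "f y \<in> S" using y down_S f_in_S by auto
    then have y': "y' \<in> D" "h y' = h y"
      using gl_up False up height_down[OF y] by (auto simp: y'_def)
    have "first_in tour {w. h w \<le> h y' - 1} y' (inv rot z)"
    proof (rule move.hyps(3))
      show "\<rho> (gl y) = gl y'" using ry by (simp add: y'_def gl_gl')
      show "y' \<in> D" by fact
      fix y'' assume "y'' \<in> D" "h y'' = h y'" "f y'' \<notin> D"
      then show "first_in tour {w. h w \<le> h y''} (tour y'') (gl (f y''))"
        using y'(2) by (intro move.prems(2)) auto
    qed
    moreover have "first_in tour {w. h w \<le> h y} (tour y) y'"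
      using move.prems(2)[OF y _ False] by (simp add: y'_def)
    moreover have "{w. h w \<le> h y - 1} \<subseteq> {w. h w \<le> h y}" by auto
    ultimately have "first_in tour {w. h w \<le> h y - 1} (tour y) (inv rot z)"
      unfolding y'(2) using first_in_trans by metis
    then show ?thesis by (rule first_in.move[OF nin])
  qed
qed

text \<open>
  Induction from the largest label downwards.  If the face of \<open>y\<close> has opposite descents, the tour
  steps from \<open>y\<close> to \<open>gl (f y)\<close> at once.  Otherwise it climbs by one level, and from there
  \<open>first_descent_step\<close>, applied one level higher, brings it down to \<open>gl (f y)\<close>.
\<close>

lemma level_return:
  assumes "y \<in> D" "f y \<notin> D"
  shows "first_in tour {w. h w \<le> h y} (tour y) (gl (f y))"
  using assms
proof (induction "nat (Max (h ` S) - h y)" arbitrary: y rule: less_induct)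
  case less
  have y: "y \<in> D" "f y \<notin> D" by fact+
  have S: "y \<in> S" "f y \<in> S" "f (f y) \<in> S" using y down_S f_in_S by auto
  have gfy: "gl (f y) \<in> D" "h (gl (f y)) = h y"
    using gl_up[OF S(2) y(2)] up[OF S(2) y(2)] height_down[OF y(1)] by auto
  show ?case
  proof (cases "f (f y) \<in> D")
    case True
    then have "tour y = gl (f y)" by (rule tour_level[OF y])
    then show ?thesis using gfy by (auto intro!: stop)
  next
    case False
    note t = tour_second[OF y False]
    have "tour y \<in> S" using t down_S by auto
    then have "h (tour y) \<le> Max (h ` S)" using finite_S by auto
    then have less': "nat (Max (h ` S) - h y') < nat (Max (h ` S) - h y)" if "h y' = h (tour y)" for y'
      using that t(3) by linarith
    have "first_in \<rho> D (gl (tour y)) (rot (gl (f y)))"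
      using rot_first[OF gfy(1)] t(1) by (simp add: gl_gl')
    then have "first_in tour {w. h w \<le> h (tour y) - 1} (tour y) (inv rot (rot (gl (f y))))"
      proof (rule first_descent_step[OF _ t(2)])
      fix y' assume "y' \<in> D" "h y' = h (tour y)" "f y' \<notin> D"
      then show "first_in tour {w. h w \<le> h y'} (tour y') (gl (f y'))"
        by (intro less.hyps less')
    qed
    then show ?thesis using t(3) permutes_inverses(2)[OF rot_permutes] by simp
  qed
qed

lemma tour_down:
  assumes "first_in \<rho> D (gl y) z" "y \<in> D"
  shows "first_in tour {w. h w \<le> h y - 1} y (inv rot z)"
  by (rule first_descent_step[OF assms]) (rule level_return)

lemma permutation_tour: "permutation tour"
  by (rule permutation_D[OF tour_permutes])

lemma level_return_orbit: "y \<in> D \<Longrightarrow> f y \<notin> D \<Longrightarrow> gl (f y) \<in> orbit tour y"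
  using first_in_orbit[OF level_return[of y]] orbit.base[of tour y]
    orbit_subset[of "gl (f y)" tour y] by metis

text \<open>
  By \<open>tour_down\<close> the tour from \<open>y\<close> meets a lower corner at the end of \<open>y\<close>, unless \<open>y\<close> ends at the sink.
\<close>

lemma reaches_sink:
  assumes "y \<in> D"
  shows "\<exists>y0\<in>D. y0 \<in> orbit tour y \<and> orbit \<rho> (gl y0) \<inter> D = {}"
  using assms
proof (induction "nat (h y - Min (h ` S))" arbitrary: y rule: less_induct)
  case less
  show ?case
  proof (cases "orbit \<rho> (gl y) \<inter> D = {}")
    case True
    then show ?thesis using less.prems permutation_self_in_orbit[OF permutation_tour] by auto
  next
    case False
    then obtain z' where "z' \<in> D" "z' \<in> orbit \<rho> (gl y)" by auto
    then obtain z where "first_in \<rho> D (\<rho> (gl y)) z" using first_in_ex_orbit[of z' D \<rho> "gl y"] by auto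
    then have z: "first_in \<rho> D (gl y) z" by (rule first_in.move[OF gl_down[OF less.prems]])
    define y' where "y' = inv rot z"
    have y': "y' \<in> D" unfolding y'_def
      using first_in_mem[OF z] permutes_in_image[OF permutes_inv[OF rot_permutes]] by metis
    have fi: "first_in tour {w. h w \<le> h y - 1} y y'"
      unfolding y'_def by (rule tour_down[OF z less.prems])
    have "h y' < h y" using first_in_mem[OF fi] by auto
    moreover have "Min (h ` S) \<le> h y'" using finite_S down_S[OF y'] by auto
    ultimately have "nat (h y' - Min (h ` S)) < nat (h y - Min (h ` S))" by linarith
    from less.hyps[OF this y'] obtain y0 where y0: "y0 \<in> D" "y0 \<in> orbit tour y'"
      "orbit \<rho> (gl y0) \<inter> D = {}" by auto
    have "y' \<in> orbit tour y"
      using first_in_orbit[OF fi] permutation_self_in_orbit[OF permutation_tour, of y] by auto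
    with y0(2) have "y0 \<in> orbit tour y" by (rule orbit_trans)
    then show ?thesis using y0(1,3) by auto
  qed
qed

text \<open>
  Every cycle of the tour contains a side that ends at the sink.  All sides that end at the sink lie
  on the same cycle, because turning around the sink from one of them to the next is a step from
  \<open>y\<close> to \<open>gl (f y)\<close> as in \<open>level_return\<close>.
\<close>

lemma tour_cyclic: "cyclic_on tour D"
proof -
  obtain d where d: "d \<in> D" using D_nonempty by auto
  obtain y0 where y0: "y0 \<in> D" "orbit \<rho> (gl y0) \<inter> D = {}" using reaches_sink[OF d] by auto
  have sink_orbit: "gl u \<in> D \<and> gl u \<in> orbit tour y0" if "u \<in> orbit \<rho> (gl y0)" for u
    using that
  proof induction
    case base
    have "f y0 \<in> orbit \<rho> (gl y0)" using orbit.base[of \<rho> "gl y0"] by (simp add: gl_gl')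
    then have "f y0 \<notin> D" using y0 by auto
    moreover have "f y0 \<in> S" using y0 down_S f_in_S by auto
    ultimately show ?case using y0(1) level_return_orbit gl_up by (simp add: gl_gl')
  next
    case (step u)
    have "f (gl u) \<in> orbit \<rho> (gl y0)" using orbit.step[OF step.hyps] by simp
    then have "f (gl u) \<notin> D" using y0 by auto
    moreover have "f (gl u) \<in> S" using step down_S f_in_S by auto
    ultimately show ?case
      using step.IH orbit_trans[OF level_return_orbit[of "gl u"], of y0] gl_up by (auto simp: gl_gl')
  qed
  have "y0 \<in> orbit tour y" if y: "y \<in> D" for y
  proof -
    obtain y1 where y1: "y1 \<in> D" "y1 \<in> orbit tour y" "orbit \<rho> (gl y1) \<inter> D = {}"
      using reaches_sink[OF y] by auto
    have "gl y0 \<in> S" "gl y1 \<in> S" using y0 y1 down_S gl_in_S by auto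
    then have "orbit \<rho> (gl y0) = orbit \<rho> (gl y1)"
      using orbit_singleton_card[OF sink] y0 y1 by blast
    then have "gl y1 \<in> orbit \<rho> (gl y0)" using permutation_self_in_orbit[OF rho] by auto
    then have "y1 \<in> orbit tour y0" using sink_orbit gl_gl' by metis
    then show ?thesis using orbit_perm_sym[OF permutation_tour] y1(2) orbit_trans by metis
  qed
  then have "y \<in> orbit tour y0" if "y \<in> D" for y
    using that orbit_perm_sym[OF permutation_tour] by auto
  moreover have "orbit tour y0 \<subseteq> D" by (rule permutes_orbit_subset[OF tour_permutes y0(1)])
  ultimately show ?thesis using y0(1) by (auto simp: cyclic_on_def)
qed

lemma scheme_of_quad: "scheme rot mate"
  using rot_permutes mate_permutes mate_invol mate_height rot_height tour_cyclic
  by (auto simp: scheme_def tour_def)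

lemma ncyc_rot: "ncyc \<rho> S = ncyc rot D + 1"
  unfolding rot_def using ncyc_induced[OF rho finite_S D_subset] sink by simp

text \<open>
  By \<open>level_return\<close>, the values of \<open>f\<close> on descending sides can be read off the one-face map and its
  labels.  The remaining values are then forced, since every face has length four.
\<close>

lemma f_on_D:
  assumes y: "y \<in> D"
  shows "f y = (if h (mate y) = h y - 1 then mate y else gl (induced tour {w \<in> D. h w = h y} y))"
proof (cases "f y \<in> D")
  case True
  then have "mate y = f y" "h (f y) = h y - 1" using mate_eqs(1)[OF y] by auto
  then show ?thesis by simp
next
  case False
  have S: "f y \<in> S" using y down_S f_in_S by auto
  have "gl (f y) \<in> D" "h (gl (f y)) = h y"
    using gl_up[OF S False] up[OF S False] height_down[OF y] by auto
  then have "first_in tour {w \<in> D. h w = h y} (tour y) (gl (f y))"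
    by (intro first_in_mono[OF level_return[OF y False]]) auto
  then have "induced tour {w \<in> D. h w = h y} y = gl (f y)"
    by (intro induced_eqI) (use y in auto)
  moreover have "h (mate y) \<noteq> h y - 1"
    using mate_eqs(2,3)[OF y False] by (cases "f (f y) \<in> D") linarith+
  ultimately show ?thesis by (simp add: gl_gl')
qed

lemma f_f:
  assumes d: "d \<in> D"
  shows "h (mate d) = h d \<Longrightarrow> f (f d) = mate d"
    and "h (mate d) = h d + 1 \<Longrightarrow> f (f d) = gl (tour d) \<and> f (gl (tour d)) = mate d"
proof -
  show "h (mate d) = h d \<Longrightarrow> f (f d) = mate d"
    using mate_eqs[OF d] by (cases "f d \<in> D"; cases "f (f d) \<in> D") auto
  assume *: "h (mate d) = h d + 1"
  then have n: "f d \<notin> D" "f (f d) \<notin> D" using mate_eqs[OF d] by auto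
  show "f (f d) = gl (tour d) \<and> f (gl (tour d)) = mate d"
    using tour_second(1)[OF d n] mate_eqs(3)[OF d n] by (simp add: gl_gl')
qed

text \<open>
  In a face with opposite descents an ascending side follows a descending one.  In a face with
  consecutive descents the two ascending sides follow the second descent; the first of them is
  \<open>f d\<close> and the second is \<open>gl (tour d)\<close>.
\<close>

lemma up_cases:
  assumes u: "u \<in> S" "u \<notin> D"
  obtains (level) d where "d \<in> D" "h (mate d) = h d" "u = f d"
  | (one) d where "d \<in> D" "h (mate d) = h d + 1" "u = f d"
  | (two) d where "d \<in> D" "h (mate d) = h d + 1" "u = gl (tour d)"
proof -
  have S: "f u \<in> S" "f (f u) \<in> S" "f (f (f u)) \<in> S" using u f_in_S by auto
  note fc = face(1)[OF u(1)]
  show ?thesis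
  proof (cases "f (f (f u)) \<in> D")
    case True
    then show ?thesis using that(1,2)[OF True] mate_eqs(2,3)[OF True] fc u by (cases "f u \<in> D") auto
  next
    case False
    then have d: "f (f u) \<in> D"
      using height_up[OF u] height_up[OF S(1)] height_up[OF S(2)] height_up[OF S(3)]
        height_down[of "f u"] fc by (cases "f u \<in> D") fastforce+
    have n: "f (f (f u)) \<notin> D" "f (f (f (f u))) \<notin> D" using False u fc by auto
    show ?thesis using that(3)[OF d] mate_eqs(3)[OF d n] tour_second(1)[OF d n] fc gl_gl' by metis
  qed
qed

end

context height_sides
begin

definition quads :: "nat \<Rightarrow> ('a \<Rightarrow> 'a) set" where
  "quads k = {f. quad f \<and> ncyc (f \<circ> gl) S = k}"

definition schemes :: "nat \<Rightarrow> (('a \<Rightarrow> 'a) \<times> ('a \<Rightarrow> 'a)) set" where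
  "schemes k = {(\<sigma>, \<alpha>). scheme \<sigma> \<alpha> \<and> ncyc \<sigma> D = k}"

lemma quad_eqI:
  assumes "quad f" "quad f'"
    and rot: "height_quad.rot S gl h f = height_quad.rot S gl h f'"
    and mate: "height_quad.mate S gl h f = height_quad.mate S gl h f'"
  shows "f = f'"
proof
  interpret a: height_quad S gl h f by unfold_locales fact
  interpret b: height_quad S gl h f' by unfold_locales fact
  have tour: "a.tour = b.tour" by (simp add: a.tour_def b.tour_def rot mate)
  have D: "f d = f' d" if "d \<in> D" for d
    using a.f_on_D[OF that] b.f_on_D[OF that] by (simp add: tour mate)
  fix s
  show "f s = f' s"
  proof (cases "s \<in> S - D")
    case True
    then have s: "s \<in> S" "s \<notin> D" by auto
    have b_f_f: "h (a.mate d) = h d \<Longrightarrow> f' (f' d) = a.mate d"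
      "h (a.mate d) = h d + 1 \<Longrightarrow> f' (f' d) = gl (a.tour d) \<and> f' (gl (a.tour d)) = a.mate d"
      if "d \<in> D" for d
      using b.f_f[OF that] by (simp_all add: tour mate)
    from s show ?thesis
    proof (cases rule: a.up_cases)
      case (level d)
      then show ?thesis using a.f_f(1) b_f_f(1) D by metis
    next
      case (one d)
      then show ?thesis using a.f_f(2) b_f_f(2) D by metis
    next
      case (two d)
      then show ?thesis using a.f_f(2) b_f_f(2) by metis
    qed
  next
    case False
    then show ?thesis using D permutes_not_in[OF a.f] permutes_not_in[OF b.f] by (cases "s \<in> S") auto
  qed
qed

lemma finite_schemes: "finite (schemes k)"
  by (rule finite_subset[of _ "{p. p permutes D} \<times> {p. p permutes D}"])
    (auto simp: schemes_def scheme_def finite_permutations finite_D)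

lemma finite_quads: "finite (quads k)"
  by (rule finite_subset[OF _ finite_permutations[OF finite_S]]) (auto simp: quads_def quad_def)

lemma card_quads_le: "card (quads (Suc k)) \<le> card (schemes k)"
proof (rule card_inj_on_le[OF _ _ finite_schemes])
  let ?open = "\<lambda>f. (height_quad.rot S gl h f, height_quad.mate S gl h f)"
  show "inj_on ?open (quads (Suc k))"
    using quad_eqI by (intro inj_onI) (auto simp: quads_def)
  show "?open ` quads (Suc k) \<subseteq> schemes k"
  proof
    fix x assume "x \<in> ?open ` quads (Suc k)"
    then obtain f where q: "quad f" "ncyc (f \<circ> gl) S = Suc k" and x: "x = ?open f"
      by (auto simp: quads_def)
    interpret height_quad S gl h f by unfold_locales fact
    show "x \<in> schemes k" using x q(2) scheme_of_quad ncyc_rot by (auto simp: schemes_def)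
  qed
qed

end


section \<open>Reconstructing a quadrangulation from a one-face scheme\<close>

locale height_scheme = height_sides +
  fixes \<sigma> \<alpha> :: "'a \<Rightarrow> 'a"
  assumes scheme: "scheme \<sigma> \<alpha>"
begin

definition \<tau> :: "'a \<Rightarrow> 'a" where "\<tau> = inv \<sigma> \<circ> \<alpha>"

lemma sigma: "\<sigma> permutes D" and alpha: "\<alpha> permutes D"
  and alpha_alpha: "\<And>d. d \<in> D \<Longrightarrow> \<alpha> (\<alpha> d) = d" and alpha_neq: "\<And>d. d \<in> D \<Longrightarrow> \<alpha> d \<noteq> d"
  and height_alpha: "\<And>d. d \<in> D \<Longrightarrow> \<bar>h (\<alpha> d) - h d\<bar> \<le> 1"
  and height_sigma': "\<And>d. d \<in> D \<Longrightarrow> h (\<sigma> d) = h d"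
  and cyclic: "cyclic_on \<tau> D"
  using scheme by (auto simp: scheme_def \<tau>_def)

lemma tau: "\<tau> permutes D"
  unfolding \<tau>_def by (intro permutes_compose permutes_inv alpha sigma)

lemma in_D [simp]: "\<sigma> d \<in> D \<longleftrightarrow> d \<in> D" "\<alpha> d \<in> D \<longleftrightarrow> d \<in> D" "\<tau> d \<in> D \<longleftrightarrow> d \<in> D"
  "inv \<tau> d \<in> D \<longleftrightarrow> d \<in> D"
  by (rule permutes_in_image, rule sigma alpha tau permutes_inv[OF tau])+

lemma perm_tau: "permutation \<tau>" by (rule permutation_D[OF tau])

lemma height_sigma: "h (\<sigma> d) = h d"
  using height_sigma' permutes_not_in[OF sigma] by (cases "d \<in> D") auto

lemma sigma_tau: "\<sigma> (\<tau> d) = \<alpha> d"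
  by (simp add: \<tau>_def permutes_inverses(1)[OF sigma])

lemma height_tau: "h (\<tau> d) = h (\<alpha> d)"
  using height_sigma[of "\<tau> d"] sigma_tau by simp

lemma height_step: "d \<in> D \<Longrightarrow> \<bar>h (\<tau> d) - h d\<bar> \<le> 1"
  using height_alpha by (simp add: height_tau)

lemma inv_tau: "inv \<tau> (\<tau> d) = d" "\<tau> (inv \<tau> d) = d"
  by (rule permutes_inverses[OF tau])+

abbreviation level :: "int \<Rightarrow> 'a set" where "level L \<equiv> {w \<in> D. h w = L}"

definition ret :: "'a \<Rightarrow> 'a" where "ret d = induced \<tau> (level (h d)) d"

lemma first_in_ret: "d \<in> D \<Longrightarrow> first_in \<tau> (level (h d)) (\<tau> d) (ret d)"
  unfolding ret_def by (rule first_in_induced[OF perm_tau]) auto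

lemma ret_in: "d \<in> D \<Longrightarrow> ret d \<in> D" and height_ret: "d \<in> D \<Longrightarrow> h (ret d) = h d"
  using first_in_mem[OF first_in_ret[of d]] by auto

lemma ret_permutes: "ret permutes D"
proof (rule inj_imp_permutes)
  show "inj_on ret D"
  proof (rule inj_onI)
    fix x y assume xy: "x \<in> D" "y \<in> D" "ret x = ret y"
    have "h x = h y" using height_ret[OF xy(1)] height_ret[OF xy(2)] xy(3) by simp
    then have "induced \<tau> (level (h x)) x = induced \<tau> (level (h x)) y"
      using xy(3) by (simp add: ret_def)
    moreover have "inj (induced \<tau> (level (h x)))"
      by (rule permutes_inj, rule induced_permutes[OF perm_tau]) (use finite_D in auto)
    ultimately show "x = y" by (auto dest: injD)
  qed
  show "ret x = x" if "x \<notin> D" for x using that by (simp add: ret_def induced_def)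
qed (use finite_D ret_in in auto)

text \<open>
  The tour changes the label by at most one per step, so it cannot get below a level without
  meeting it.
\<close>

lemma first_in_above:
  assumes "first_in \<tau> (level L) x z" "x \<in> D" "L \<le> h x"
  shows "first_in \<tau> {w. h w \<le> L} x z"
  using assms
proof (induction rule: first_in.induct)
  case (stop x)
  then show ?case by (auto intro: first_in.stop)
next
  case (move x z)
  then have "L < h x" by auto
  then have "L \<le> h (\<tau> x)" using height_step[OF move.prems(1)] by linarith
  then have "first_in \<tau> {w. h w \<le> L} (\<tau> x) z" using move by auto
  then show ?case using \<open>L < h x\<close> by (auto intro: first_in.move)
qed

text \<open>
  For the same reason, the tour comes back to a level from the side on which it left it.
\<close>

lemma above_before:
  assumes "first_in \<tau> (level L) x z" "x \<in> D" "L < h x"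
  shows "L < h (inv \<tau> z)"
  using assms
proof (induction rule: first_in.induct)
  case (move x z)
  show ?case
  proof (cases "h (\<tau> x) = L")
    case True
    then have "z = \<tau> x" using move.hyps(2) move.prems first_in_from_mem[of "\<tau> x" "level L"] by auto
    then show ?thesis using move.prems inv_tau by simp
  next
    case False
    then have "L < h (\<tau> x)" using height_step[OF move.prems(1)] move.prems(2) by linarith
    then show ?thesis using move by auto
  qed
qed auto

lemma below_before:
  assumes "first_in \<tau> (level L) x z" "x \<in> D" "h x < L"
  shows "h (inv \<tau> z) < L"
  using assms
proof (induction rule: first_in.induct)
  case (move x z)
  show ?case
  proof (cases "h (\<tau> x) = L")
    case True
    then have "z = \<tau> x" using move.hyps(2) move.prems first_in_from_mem[of "\<tau> x" "level L"] by auto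
    then show ?thesis using move.prems inv_tau by simp
  next
    case False
    then have "h (\<tau> x) < L" using height_step[OF move.prems(1)] move.prems(2) by linarith
    then show ?thesis using move by auto
  qed
qed auto

lemma ret_level: "d \<in> D \<Longrightarrow> h (\<tau> d) = h d \<Longrightarrow> ret d = \<tau> d"
  using first_in_ret[of d] first_in_from_mem[of "\<tau> d" "level (h d)" \<tau>] by auto

lemma ret_up: "d \<in> D \<Longrightarrow> h d \<le> h (\<tau> d) \<Longrightarrow> first_in \<tau> {w. h w \<le> h d} (\<tau> d) (ret d)"
  using first_in_above[OF first_in_ret] by auto

lemma before_ret:
  assumes "d \<in> D" shows "h d < h (inv \<tau> (ret d)) \<longleftrightarrow> h d < h (\<tau> d)"
proof -
  consider "h d < h (\<tau> d)" | "h (\<tau> d) = h d" | "h (\<tau> d) < h d" by linarith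
  then show ?thesis
  proof cases
    case 1
    then show ?thesis using above_before[OF first_in_ret[OF assms]] assms by simp
  next
    case 2
    then show ?thesis using ret_level[OF assms] inv_tau by simp
  next
    case 3
    then show ?thesis using below_before[OF first_in_ret[OF assms]] assms by simp
  qed
qed

text \<open>
  The inverse construction, as dictated by the shape of the faces.  After a descending side \<open>s\<close>
  comes the dart matched to \<open>s\<close> if that dart is lower, and otherwise the reverse of the next dart
  on the tour with the label of \<open>s\<close>.  An ascending side \<open>gl x\<close> is of one of two sorts, told apart by the
  label of the dart before \<open>x\<close> on the tour: if that label is at most \<open>h x\<close>, then the face goes on with
  a descending side, and this is \<open>\<sigma> x\<close>; otherwise the tour has just come
  down to \<open>x\<close> from an excursion that began at \<open>inv ret x\<close>, and \<open>gl x\<close> is followed by the reverse of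
  the first dart of that excursion.
\<close>

definition cl :: "'a \<Rightarrow> 'a" where
  "cl s = (if s \<in> D then if h (\<alpha> s) = h s - 1 then \<alpha> s else gl (ret s)
     else if s \<in> S then
       if h (inv \<tau> (gl s)) \<le> h (gl s) then \<sigma> (gl s) else gl (\<tau> (inv ret (gl s)))
     else s)"

lemma cl_first: "d \<in> D \<Longrightarrow> h (\<alpha> d) = h d - 1 \<Longrightarrow> cl d = \<alpha> d"
  by (simp add: cl_def)

lemma cl_other: "d \<in> D \<Longrightarrow> h d \<le> h (\<alpha> d) \<Longrightarrow> cl d = gl (ret d)"
  by (simp add: cl_def)

lemma cl_gl: "x \<in> D \<Longrightarrow> cl (gl x) =
   (if h (inv \<tau> x) \<le> h x then \<sigma> x else gl (\<tau> (inv ret x)))"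
  using gl_down[of x] down_S[of x] by (simp add: cl_def gl_gl' gl_in_S)

lemma cl_gl_ret: "d \<in> D \<Longrightarrow> h (\<alpha> d) = h d + 1 \<Longrightarrow> cl (gl (ret d)) = gl (\<tau> d)"
  using cl_gl[OF ret_in[of d]] before_ret[of d] height_ret[of d] permutes_inverses(2)[OF ret_permutes]
  by (simp add: height_tau)

lemma cl_gl_tau: "d \<in> D \<Longrightarrow> h d \<le> h (\<alpha> d) \<Longrightarrow> cl (gl (\<tau> d)) = \<alpha> d"
  using cl_gl[of "\<tau> d"] inv_tau height_tau sigma_tau by simp

lemma tau_inj: "\<tau> x = \<tau> y \<longleftrightarrow> x = y"
  using permutes_inj[OF tau] by (auto dest: injD)

lemma gl_inj: "gl x = gl y \<longleftrightarrow> x = y"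
  using gl_gl' by metis

text \<open>
  The face that contains \<open>d\<close> and \<open>\<alpha> d\<close>, listed from the lower of the two darts; the other two
  sides are ascending.
\<close>

lemma closed_face:
  assumes d: "d \<in> D" "h d \<le> h (\<alpha> d)"
  shows "cl (cl (cl (cl d))) = d" "distinct [d, cl d, cl (cl d), cl (cl (cl d))]"
    and "gl (\<tau> d) \<in> {cl d, cl (cl d)}" "\<alpha> d \<in> {cl (cl d), cl (cl (cl d))}"
proof -
  have ad: "\<alpha> d \<in> D" "\<alpha> (\<alpha> d) = d" "\<alpha> d \<noteq> d" using d alpha_alpha alpha_neq by auto
  have n: "gl x \<noteq> y" "y \<noteq> gl x" if "x \<in> D" "y \<in> D" for x y using that gl_down by auto
  have "cl (cl (cl (cl d))) = d \<and> distinct [d, cl d, cl (cl d), cl (cl (cl d))] \<and>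
    gl (\<tau> d) \<in> {cl d, cl (cl d)} \<and> \<alpha> d \<in> {cl (cl d), cl (cl (cl d))}"
  proof (cases "h (\<alpha> d) = h d")
    case True
    have 1: "cl d = gl (\<tau> d)" using cl_other[OF d] ret_level[OF d(1)] True by (simp add: height_tau)
    have 2: "cl (gl (\<tau> d)) = \<alpha> d" by (rule cl_gl_tau[OF d])
    have 3: "cl (\<alpha> d) = gl (\<tau> (\<alpha> d))"
      using cl_other[OF ad(1)] ret_level[OF ad(1)] True ad by (simp add: height_tau)
    have 4: "cl (gl (\<tau> (\<alpha> d))) = d" using cl_gl_tau[OF ad(1)] True ad by simp
    show ?thesis using 1 2 3 4 ad d n by (simp add: tau_inj gl_inj)
  next
    case False
    then have up: "h (\<alpha> d) = h d + 1" using d height_alpha[OF d(1)] by linarith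
    have 1: "cl d = gl (ret d)" by (rule cl_other[OF d])
    have 2: "cl (gl (ret d)) = gl (\<tau> d)" by (rule cl_gl_ret[OF d(1) up])
    have 3: "cl (gl (\<tau> d)) = \<alpha> d" by (rule cl_gl_tau[OF d])
    have 4: "cl (\<alpha> d) = d" using cl_first[OF ad(1)] ad up by simp
    have "h (ret d) \<noteq> h (\<tau> d)" using height_ret[OF d(1)] up height_tau by simp
    then have "ret d \<noteq> \<tau> d" by auto
    then show ?thesis using 1 2 3 4 ad d n ret_in by (auto simp: gl_inj)
  qed
  then show "cl (cl (cl (cl d))) = d" "distinct [d, cl d, cl (cl d), cl (cl (cl d))]"
    "gl (\<tau> d) \<in> {cl d, cl (cl d)}" "\<alpha> d \<in> {cl (cl d), cl (cl (cl d))}" by blast+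
qed

lemma step_back_ret:
  assumes x: "x \<in> D" "h x < h (inv \<tau> x)"
  defines "d \<equiv> inv ret x"
  shows "d \<in> D" "ret d = x" "h d = h x" "h (\<tau> d) = h d + 1" "h (\<alpha> d) = h d + 1"
proof -
  show d: "d \<in> D" unfolding d_def using permutes_in_image[OF permutes_inv[OF ret_permutes]] x by auto
  show r: "ret d = x" unfolding d_def by (rule permutes_inverses(1)[OF ret_permutes])
  show hd: "h d = h x" using height_ret[OF d] r by simp
  have "h d < h (\<tau> d)" using before_ret[OF d] r x hd by simp
  then show "h (\<tau> d) = h d + 1" using height_step[OF d] by linarith
  then show "h (\<alpha> d) = h d + 1" by (simp add: height_tau)
qed

lemma face_cover:
  assumes "s \<in> S"
  obtains d where "d \<in> D" "h d \<le> h (\<alpha> d)" "s \<in> {d, cl d, cl (cl d), cl (cl (cl d))}"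
proof (cases "s \<in> D")
  case True
  show ?thesis
  proof (cases "h s \<le> h (\<alpha> s)")
    case True
    then show ?thesis using that \<open>s \<in> D\<close> by blast
  next
    case False
    then have "h (\<alpha> s) \<le> h (\<alpha> (\<alpha> s))" "\<alpha> s \<in> D" using alpha_alpha[OF True] True by auto
    moreover have "s \<in> {\<alpha> s, cl (\<alpha> s), cl (cl (\<alpha> s)), cl (cl (cl (\<alpha> s)))}"
      using closed_face(4)[OF \<open>\<alpha> s \<in> D\<close>] calculation(1) alpha_alpha[OF True] by auto
    ultimately show ?thesis using that by metis
  qed
next
  case False
  define x where "x = gl s"
  have x: "x \<in> D" "s = gl x" using gl_up[OF assms False] by (auto simp: x_def gl_gl')
  show ?thesis
  proof (cases "h (inv \<tau> x) \<le> h x")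
    case True
    then have "h (inv \<tau> x) \<le> h (\<alpha> (inv \<tau> x))" using inv_tau(2) by (simp flip: height_tau)
    then show ?thesis
      using that[of "inv \<tau> x"] closed_face(3)[of "inv \<tau> x"] x inv_tau(2) by auto
  next
    case False
    then have "h x < h (inv \<tau> x)" by simp
    note d = step_back_ret[OF x(1) this]
    show ?thesis using that[OF d(1)] d cl_other[OF d(1)] x by auto
  qed
qed

lemma cl_in_S: "s \<in> S \<Longrightarrow> cl s \<in> S"
proof -
  have "inv ret x \<in> D" if "x \<in> D" for x
    using that permutes_in_image[OF permutes_inv[OF ret_permutes]] by auto
  then show "s \<in> S \<Longrightarrow> cl s \<in> S"
    using down_S gl_up[of s] gl_in_S ret_in in_D by (auto simp: cl_def)
qed

lemma cl_cycle4:
  assumes "s \<in> S" shows "cl (cl (cl (cl s))) = s"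
proof -
  obtain d where d: "d \<in> D" "h d \<le> h (\<alpha> d)" and s: "s \<in> {d, cl d, cl (cl d), cl (cl (cl d))}"
    using face_cover[OF assms] by metis
  have "cl (cl (cl (cl d))) = d" by (rule closed_face(1)[OF d])
  then show ?thesis using s by auto
qed

lemma cl_permutes: "cl permutes S"
proof (rule inj_imp_permutes)
  show "inj_on cl S" by (rule inj_on_inverseI[of _ "\<lambda>s. cl (cl (cl s))"]) (rule cl_cycle4)
qed (use finite_S cl_in_S D_subset in \<open>auto simp: cl_def\<close>)

lemma card_cl_orbit:
  assumes "s \<in> S" shows "card (orbit cl s) = 4"
proof -
  obtain d where d: "d \<in> D" "h d \<le> h (\<alpha> d)" and s: "s \<in> {d, cl d, cl (cl d), cl (cl (cl d))}"
    using face_cover[OF assms] by metis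
  let ?X = "{d, cl d, cl (cl d), cl (cl (cl d))}"
  note c4 = closed_face(1)[OF d]
  have "orbit cl d \<subseteq> ?X" by (rule orbit_subset_closed) (use c4 in auto)
  moreover have m: "cl d \<in> orbit cl d" "cl (cl d) \<in> orbit cl d" "cl (cl (cl d)) \<in> orbit cl d"
    by (intro orbit.intros)+
  moreover have "d \<in> orbit cl d" using orbit.step[OF m(3)] c4 by simp
  ultimately have X: "orbit cl d = ?X" by auto
  have "permutation cl" by (rule permutation_S[OF cl_permutes])
  moreover have "s \<in> orbit cl d" using X s by simp
  ultimately have "orbit cl s = ?X" using orbit_perm_eq X by metis
  then show ?thesis using closed_face(2)[OF d] by simp
qed

lemma height_cl:
  assumes "s \<in> S" shows "h (cl s) = h (gl s)"
proof (cases "s \<in> D")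
  case True
  then show ?thesis using down[OF True] down[OF ret_in[OF True]] height_ret[OF True]
    by (auto simp: cl_def)
next
  case False
  define x where "x = gl s"
  have x: "x \<in> D" "s = gl x" using gl_up[OF assms False] by (auto simp: x_def gl_gl')
  show ?thesis
  proof (cases "h (inv \<tau> x) \<le> h x")
    case True
    then show ?thesis using cl_gl[OF x(1)] x height_sigma gl_gl' by simp
  next
    case False
    then have "h x < h (inv \<tau> x)" by simp
    note d = step_back_ret[OF x(1) this]
    have "\<tau> (inv ret x) \<in> D" using d by simp
    then show ?thesis using cl_gl[OF x(1)] False x d down gl_gl' by simp
  qed
qed

abbreviation \<rho> where "\<rho> \<equiv> cl \<circ> gl"

lemma perm_rho: "permutation \<rho>"
  using permutes_compose[OF gl cl_permutes] by (rule permutation_S)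

text \<open>
  Between \<open>d\<close> and \<open>\<sigma> d\<close> the closed surface has an ascending side \<open>gl z\<close> for each dart \<open>z\<close> of
  label \<open>h d + 1\<close> in the excursion of the tour above the label of \<open>d\<close> that ends at \<open>d\<close>.  Induction along
  this excursion, where \<open>z1\<close> is the first dart of label \<open>h d + 1\<close> from \<open>z\<close> on.
\<close>

lemma rotation_chain:
  assumes "first_in \<tau> {w. h w \<le> L} z d" "z \<in> D" "L < h z" "d \<in> D" "h d = L"
  shows "\<exists>z1\<in>D. first_in \<tau> {w. h w \<le> L + 1} z z1 \<and> first_in \<rho> D (gl z1) (\<sigma> d)"
  using assms
proof (induction rule: first_in.induct)
  case (stop x)
  then show ?case by auto
next
  case (move z d)
  have rz: "\<rho> (gl z) = cl z" by (simp add: gl_gl')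
  have gz: "gl z \<notin> D" by (rule gl_down) fact
  show ?case
  proof (cases "h (\<tau> z) \<le> L")
    case True
    then have d: "d = \<tau> z"
      using move.hyps(2) first_in_from_mem[of "\<tau> z" "{w. h w \<le> L}" \<tau>] by auto
    then have hz: "h z = L + 1" using height_step[OF move.prems(1)] move.prems(2,4) by simp
    then have "cl z = \<sigma> d"
      using cl_first[OF move.prems(1)] d sigma_tau height_tau move.prems(4) by simp
    then have "first_in \<rho> D (\<rho> (gl z)) (\<sigma> d)"
      using rz move.prems by (auto intro!: stop)
    then have "first_in \<rho> D (gl z) (\<sigma> d)" by (rule first_in.move[OF gz])
    moreover have "first_in \<tau> {w. h w \<le> L + 1} z z" using hz by (intro first_in.stop) auto
    ultimately show ?thesis using move.prems(1) by blast
  next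
    case False
    then have lt: "L < h (\<tau> z)" by simp
    then obtain z1 where z1: "z1 \<in> D" "first_in \<tau> {w. h w \<le> L + 1} (\<tau> z) z1"
      "first_in \<rho> D (gl z1) (\<sigma> d)"
      using move.IH[OF _ lt move.prems(3,4)] move.prems(1) in_D(3) by blast
    show ?thesis
    proof (cases "h z = L + 1")
      case True
      then have "first_in \<tau> {w. h w \<le> L + 1} (\<tau> z) (ret z)"
        using ret_up[OF move.prems(1)] lt by simp
      then have "ret z = z1" using z1(2) first_in_unique by metis
      then have "\<rho> (gl z) = gl z1"
        using rz cl_other[OF move.prems(1)] lt True height_tau by simp
      then have "first_in \<rho> D (gl z) (\<sigma> d)" using z1(3) first_in.move[OF gz] by metis
      moreover have "first_in \<tau> {w. h w \<le> L + 1} z z" using True by (intro first_in.stop) auto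
      ultimately show ?thesis using move.prems(1) by blast
    next
      case False
      then have "z \<notin> {w. h w \<le> L + 1}" using move.prems(2) by auto
      then show ?thesis using z1 first_in.move by metis
    qed
  qed
qed

lemma induced_rho: "induced \<rho> D = \<sigma>"
proof
  fix d
  show "induced \<rho> D d = \<sigma> d"
  proof (cases "d \<in> D")
    case True
    have "first_in \<rho> D (\<rho> d) (\<sigma> d)"
    proof (cases "h (inv \<tau> d) \<le> h d")
      case le: True
      then show ?thesis using cl_gl[OF True] True by (auto intro!: stop)
    next
      case False
      then have "h d < h (inv \<tau> d)" by simp
      note y = step_back_ret[OF True this]
      define y where "y = inv ret d"
      have "first_in \<tau> {w. h w \<le> h d} (\<tau> y) d"
        using ret_up[OF y(1)] y by (simp add: y_def)
      then obtain z1 where z1: "first_in \<tau> {w. h w \<le> h d + 1} (\<tau> y) z1" "first_in \<rho> D (gl z1) (\<sigma> d)"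
        using rotation_chain[of "h d" "\<tau> y" d] y True by (auto simp: y_def)
      have "z1 = \<tau> y" using z1(1) y first_in_from_mem[of "\<tau> y" "{w. h w \<le> h d + 1}"]
        by (simp add: y_def)
      then show ?thesis using z1(2) cl_gl[OF True] False by (simp add: y_def)
    qed
    then show ?thesis by (rule induced_eqI[OF True])
  next
    case False
    then show ?thesis using permutes_not_in[OF sigma] by (simp add: induced_def)
  qed
qed

lemma orbit_tau: "d \<in> D \<Longrightarrow> orbit \<tau> d = D"
  by (rule orbit_cyclic_eq3[OF cyclic])

lemma orbit_ret:
  assumes z: "z \<in> D" and X: "z \<in> X" "\<And>w. w \<in> X \<Longrightarrow> w \<in> level (h z) \<Longrightarrow> ret w \<in> X"
  shows "level (h z) \<subseteq> X"
proof -
  let ?p = "induced \<tau> (level (h z))"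
  have "orbit ?p z \<subseteq> X \<inter> level (h z)"
  proof (rule orbit_subset_closed)
    show "z \<in> X \<inter> level (h z)" using z X by auto
    fix w assume w: "w \<in> X \<inter> level (h z)"
    then have "?p w = ret w" by (simp add: ret_def)
    then show "?p w \<in> X \<inter> level (h z)" using w X(2) ret_in height_ret by auto
  qed
  moreover have "orbit ?p z = level (h z)"
    using orbit_induced[OF perm_tau, of z "level (h z)"] orbit_tau[OF z] z by auto
  ultimately show ?thesis by auto
qed

text \<open>
  An orbit of the rotation without descending sides is closed under returns to its level, hence
  contains the reverses of all darts of that level.  No dart of the level then takes a step down, so
  the level is the lowest one.  Conversely the reverses of the lowest darts form such an orbit.
\<close>

lemma one_sink: "card {C \<in> orbit \<rho> ` S. C \<inter> D = {}} = 1"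
proof -
  define m where "m = Min (h ` D)"
  have "m \<in> h ` D" unfolding m_def using finite_D D_nonempty by simp
  then obtain z0 where z0: "z0 \<in> D" "h z0 = m" by auto
  have min: "m \<le> h d" if "d \<in> D" for d unfolding m_def using finite_D that by simp
  have "orbit \<rho> (gl z0) \<subseteq> gl ` level m"
  proof (rule orbit_subset_closed)
    show "gl z0 \<in> gl ` level m" using z0 by auto
    fix u assume "u \<in> gl ` level m"
    then obtain w where w: "w \<in> D" "h w = m" "u = gl w" by auto
    then have "\<rho> u = gl (ret w)" using cl_other[of w] min[of "\<alpha> w"] by (simp add: gl_gl')
    then show "\<rho> u \<in> gl ` level m" using ret_in height_ret w by auto
  qed
  then have sink0: "orbit \<rho> (gl z0) \<inter> D = {}" using gl_down by blast
  have "C = orbit \<rho> (gl z0)" if C: "C \<in> orbit \<rho> ` S" "C \<inter> D = {}" for C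
  proof -
    obtain s where s: "s \<in> S" "C = orbit \<rho> s" using C by auto
    then have sC: "s \<in> C" using permutation_self_in_orbit[OF perm_rho] by auto
    then have "s \<notin> D" using C by auto
    define z where "z = gl s"
    have z: "z \<in> D" "gl z \<in> C" using gl_up[OF s(1) \<open>s \<notin> D\<close>] sC by (auto simp: z_def gl_gl')
    have step: "h w \<le> h (\<tau> w) \<and> gl (ret w) \<in> C" if "w \<in> D" "gl w \<in> C" for w
    proof -
      have in_C: "cl w \<in> C" using orbit.step[of "gl w" \<rho> s] that s by (simp add: gl_gl')
      have "h (\<alpha> w) \<noteq> h w - 1" using in_C C that cl_first[of w] in_D(2) by auto
      then have "h w \<le> h (\<alpha> w)" using height_alpha[OF that(1)] by linarith
      then show ?thesis using in_C cl_other[OF that(1)] by (simp add: height_tau)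
    qed
    have all: "gl w \<in> C" if "w \<in> level (h z)" for w
      using orbit_ret[OF z(1), of "{w \<in> D. gl w \<in> C}"] step z that ret_in by auto
    have "orbit \<tau> z \<subseteq> {w \<in> D. h z \<le> h w}"
    proof (rule orbit_subset_closed)
      fix w assume w: "w \<in> {w \<in> D. h z \<le> h w}"
      have "h z \<le> h (\<tau> w)"
      proof (cases "h w = h z")
        case True
        then show ?thesis using step[of w] all[of w] w by auto
      next
        case False
        then show ?thesis using height_step[of w] w by auto
      qed
      then show "\<tau> w \<in> {w \<in> D. h z \<le> h w}" using w by auto
    qed (use z in auto)
    then have "h z \<le> m" using z0 orbit_tau[OF z(1)] by auto
    then have "h z0 = h z" using min[OF z(1)] z0 by auto
    then have "gl z0 \<in> C" using all z0 by auto
    then show ?thesis using s orbit_perm_eq[OF perm_rho] by auto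
  qed
  moreover have "gl z0 \<in> S" using z0 down_S gl_in_S by auto
  ultimately have "{C \<in> orbit \<rho> ` S. C \<inter> D = {}} = {orbit \<rho> (gl z0)}" using sink0 by auto
  then show ?thesis by simp
qed

lemma quad_cl: "quad cl"
  using cl_permutes card_cl_orbit height_cl one_sink by (auto simp: quad_def)

sublocale Q: height_quad S gl h cl
  by unfold_locales (rule quad_cl)

lemma rot_cl: "Q.rot = \<sigma>"
  unfolding Q.rot_def by (rule induced_rho)

lemma mate_cl: "Q.mate = \<alpha>"
proof
  fix d
  show "Q.mate d = \<alpha> d"
  proof (cases "d \<in> D")
    case True
    have n: "gl x \<notin> D" if "x \<in> D" for x using gl_down that by auto
    consider "h (\<alpha> d) = h d - 1" | "h (\<alpha> d) = h d" | "h (\<alpha> d) = h d + 1"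
      using height_alpha[OF True] by linarith
    then show ?thesis
    proof cases
      case 1
      then show ?thesis using True cl_first[OF True] by (simp add: Q.mate_def)
    next
      case 2
      then have "cl d = gl (\<tau> d)" using cl_other[OF True] ret_level[OF True] by (simp add: height_tau)
      then show ?thesis using True cl_gl_tau[OF True] 2 n by (simp add: Q.mate_def)
    next
      case 3
      then have "cl d = gl (ret d)" "cl (cl d) = gl (\<tau> d)"
        using cl_other[OF True] cl_gl_ret[OF True] by simp_all
      then show ?thesis using True cl_gl_tau[OF True] 3 n ret_in by (simp add: Q.mate_def)
    qed
  next
    case False
    then show ?thesis using permutes_not_in[OF alpha] by (simp add: Q.mate_def)
  qed
qed

end

context height_sides
begin

lemma card_schemes_le: "card (schemes k) \<le> card (quads (Suc k))"
proof (rule card_inj_on_le[OF _ _ finite_quads])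
  let ?close = "\<lambda>(\<sigma>, \<alpha>). height_scheme.cl S gl h \<sigma> \<alpha>"
  let ?open = "\<lambda>f. (height_quad.rot S gl h f, height_quad.mate S gl h f)"
  have "?open (?close x) = x \<and> ?close x \<in> quads (Suc k)" if xs: "x \<in> schemes k" for x
  proof -
    obtain \<sigma> \<alpha> where x: "x = (\<sigma>, \<alpha>)" "scheme \<sigma> \<alpha>" "ncyc \<sigma> D = k"
      using xs by (cases x) (auto simp: schemes_def)
    interpret height_scheme S gl h \<sigma> \<alpha> by unfold_locales fact
    show ?thesis using x rot_cl mate_cl quad_cl Q.ncyc_rot by (auto simp: quads_def)
  qed
  then show "inj_on ?close (schemes k)" "?close ` schemes k \<subseteq> quads (Suc k)"
    by (force intro!: inj_on_inverseI[of _ ?open])+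
qed

end


section \<open>Cutting a vertex into three\<close>

text \<open>
  For distinct points, the cycle that maps \<open>i\<close> to \<open>m\<close>, \<open>m\<close> to \<open>j\<close> and \<open>j\<close> to \<open>i\<close>.
\<close>

definition cyc3 :: "'a \<times> 'a \<times> 'a \<Rightarrow> 'a \<Rightarrow> 'a" where
  "cyc3 = (\<lambda>(i, j, m). transpose j m \<circ> transpose i j)"

lemma cyc3_apply:
  assumes "i \<noteq> j" "j \<noteq> m" "i \<noteq> m"
  shows "cyc3 (i, j, m) i = m" "cyc3 (i, j, m) j = i" "cyc3 (i, j, m) m = j"
    "x \<noteq> i \<Longrightarrow> x \<noteq> j \<Longrightarrow> x \<noteq> m \<Longrightarrow> cyc3 (i, j, m) x = x"
  using assms by (auto simp: cyc3_def transpose_def)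

lemma cyc3_rotate:
  assumes "i \<noteq> j" "j \<noteq> m" "i \<noteq> m"
  shows "cyc3 (j, m, i) = cyc3 (i, j, m)" "cyc3 (m, i, j) = cyc3 (i, j, m)"
  using assms by (auto simp: cyc3_def fun_eq_iff transpose_def)

lemma cyc3_permutes:
  assumes "i \<in> A" "j \<in> A" "m \<in> A" shows "cyc3 (i, j, m) permutes A"
  unfolding cyc3_def using assms by (auto intro!: permutes_compose permutes_swap_id)

text \<open>
  The first transposition splits off \<open>i\<close> as a fixed point; the second one splits the remaining cycle,
  which still contains both \<open>p i\<close> and \<open>m\<close>.
\<close>

lemma ncyc_cyc3:
  assumes p: "permutation p" and A: "finite A" "i \<in> A" "p i \<in> A" "m \<in> A"
    and m: "m \<in> orbit p i" and neq: "i \<noteq> p i" "p i \<noteq> m" "i \<noteq> m"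
  shows "ncyc (cyc3 (i, p i, m) \<circ> p) A = ncyc p A + 2"
proof -
  define q where "q = transpose i (p i) \<circ> p"
  have q: "permutation q" unfolding q_def by (rule permutation_transpose_comp[OF p])
  have j: "p i \<in> orbit p i" by (rule orbit.base)
  have 1: "ncyc q A = ncyc p A + 1"
    unfolding q_def by (rule ncyc_transpose_split[OF p A(1-3) j neq(1)])
  have "q i = i" by (simp add: q_def)
  then have "orbit q i = {i}" by (simp add: orbit_eq_singleton_iff)
  then have "m \<in> orbit q (p i)"
    using transpose_splits_cycle(1)[OF p j neq(1), folded q_def] m neq(3) by auto
  then have 2: "ncyc (transpose (p i) m \<circ> q) A = ncyc q A + 1"
    by (rule ncyc_transpose_split[OF q A(1,3,4) _ neq(2)])
  have "cyc3 (i, p i, m) \<circ> p = transpose (p i) m \<circ> q" by (simp add: cyc3_def q_def comp_assoc)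
  then show ?thesis using 1 2 by simp
qed

text \<open>
  The position of a point on a single cycle is the number of steps needed to reach it from \<open>r\<close>.
\<close>

locale cyclic_order =
  fixes A :: "'a set" and p :: "'a \<Rightarrow> 'a" and r :: 'a
  assumes finite_A: "finite A" and p: "p permutes A" and cyclic_p: "cyclic_on p A" and r: "r \<in> A"
begin

definition pos :: "'a \<Rightarrow> nat" where "pos x = funpow_dist p r x"

lemma orbit_r: "orbit p r = A"
  by (rule orbit_cyclic_eq3[OF cyclic_p r])

lemma at_pos: "x \<in> A \<Longrightarrow> (p ^^ pos x) r = x"
  unfolding pos_def by (rule funpow_dist_prop) (simp add: orbit_r)

lemma pos_inj: "x \<in> A \<Longrightarrow> y \<in> A \<Longrightarrow> pos x = pos y \<longleftrightarrow> x = y"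
  using at_pos by metis

lemma pos_le: "(p ^^ k) r = x \<Longrightarrow> pos x \<le> k"
  unfolding pos_def funpow_dist_def by (rule Least_le)

lemma pos_r: "pos r = 0"
  using pos_le[of 0 r] by simp

lemma pos_step:
  assumes "x \<in> A" "p x \<noteq> r" shows "pos (p x) = Suc (pos x)"
proof -
  have px: "p x \<in> A" using permutes_in_image[OF p] assms(1) by auto
  have "pos (p x) \<noteq> 0" using at_pos[OF px] assms(2) by (cases "pos (p x)") auto
  then obtain k where k: "pos (p x) = Suc k" by (cases "pos (p x)") auto
  have "p ((p ^^ k) r) = p x" using at_pos[OF px] k by simp
  then have "(p ^^ k) r = x" using permutes_inj[OF p] by (auto dest: injD)
  then have "pos x \<le> k" by (rule pos_le)
  moreover have "pos (p x) \<le> Suc (pos x)" using at_pos[OF assms(1)] by (intro pos_le) auto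
  ultimately show ?thesis using k by simp
qed

lemma pos_last:
  assumes "x \<in> A" "p l = r" "l \<in> A" shows "pos x \<le> pos l"
proof (rule ccontr)
  assume "\<not> pos x \<le> pos l"
  then obtain k where k: "pos x = k + Suc (pos l)"
    using le_Suc_ex[of "Suc (pos l)" "pos x"] by (auto simp: not_le add.commute)
  have "(p ^^ Suc (pos l)) r = r" using at_pos[OF assms(3)] assms(2) by simp
  then have "(p ^^ k) r = x" using at_pos[OF assms(1)] k by (simp only: funpow_add o_apply)
  then show False using pos_le[of k x] k by simp
qed

lemma pos_funpow:
  assumes "x \<in> A" "k \<le> pos x" shows "pos ((p ^^ k) r) = k"
proof (rule antisym)
  show le: "pos ((p ^^ k) r) \<le> k" by (rule pos_le) simp
  have "(p ^^ k) r \<in> A" using permutes_in_funpow_image[OF p r] .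
  then have "(p ^^ (pos x - k + pos ((p ^^ k) r))) r = (p ^^ (pos x - k)) ((p ^^ k) r)"
    using at_pos by (simp add: funpow_add)
  also have "\<dots> = (p ^^ (pos x - k + k)) r" by (simp only: funpow_add o_apply)
  also have "\<dots> = x" using at_pos[OF assms(1)] assms(2) by simp
  finally have "(p ^^ (pos x - k + pos ((p ^^ k) r))) r = x" .
  then have "pos x \<le> pos x - k + pos ((p ^^ k) r)" by (rule pos_le)
  then show "k \<le> pos ((p ^^ k) r)" using assms(2) by simp
qed

text \<open>
  In the new permutation the blocks of positions between \<open>i\<close>, \<open>j\<close> and \<open>m\<close> are traversed in a
  different order: first the positions up to \<open>i\<close>, then those after \<open>j\<close> up to \<open>m\<close>, then those
  after \<open>i\<close> up to \<open>j\<close>, and finally those after \<open>m\<close>.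
\<close>

lemma cyclic_cyc3:
  assumes A: "i \<in> A" "j \<in> A" "m \<in> A" and lt: "pos i < pos j" "pos j < pos m"
  shows "cyclic_on (p \<circ> inv (cyc3 (i, j, m))) A"
proof -
  let ?c = "cyc3 (i, j, m)" and ?q = "p \<circ> inv (cyc3 (i, j, m))"
  let ?e = "\<lambda>k. (p ^^ k) r"
  have neq: "i \<noteq> j" "j \<noteq> m" "i \<noteq> m" using lt by auto
  have c: "?c permutes A" by (rule cyc3_permutes[OF A])
  have q: "?q permutes A" by (intro permutes_compose permutes_inv c p)
  then have perm_q: "permutation ?q" using finite_A permutation_permutes by auto
  have inv_c: "inv ?c m = i" "inv ?c i = j" "inv ?c j = m"
    "\<And>x. x \<noteq> i \<Longrightarrow> x \<noteq> j \<Longrightarrow> x \<noteq> m \<Longrightarrow> inv ?c x = x"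
    using cyc3_apply[OF neq] permutes_inv_eq[OF c] by auto
  let ?O = "orbit ?q r"
  have qstep: "?q x \<in> ?O" if "x \<in> ?O" for x using that by (rule orbit.step)
  have run: "?e y \<in> ?O"
    if "?e x \<in> ?O" "x \<le> y" "z \<in> A" "y \<le> pos z"
      "\<forall>k. x \<le> k \<and> k < y \<longrightarrow> k \<noteq> pos i \<and> k \<noteq> pos j \<and> k \<noteq> pos m" for x y z
    using that(2,1,4,5)
  proof (induction y rule: dec_induct)
    case (step y)
    have "pos (?e y) = y" using pos_funpow[OF that(3)] step.prems by simp
    then have "?e y \<noteq> i" "?e y \<noteq> j" "?e y \<noteq> m" using step.prems(3) step.hyps by auto
    then have "?q (?e y) = ?e (Suc y)" using inv_c(4) by simp
    moreover have "?e y \<in> ?O" by (rule step.IH) (use step.prems in auto)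
    ultimately show ?case using qstep[of "?e y"] by (simp only:)
  qed auto
  \<comment> \<open>The jumps at \<open>i\<close>, \<open>m\<close> and \<open>j\<close> lead to the first positions of the next blocks.\<close>
  have e0: "?e 0 \<in> ?O" using permutation_self_in_orbit[OF perm_q] by simp
  have ei: "?e (pos i) \<in> ?O" by (rule run[OF e0 _ A(1)]) (use lt in auto)
  have "?q (?e (pos i)) = ?e (Suc (pos j))" using at_pos A inv_c by simp
  then have ej': "?e (Suc (pos j)) \<in> ?O" using qstep[OF ei] by simp
  have em: "?e (pos m) \<in> ?O" by (rule run[OF ej' _ A(3)]) (use lt in auto)
  have "?q (?e (pos m)) = ?e (Suc (pos i))" using at_pos A inv_c by simp
  then have ei': "?e (Suc (pos i)) \<in> ?O" using qstep[OF em] by simp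
  have ej: "?e (pos j) \<in> ?O" by (rule run[OF ei' _ A(2)]) (use lt in auto)
  have "?q (?e (pos j)) = ?e (Suc (pos m))" using at_pos A inv_c by simp
  then have em': "?e (Suc (pos m)) \<in> ?O" using qstep[OF ej] by simp
  have "x \<in> ?O" if x: "x \<in> A" for x
  proof -
    consider "pos x \<le> pos i" | "pos i < pos x" "pos x \<le> pos j" | "pos j < pos x" "pos x \<le> pos m"
      | "pos m < pos x" by linarith
    then have "?e (pos x) \<in> ?O"
    proof cases
      case 1 show ?thesis by (rule run[OF e0 _ x]) (use 1 lt in auto)
    next
      case 2 show ?thesis by (rule run[OF ei' _ x]) (use 2 lt in auto)
    next
      case 3 show ?thesis by (rule run[OF ej' _ x]) (use 3 lt in auto)
    next
      case 4 show ?thesis by (rule run[OF em' _ x]) (use 4 lt in auto)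
    qed
    then show ?thesis using at_pos[OF x] by simp
  qed
  moreover have "?O \<subseteq> A" by (rule permutes_orbit_subset[OF q r])
  ultimately show ?thesis using r by (auto simp: cyclic_on_def)
qed

end

context height_sides
begin

text \<open>
  The starting point of the numbering depends on \<open>D\<close> only, so it is the same before and after a
  vertex is cut.
\<close>

definition root :: 'a where "root = (SOME r. r \<in> D)"

lemma root_in: "root \<in> D"
  unfolding root_def using D_nonempty by (simp add: some_in_eq)

text \<open>
  The face boundary can be followed with \<open>\<alpha>\<close> before or after \<open>inv \<sigma>\<close>; numbering
  the darts along \<open>\<alpha> \<circ> inv \<sigma>\<close> makes the effect of changing
  \<open>\<sigma>\<close> a composition on the right.
\<close>

lemma cyclic_on_conj:
  assumes "\<alpha> permutes D" "\<And>d. d \<in> D \<Longrightarrow> \<alpha> (\<alpha> d) = d"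
  shows "cyclic_on (inv \<sigma> \<circ> \<alpha>) D \<longleftrightarrow> cyclic_on (\<alpha> \<circ> inv \<sigma>) D"
proof -
  have aD: "\<alpha> ` D = D" by (rule permutes_image[OF assms(1)])
  have "\<alpha> (\<alpha> d) = d" for d using assms permutes_not_in[OF assms(1)] by metis
  then show ?thesis
    using cyclic_on_image[of "inv \<sigma> \<circ> \<alpha>" D "\<alpha> \<circ> inv \<sigma>" \<alpha>]
      cyclic_on_image[of "\<alpha> \<circ> inv \<sigma>" D "inv \<sigma> \<circ> \<alpha>" \<alpha>] aD by auto
qed

end

context height_scheme
begin

sublocale C: cyclic_order D "\<alpha> \<circ> inv \<sigma>" root
proof
  show "\<alpha> \<circ> inv \<sigma> permutes D" by (intro permutes_compose permutes_inv alpha sigma)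
  show "cyclic_on (\<alpha> \<circ> inv \<sigma>) D"
    using cyclic cyclic_on_conj[OF alpha alpha_alpha] by (simp add: \<tau>_def)
qed (auto simp: finite_D root_in)

lemma perm_sigma: "permutation \<sigma>" by (rule permutation_D[OF sigma])

lemma sigma_inj: "\<sigma> x = \<sigma> y \<longleftrightarrow> x = y"
  using permutes_inj[OF sigma] by (auto dest: injD)

text \<open>
  Each vertex has one peak, the dart whose successor in the rotation has the largest position.  It is an
  ascent; the ascents that are not peaks are the trisections of Chapuy.  Ascents are weak so that
  fixed points of \<open>\<sigma>\<close> are included.
\<close>

definition ascents :: "'a set" where "ascents = {x \<in> D. C.pos x \<le> C.pos (\<sigma> x)}"

definition peaks :: "'a set" where
  "peaks = {x \<in> D. \<forall>m \<in> orbit \<sigma> x. C.pos m \<le> C.pos (\<sigma> x)}"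

definition trisections :: "'a set" where "trisections = ascents - peaks"

lemma card_half: "2 * card {x \<in> D. C.pos x < C.pos (\<alpha> x)} = card D"
proof -
  let ?U = "{x \<in> D. C.pos x < C.pos (\<alpha> x)}"
  have "bij_betw \<alpha> ?U (D - ?U)"
  proof (rule bij_betw_byWitness[where f' = \<alpha>])
    show "\<alpha> ` ?U \<subseteq> D - ?U" using alpha_alpha by auto
    show "\<alpha> ` (D - ?U) \<subseteq> ?U"
    proof
      fix y assume "y \<in> \<alpha> ` (D - ?U)"
      then obtain x where "x \<in> D - ?U" and y: "y = \<alpha> x" by blast
      then have x: "x \<in> D" "C.pos (\<alpha> x) \<le> C.pos x" by auto
      moreover have "C.pos (\<alpha> x) \<noteq> C.pos x" using C.pos_inj x alpha_neq by auto
      ultimately show "y \<in> ?U" using alpha_alpha y by auto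
    qed
  qed (use alpha_alpha in auto)
  then have "card ?U = card (D - ?U)" by (rule bij_betw_same_card)
  moreover have "card (D - ?U) = card D - card ?U" by (rule card_Diff_subset) (use finite_D in auto)
  moreover have "card ?U \<le> card D" by (rule card_mono) (use finite_D in auto)
  ultimately show ?thesis by simp
qed

lemma pos_sigma:
  assumes "x \<in> D" "\<alpha> x \<noteq> root" shows "C.pos (\<alpha> x) = Suc (C.pos (\<sigma> x))"
  using C.pos_step[of "\<sigma> x"] assms by (simp add: permutes_inverses(2)[OF sigma])

text \<open>
  As \<open>\<sigma> x\<close> is the point just before \<open>\<alpha> x\<close> on the cycle, \<open>x\<close> is an ascent exactly when
  \<open>\<alpha> x\<close> comes later than \<open>x\<close>, except that the point before \<open>root\<close> is the last one and
  makes \<open>\<alpha> root\<close> an ascent as well.  So each edge gives one ascent, and there is one extra.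
\<close>

lemma ascents_eq: "ascents = insert (\<alpha> root) {x \<in> D. C.pos x < C.pos (\<alpha> x)}"
proof -
  have 1: "C.pos x \<le> C.pos (\<sigma> x)" if "x \<in> D" "\<alpha> x = root" for x
    by (rule C.pos_last) (use that in \<open>simp_all add: permutes_inverses(2)[OF sigma]\<close>)
  have 2: "\<alpha> x = root \<longleftrightarrow> x = \<alpha> root" if "x \<in> D" for x
    using that alpha_alpha[of x] alpha_alpha[OF root_in] by auto
  have 3: "C.pos x < C.pos (\<alpha> x) \<longleftrightarrow> C.pos x \<le> C.pos (\<sigma> x)" if "x \<in> D" "\<alpha> x \<noteq> root" for x
    using pos_sigma[OF that] by (simp add: less_Suc_eq_le)
  show ?thesis
  proof (rule set_eqI)
    fix x
    show "x \<in> ascents \<longleftrightarrow> x \<in> insert (\<alpha> root) {x \<in> D. C.pos x < C.pos (\<alpha> x)}"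
      using 1[of x] 2[of x] 3[of x] root_in by (auto simp: ascents_def)
  qed
qed

lemma card_ascents: "2 * card ascents = card D + 2"
proof -
  have "\<alpha> root \<notin> {x \<in> D. C.pos x < C.pos (\<alpha> x)}"
    using alpha_alpha root_in by (simp add: C.pos_r)
  then have "card ascents = Suc (card {x \<in> D. C.pos x < C.pos (\<alpha> x)})"
    unfolding ascents_eq using finite_D by simp
  then show ?thesis using card_half by simp
qed

lemma sigma_orbit_self: "x \<in> orbit \<sigma> x"
  by (rule permutation_self_in_orbit[OF perm_sigma])

lemma orbit_sigma_D: "x \<in> D \<Longrightarrow> orbit \<sigma> x \<subseteq> D"
  by (rule permutes_orbit_subset[OF sigma])

lemma card_peaks: "card peaks = ncyc \<sigma> D"
proof -
  have "bij_betw (orbit \<sigma>) peaks (orbit \<sigma> ` D)"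
  proof (rule bij_betwI')
    fix x y assume xy: "x \<in> peaks" "y \<in> peaks"
    show "orbit \<sigma> x = orbit \<sigma> y \<longleftrightarrow> x = y"
    proof
      assume e: "orbit \<sigma> x = orbit \<sigma> y"
      have "\<sigma> x \<in> orbit \<sigma> y" "\<sigma> y \<in> orbit \<sigma> x" using e orbit.base by metis+
      then have "C.pos (\<sigma> x) = C.pos (\<sigma> y)" using xy by (auto simp: peaks_def intro: antisym)
      then show "x = y" using C.pos_inj xy sigma_inj by (auto simp: peaks_def)
    qed auto
  next
    fix x assume "x \<in> peaks" then show "orbit \<sigma> x \<in> orbit \<sigma> ` D" by (auto simp: peaks_def)
  next
    fix X assume "X \<in> orbit \<sigma> ` D"
    then obtain y where y: "y \<in> D" "X = orbit \<sigma> y" by auto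
    have fin: "finite (orbit \<sigma> y)" using orbit_sigma_D[OF y(1)] finite_D finite_subset by auto
    have "Max (C.pos ` orbit \<sigma> y) \<in> C.pos ` orbit \<sigma> y"
      using fin sigma_orbit_self[of y] by (intro Max_in) auto
    then obtain M where M: "M \<in> orbit \<sigma> y" "C.pos M = Max (C.pos ` orbit \<sigma> y)" by auto
    define x where "x = inv \<sigma> M"
    have x: "\<sigma> x = M" unfolding x_def by (rule permutes_inverses(1)[OF sigma])
    then have "M \<in> orbit \<sigma> x" using orbit.base by metis
    then have o: "orbit \<sigma> x = orbit \<sigma> y"
      using orbit_perm_eq[OF perm_sigma] M(1) by metis
    have "M \<in> D" using M(1) orbit_sigma_D[OF y(1)] by auto
    then have "x \<in> D" using x in_D(1) by metis
    moreover have "C.pos m \<le> C.pos (\<sigma> x)" if "m \<in> orbit \<sigma> x" for m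
      using that o x M(2) fin by auto
    ultimately have "x \<in> peaks" by (auto simp: peaks_def)
    then show "\<exists>x\<in>peaks. X = orbit \<sigma> x" using o y by auto
  qed
  then show ?thesis unfolding ncyc_def by (rule bij_betw_same_card)
qed

text \<open>
  If \<open>\<sigma>\<close> has as many cycles as a one-face map of genus \<open>g\<close> has vertices, namely
  \<open>n + 1 - 2 * g\<close>, there are \<open>2 * g\<close> trisections.
\<close>

lemma card_trisections: "2 * card trisections + 2 * ncyc \<sigma> D = card D + 2"
proof -
  have "peaks \<subseteq> ascents" using sigma_orbit_self by (auto simp: peaks_def ascents_def)
  moreover have "finite ascents" using finite_D by (auto simp: ascents_def)
  ultimately have "card trisections + card peaks = card ascents"
    unfolding trisections_def using card_Diff_subset[of peaks ascents] card_mono[of ascents peaks]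
    by (simp add: finite_subset)
  then show ?thesis using card_ascents card_peaks by linarith
qed

text \<open>
  Any dart at the same vertex with a larger position than \<open>\<sigma> x\<close> will do.
\<close>

definition higher :: "'a \<Rightarrow> 'a" where
  "higher x = (SOME m. m \<in> orbit \<sigma> x \<and> C.pos (\<sigma> x) < C.pos m)"

lemma trisection:
  assumes "x \<in> trisections"
  defines "m \<equiv> higher x"
  shows "x \<in> D" "\<sigma> x \<in> D" "m \<in> D" "m \<in> orbit \<sigma> x"
    "C.pos x < C.pos (\<sigma> x)" "C.pos (\<sigma> x) < C.pos m"
proof -
  have x: "x \<in> D" "C.pos x \<le> C.pos (\<sigma> x)" "\<exists>m. m \<in> orbit \<sigma> x \<and> C.pos (\<sigma> x) < C.pos m"
    using assms by (auto simp: trisections_def ascents_def peaks_def not_le)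
  show "x \<in> D" "\<sigma> x \<in> D" using x by auto
  show m: "m \<in> orbit \<sigma> x" "C.pos (\<sigma> x) < C.pos m"
    using someI_ex[OF x(3)] unfolding m_def higher_def by auto
  then show "m \<in> D" using orbit_sigma_D x by auto
  have "\<sigma> x \<noteq> x"
  proof
    assume "\<sigma> x = x"
    then have "orbit \<sigma> x = {x}" by (simp add: orbit_eq_singleton_iff)
    then show False using m \<open>\<sigma> x = x\<close> by auto
  qed
  then show "C.pos x < C.pos (\<sigma> x)" using C.pos_inj[of x "\<sigma> x"] x by auto
qed

definition triple :: "'a \<Rightarrow> 'a \<times> 'a \<times> 'a" where "triple x = (x, \<sigma> x, higher x)"

lemma height_orbit: "m \<in> orbit \<sigma> x \<Longrightarrow> h m = h x"
  by (induction rule: orbit.induct) (simp_all add: height_sigma)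

text \<open>
  All three darts of the triple belong to one vertex, so the pieces of that vertex inherit its label.
\<close>

lemma cut_scheme:
  assumes x: "x \<in> trisections"
  shows "scheme (cyc3 (triple x) \<circ> \<sigma>) \<alpha>" "ncyc (cyc3 (triple x) \<circ> \<sigma>) D = ncyc \<sigma> D + 2"
proof -
  let ?m = "higher x" and ?c = "cyc3 (triple x)"
  note t = trisection[OF x]
  have neq: "x \<noteq> \<sigma> x" "\<sigma> x \<noteq> ?m" "x \<noteq> ?m" using t by auto
  show "ncyc (?c \<circ> \<sigma>) D = ncyc \<sigma> D + 2"
    unfolding triple_def by (rule ncyc_cyc3[OF perm_sigma finite_D t(1-4) neq])
  have c: "?c permutes D" unfolding triple_def by (rule cyc3_permutes) (use t in auto)
  then have s: "?c \<circ> \<sigma> permutes D" by (rule permutes_compose[OF sigma])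
  have "h ?m = h x" by (rule height_orbit[OF t(4)])
  then have "h (?c y) = h y" for y
    using cyc3_apply[OF neq] height_sigma[of x] unfolding triple_def
    by (cases "y = x"; cases "y = \<sigma> x"; cases "y = ?m") simp_all
  moreover have "cyclic_on (inv (?c \<circ> \<sigma>) \<circ> \<alpha>) D"
  proof -
    have "cyclic_on (\<alpha> \<circ> inv \<sigma> \<circ> inv ?c) D"
      unfolding triple_def by (rule C.cyclic_cyc3) (use t in auto)
    moreover have "inv (?c \<circ> \<sigma>) = inv \<sigma> \<circ> inv ?c"
      using o_inv_distrib permutes_bij c sigma by metis
    ultimately show ?thesis
      using cyclic_on_conj[OF alpha alpha_alpha, of "?c \<circ> \<sigma>"] by (simp only: comp_assoc)
  qed
  ultimately show "scheme (?c \<circ> \<sigma>) \<alpha>"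
    using s alpha alpha_alpha alpha_neq height_alpha height_sigma by (simp add: scheme_def)
qed

end

text \<open>
  A three-cycle is given by three ordered triples.  Recording each of them gains the factor \<open>3\<close> that
  later pays for the change in the number of vertices.
\<close>

definition rotate3 :: "nat \<Rightarrow> 'a \<times> 'a \<times> 'a \<Rightarrow> 'a \<times> 'a \<times> 'a" where
  "rotate3 k = (\<lambda>(a, b, c). if k = 0 then (a, b, c) else if k = 1 then (b, c, a) else (c, a, b))"

context height_sides
begin

definition tri :: "('a \<Rightarrow> 'a) \<times> ('a \<Rightarrow> 'a) \<Rightarrow> 'a set" where
  "tri = (\<lambda>(\<sigma>, \<alpha>). height_scheme.trisections S gl h \<sigma> \<alpha>)"

definition cut :: "(('a \<Rightarrow> 'a) \<times> ('a \<Rightarrow> 'a)) \<times> 'a \<times> nat \<Rightarrow> (('a \<Rightarrow> 'a) \<times> ('a \<Rightarrow> 'a)) \<times> 'a \<times> 'a \<times> 'a" where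
  "cut = (\<lambda>((\<sigma>, \<alpha>), x, k).
     let t = height_scheme.triple S gl h \<sigma> \<alpha> x in ((cyc3 t \<circ> \<sigma>, \<alpha>), rotate3 k t))"

text \<open>
  All rotations of a triple define the same three-cycle, so the image determines the original
  rotation and hence the positions of the darts; the positions in the triple increase, and this
  shows how far it was rotated.
\<close>

lemma cut_inj:
  assumes "scheme \<sigma> \<alpha>" "x \<in> tri (\<sigma>, \<alpha>)" "k < 3" "scheme \<sigma>' \<alpha>'" "x' \<in> tri (\<sigma>', \<alpha>')" "k' < 3"
    and eq: "cut ((\<sigma>, \<alpha>), x, k) = cut ((\<sigma>', \<alpha>'), x', k')"
  shows "((\<sigma>, \<alpha>), x, k) = ((\<sigma>', \<alpha>'), x', k')"
proof -
  interpret a: height_scheme S gl h \<sigma> \<alpha> by unfold_locales fact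
  interpret b: height_scheme S gl h \<sigma>' \<alpha>' by unfold_locales fact
  have x: "x \<in> a.trisections" "x' \<in> b.trisections" using assms by (auto simp: tri_def)
  note t = a.trisection[OF x(1)] and t' = b.trisection[OF x(2)]
  have e: "cyc3 (a.triple x) \<circ> \<sigma> = cyc3 (b.triple x') \<circ> \<sigma>'" "\<alpha> = \<alpha>'"
    "rotate3 k (a.triple x) = rotate3 k' (b.triple x')"
    using eq by (auto simp: cut_def Let_def)
  have neq: "x \<noteq> \<sigma> x" "\<sigma> x \<noteq> a.higher x" "x \<noteq> a.higher x"
    "x' \<noteq> \<sigma>' x'" "\<sigma>' x' \<noteq> b.higher x'" "x' \<noteq> b.higher x'" using t t' by auto
  have "cyc3 (rotate3 k (a.triple x)) = cyc3 (a.triple x)"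
    "cyc3 (rotate3 k' (b.triple x')) = cyc3 (b.triple x')"
    using cyc3_rotate[OF neq(1-3)] cyc3_rotate[OF neq(4-6)]
    by (simp_all add: rotate3_def a.triple_def b.triple_def)
  then have c: "cyc3 (a.triple x) = cyc3 (b.triple x')" using e(3) by simp
  have "cyc3 (a.triple x) permutes D"
    unfolding a.triple_def by (rule cyc3_permutes) (use t in auto)
  then have "inj (cyc3 (a.triple x))" by (rule permutes_inj)
  moreover have "cyc3 (a.triple x) (\<sigma> y) = cyc3 (a.triple x) (\<sigma>' y)" for y
    using e(1) c by (auto simp: fun_eq_iff)
  ultimately have s: "\<sigma> = \<sigma>'" by (auto simp: fun_eq_iff dest: injD)
  have "k = k' \<and> x = x'"
  proof -
    have "k \<in> {0, 1, 2}" "k' \<in> {0, 1, 2}" using assms(3,6) by auto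
    then show ?thesis
      using e(3) t(5,6) t'(5,6) unfolding a.triple_def b.triple_def rotate3_def s[symmetric] e(2)[symmetric]
      by auto
  qed
  then show ?thesis using s e(2) by simp
qed

lemma card_schemes_step:
  assumes D: "card D = 2 * n"
  shows "3 * (n + 1 - k) * card (schemes k) \<le> (2 * n) ^ 3 * card (schemes (k + 2))"
proof -
  let ?X = "SIGMA s : schemes k. tri s \<times> {..<3::nat}"
  have tri: "card (tri s \<times> {..<3::nat}) = 3 * (n + 1 - k)" "finite (tri s)" if sk: "s \<in> schemes k" for s
  proof -
    obtain \<sigma> \<alpha> where s: "s = (\<sigma>, \<alpha>)" "scheme \<sigma> \<alpha>" "ncyc \<sigma> D = k"
      using sk by (cases s) (auto simp: schemes_def)
    interpret height_scheme S gl h \<sigma> \<alpha> by unfold_locales fact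
    show "card (tri s \<times> {..<3::nat}) = 3 * (n + 1 - k)"
      using card_trisections D s by (simp add: tri_def card_cartesian_product)
    show "finite (tri s)" using finite_D s(1) by (simp add: tri_def trisections_def ascents_def)
  qed
  have "card ?X = 3 * (n + 1 - k) * card (schemes k)"
    using tri finite_schemes by (subst card_SigmaI) auto
  moreover have "card ?X \<le> card (schemes (k + 2) \<times> D \<times> D \<times> D)"
  proof (rule card_inj_on_le)
    show "inj_on cut ?X"
    proof (rule inj_onI)
      fix a b assume "a \<in> ?X" "b \<in> ?X" "cut a = cut b"
      then show "a = b" using cut_inj by (cases a; cases b) (force simp: schemes_def)
    qed
    show "cut ` ?X \<subseteq> schemes (k + 2) \<times> D \<times> D \<times> D"
    proof
      fix y assume "y \<in> cut ` ?X"
      then obtain \<sigma> \<alpha> x l where s: "scheme \<sigma> \<alpha>" "ncyc \<sigma> D = k" and x: "x \<in> tri (\<sigma>, \<alpha>)"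
        and y: "y = cut ((\<sigma>, \<alpha>), x, l)" by (auto simp: schemes_def)
      interpret height_scheme S gl h \<sigma> \<alpha> by unfold_locales fact
      have "x \<in> trisections" using x by (simp add: tri_def)
      then show "y \<in> schemes (k + 2) \<times> D \<times> D \<times> D"
        using y s(2) cut_scheme[of x] trisection[of x]
        by (auto simp: cut_def Let_def schemes_def rotate3_def triple_def)
    qed
  qed (use finite_schemes finite_D in auto)
  ultimately show ?thesis
    using D by (simp add: card_cartesian_product power3_eq_cube mult.commute mult.left_commute)
qed

lemma card_quads_step:
  assumes D: "card D = 2 * n"
  shows "3 * (n + 2 - k) * card (quads k) \<le> (2 * n) ^ 3 * card (quads (k + 2))"
proof (cases k)
  case 0
  have "quads 0 = {}" using nonempty_S finite_S by (auto simp: quads_def ncyc_def)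
  then show ?thesis using 0 by simp
next
  case (Suc l)
  have "3 * (n + 1 - l) * card (quads k) \<le> 3 * (n + 1 - l) * card (schemes l)"
    using card_quads_le Suc by simp
  also have "\<dots> \<le> (2 * n) ^ 3 * card (schemes (l + 2))" by (rule card_schemes_step[OF D])
  also have "\<dots> \<le> (2 * n) ^ 3 * card (quads (k + 2))"
    using card_schemes_le[of "l + 2"] Suc by simp
  finally show ?thesis using Suc by simp
qed

end


section \<open>Distance labels\<close>

text \<open>
  Here \<open>B\<close> is the set of sides that start at a black vertex.
\<close>

locale bipartite_gluing =
  fixes S :: "'a set" and f gl :: "'a \<Rightarrow> 'a" and B :: "'a set"
  assumes finite_S: "finite S" and f: "f permutes S" and gl: "gl permutes S"
    and gl_gl: "\<And>s. s \<in> S \<Longrightarrow> gl (gl s) = s"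
    and connected: "\<And>s t. s \<in> S \<Longrightarrow> t \<in> S \<Longrightarrow> (s, t) \<in> {(x, y). x \<in> S \<and> (y = f x \<or> y = gl x)}\<^sup>*"
    and B_rho: "\<And>s. s \<in> S \<Longrightarrow> f (gl s) \<in> B \<longleftrightarrow> s \<in> B"
    and B_gl: "\<And>s. s \<in> S \<Longrightarrow> gl s \<in> B \<longleftrightarrow> s \<notin> B"
begin

abbreviation \<rho> where "\<rho> \<equiv> f \<circ> gl"

lemma rho: "\<rho> permutes S" by (rule permutes_compose[OF gl f])

lemma perm_rho: "permutation \<rho>" using rho finite_S permutation_permutes by auto

lemma in_S [simp]: "f s \<in> S \<longleftrightarrow> s \<in> S" "gl s \<in> S \<longleftrightarrow> s \<in> S"
  by (rule permutes_in_image[OF f], rule permutes_in_image[OF gl])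

lemma orbit_in_S: "s \<in> S \<Longrightarrow> t \<in> orbit \<rho> s \<Longrightarrow> t \<in> S"
  using permutes_orbit_subset[OF rho] by blast

lemma self_orbit: "s \<in> orbit \<rho> s" by (rule permutation_self_in_orbit[OF perm_rho])

text \<open>
  The set \<open>within v k\<close> consists of the sides that start at a vertex joined to \<open>v\<close> by a walk of length
  \<open>k\<close>; vertices are orbits of the rotation.
\<close>

primrec within :: "'a set \<Rightarrow> nat \<Rightarrow> 'a set" where
  "within v 0 = v"
| "within v (Suc k) = {s \<in> S. \<exists>t\<in>orbit \<rho> s. gl t \<in> within v k}"

definition dist_from :: "'a set \<Rightarrow> 'a \<Rightarrow> int" where
  "dist_from v s = (if s \<in> S then int (LEAST k. s \<in> within v k) else 0)"

lemma within_S: "v \<in> orbit \<rho> ` S \<Longrightarrow> s \<in> within v k \<Longrightarrow> s \<in> S"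
  by (cases k) (auto intro: orbit_in_S)

lemma within_orbit:
  assumes v: "v \<in> orbit \<rho> ` S" and s: "s \<in> within v k" and t: "t \<in> orbit \<rho> s"
  shows "t \<in> within v k"
proof (cases k)
  case 0
  obtain u where "v = orbit \<rho> u" using v by auto
  then show ?thesis using 0 s t orbit_trans by auto
next
  case (Suc k)
  have "orbit \<rho> t = orbit \<rho> s" by (rule orbit_perm_eq[OF perm_rho t])
  then show ?thesis using Suc s t orbit_in_S by auto
qed

lemma within_gl:
  assumes "v \<in> orbit \<rho> ` S" "s \<in> within v k" shows "gl s \<in> within v (Suc k)"
proof -
  have "s \<in> S" using assms by (rule within_S)
  then show ?thesis using assms(2) self_orbit[of "gl s"] gl_gl[OF \<open>s \<in> S\<close>] by (auto intro!: bexI[of _ "gl s"])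
qed

lemma within_ex:
  assumes v: "v \<in> orbit \<rho> ` S" and s: "s \<in> S" shows "\<exists>k. s \<in> within v k"
proof -
  obtain t where t: "t \<in> S" "v = orbit \<rho> t" using v by auto
  from connected[OF s t(1)] show ?thesis
  proof (induction rule: converse_rtrancl_induct)
    case base
    have "t \<in> within v 0" using t self_orbit by simp
    then show ?case by blast
  next
    case (step x y)
    then obtain k where k: "y \<in> within v k" by auto
    have x: "x \<in> S" "gl (gl x) = x" using step gl_gl by auto
    from step have "y = f x \<or> y = gl x" by auto
    then show ?case
    proof
      assume "y = gl x"
      then have "x \<in> within v (Suc k)" using within_gl[OF v k] x by simp
      then show ?thesis by blast
    next
      assume "y = f x"
      then have "y = \<rho> (gl x)" using x by simp
      then have "y \<in> orbit \<rho> (gl x)" by (simp only: orbit.base)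
      then have "gl x \<in> orbit \<rho> y" by (rule orbit_perm_sym[OF perm_rho])
      then have "gl x \<in> within v k" by (rule within_orbit[OF v k])
      then have "x \<in> within v (Suc k)" using within_gl[OF v] x by metis
      then show ?thesis by blast
    qed
  qed
qed

lemma B_orbit:
  assumes "t \<in> orbit \<rho> s" "s \<in> S" shows "t \<in> B \<longleftrightarrow> s \<in> B"
  using assms(1)
proof induction
  case base then show ?case using B_rho assms(2) by simp
next
  case (step t)
  then show ?case using B_rho[of t] orbit_in_S[OF assms(2)] by simp
qed

text \<open>
  Colours alternate along a walk, so its length modulo two is determined by its ends.  In particular
  adjacent vertices cannot be at the same distance from \<open>v\<close>.
\<close>

lemma within_colour:
  assumes v: "v \<in> orbit \<rho> ` S" "z \<in> v" and s: "s \<in> within v k"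
  shows "s \<in> B \<longleftrightarrow> (even k \<longleftrightarrow> z \<in> B)"
  using s
proof (induction k arbitrary: s)
  case 0
  obtain t where t: "t \<in> S" "v = orbit \<rho> t" using v by auto
  then show ?case using B_orbit[of s t] B_orbit[of z t] 0 v by simp
next
  case (Suc k)
  then obtain t where t: "s \<in> S" "t \<in> orbit \<rho> s" "gl t \<in> within v k" by auto
  then have "t \<in> S" using orbit_in_S by auto
  then show ?case using Suc.IH[OF t(3)] B_gl[of t] B_orbit[OF t(2,1)] by auto
qed

lemma dist_from_le: "s \<in> S \<Longrightarrow> s \<in> within v k \<Longrightarrow> dist_from v s \<le> int k"
  unfolding dist_from_def by (auto intro: Least_le)

lemma dist_from_within:
  assumes "v \<in> orbit \<rho> ` S" "s \<in> S"
  shows "s \<in> within v (nat (dist_from v s))" "0 \<le> dist_from v s"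
  using LeastI_ex[OF within_ex[OF assms]] assms(2) by (auto simp: dist_from_def)

lemma dist_from_colour:
  assumes "v \<in> orbit \<rho> ` S" "z \<in> v" "s \<in> S"
  shows "s \<in> B \<longleftrightarrow> (even (dist_from v s) \<longleftrightarrow> z \<in> B)"
  using within_colour[OF assms(1,2) dist_from_within(1)[OF assms(1,3)]]
    dist_from_within(2)[OF assms(1,3)] by (simp add: even_nat_iff)

lemma dist_from_rho:
  assumes "v \<in> orbit \<rho> ` S" "t \<in> orbit \<rho> s" "s \<in> S"
  shows "dist_from v t = dist_from v s"
proof -
  have t: "t \<in> S" "s \<in> orbit \<rho> t" using orbit_in_S orbit_perm_sym[OF perm_rho] assms by auto
  have "dist_from v t \<le> int (nat (dist_from v s))"
    by (rule dist_from_le[OF t(1) within_orbit[OF assms(1) dist_from_within(1) assms(2)]]) (use assms in auto)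
  moreover have "dist_from v s \<le> int (nat (dist_from v t))"
    by (rule dist_from_le[OF assms(3) within_orbit[OF assms(1) dist_from_within(1) t(2)]]) (use assms t in auto)
  ultimately show ?thesis using dist_from_within(2)[OF assms(1)] t(1) assms(3) by fastforce
qed

lemma dist_from_gl:
  assumes v: "v \<in> orbit \<rho> ` S" and s: "s \<in> S"
  shows "\<bar>dist_from v (gl s) - dist_from v s\<bar> = 1"
proof -
  obtain z where z: "z \<in> v" using v self_orbit by auto
  have le: "dist_from v (gl t) \<le> dist_from v t + 1" if "t \<in> S" for t
    using dist_from_le[of "gl t", OF _ within_gl[OF v dist_from_within(1)[OF v that]]] that
      dist_from_within(2)[OF v that] by simp
  have "dist_from v s \<le> dist_from v (gl s) + 1" using le[of "gl s"] s gl_gl by simp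
  moreover have "even (dist_from v s) \<noteq> even (dist_from v (gl s))"
    using dist_from_colour[OF v z s] dist_from_colour[OF v z, of "gl s"] B_gl[OF s] s by auto
  then have "dist_from v s \<noteq> dist_from v (gl s)" by metis
  ultimately show ?thesis using le[OF s] by linarith
qed

lemma dist_from_zero: "v \<in> orbit \<rho> ` S \<Longrightarrow> s \<in> v \<Longrightarrow> dist_from v s = 0"
  using dist_from_le[of s v 0] within_S[of v s 0] dist_from_within(2)[of v s] by force

lemma dist_from_sinks:
  assumes v: "v \<in> orbit \<rho> ` S"
  shows "{C \<in> orbit \<rho> ` S. C \<inter> {s \<in> S. dist_from v (gl s) = dist_from v s - 1} = {}} = {v}"
proof -
  have "C = v \<longleftrightarrow> C \<inter> {s \<in> S. dist_from v (gl s) = dist_from v s - 1} = {}" if CS: "C \<in> orbit \<rho> ` S" for C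
  proof
    assume "C = v"
    moreover have "dist_from v (gl s) \<noteq> dist_from v s - 1" if "s \<in> v" "s \<in> S" for s
      using dist_from_zero[OF v that(1)] dist_from_within(2)[OF v, of "gl s"] that(2) by simp
    ultimately show "C \<inter> {s \<in> S. dist_from v (gl s) = dist_from v s - 1} = {}" by blast
  next
    assume no: "C \<inter> {s \<in> S. dist_from v (gl s) = dist_from v s - 1} = {}"
    obtain s where s: "s \<in> S" "C = orbit \<rho> s" using CS by auto
    show "C = v"
    proof (cases "nat (dist_from v s)")
      case 0
      then have "s \<in> v" using dist_from_within(1)[OF v s(1)] by simp
      moreover obtain u where "v = orbit \<rho> u" using v by auto
      ultimately show ?thesis using s(2) orbit_perm_eq[OF perm_rho] by auto
    next
      case (Suc k)
      then obtain t where t: "t \<in> orbit \<rho> s" "gl t \<in> within v k"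
        using dist_from_within(1)[OF v s(1)] by auto
      have tS: "t \<in> S" using orbit_in_S s t by auto
      have "dist_from v (gl t) \<le> int k" by (rule dist_from_le) (use t tS in auto)
      moreover have "dist_from v t = int (Suc k)"
        using dist_from_rho[OF v t(1) s(1)] Suc by linarith
      ultimately have "dist_from v (gl t) = dist_from v t - 1" using dist_from_gl[OF v tS] by linarith
      then show ?thesis using no t tS s by auto
    qed
  qed
  then show ?thesis using v by blast
qed

text \<open>
  From any side a path along which \<open>h\<close> decreases leads to the sink, so \<open>h\<close> is at least the distance; it
  is at most the distance because it changes by one along each edge.
\<close>

lemma dist_from_unique:
  fixes h :: "'a \<Rightarrow> int"
  assumes v: "v \<in> orbit \<rho> ` S"
    and rho_h: "\<And>s. s \<in> S \<Longrightarrow> h (f (gl s)) = h s"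
    and step: "\<And>s. s \<in> S \<Longrightarrow> \<bar>h (gl s) - h s\<bar> = 1"
    and nonneg: "\<And>s. s \<in> S \<Longrightarrow> 0 \<le> h s" and zero: "\<exists>s\<in>S. h s = 0"
    and outside: "\<And>s. s \<notin> S \<Longrightarrow> h s = 0"
    and sink: "{C \<in> orbit \<rho> ` S. C \<inter> {s \<in> S. h (gl s) = h s - 1} = {}} = {v}"
  shows "h = dist_from v"
proof
  fix s
  have orb: "h t = h s" if "t \<in> orbit \<rho> s" "s \<in> S" for s t
    using that(1)
  proof induction
    case (step t)
    then show ?case using rho_h[of t] orbit_in_S[OF that(2)] by simp
  qed (use rho_h that in simp)
  obtain z where z: "z \<in> S" "h z = 0" using zero by auto
  have "t \<notin> orbit \<rho> z \<inter> {s \<in> S. h (gl s) = h s - 1}" for t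
    using orb[of t z] z nonneg[of "gl t"] by auto
  then have v_eq: "v = orbit \<rho> z" using sink z by blast
  have le: "h s \<le> int k" if "s \<in> within v k" for s k
    using that
  proof (induction k arbitrary: s)
    case 0
    then show ?case using orb[of s z] v_eq z by simp
  next
    case (Suc k)
    then obtain t where t: "s \<in> S" "t \<in> orbit \<rho> s" "gl t \<in> within v k" by auto
    have "t \<in> S" using orbit_in_S t by auto
    then show ?case using Suc.IH[OF t(3)] orb[OF t(2,1)] step[of t] by linarith
  qed
  have ge: "s \<in> within v (nat (h s))" if "s \<in> S" for s
    using that
  proof (induction "nat (h s)" arbitrary: s rule: less_induct)
    case less
    show ?case
    proof (cases "orbit \<rho> s \<inter> {s \<in> S. h (gl s) = h s - 1} = {}")
      case True
      then have "orbit \<rho> s = v" using sink less.prems by blast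
      then have "s \<in> v" using self_orbit by auto
      moreover then have "h s = 0" using orb[of s z] v_eq z by simp
      ultimately show ?thesis by simp
    next
      case False
      then obtain t where t: "t \<in> orbit \<rho> s" "t \<in> S" "h (gl t) = h t - 1" by auto
      have ht: "h t = h s" by (rule orb[OF t(1) less.prems])
      have "0 \<le> h (gl t)" using nonneg t(2) by simp
      then have n: "nat (h s) = Suc (nat (h (gl t)))" using t(3) ht by linarith
      then have "gl t \<in> within v (nat (h (gl t)))" using less.hyps t(2) by simp
      then show ?thesis unfolding n using t(1) less.prems by auto
    qed
  qed
  show "h s = dist_from v s"
  proof (cases "s \<in> S")
    case True
    have "(LEAST k. s \<in> within v k) = nat (h s)"
    proof (rule Least_equality)
      show "s \<in> within v (nat (h s))" by (rule ge[OF True])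
      show "nat (h s) \<le> k" if "s \<in> within v k" for k using le[OF that] by simp
    qed
    then show ?thesis using True nonneg by (simp add: dist_from_def)
  qed (simp add: outside dist_from_def)
qed

lemma height_sides_dist:
  assumes v: "v \<in> orbit \<rho> ` S"
  shows "height_sides S gl (dist_from v)"
  by unfold_locales (use v finite_S gl gl_gl dist_from_gl[OF v] in auto)

lemma quad_dist:
  assumes v: "v \<in> orbit \<rho> ` S" and faces: "\<And>s. s \<in> S \<Longrightarrow> card (orbit f s) = 4"
  shows "height_sides.quad S gl (dist_from v) f"
proof -
  interpret height_sides S gl "dist_from v" by (rule height_sides_dist[OF v])
  have "dist_from v (f s) = dist_from v (gl s)" if "s \<in> S" for s
  proof -
    have "f s = \<rho> (gl s)" using gl_gl[OF that] by simp
    then have "f s \<in> orbit \<rho> (gl s)" by (simp only: orbit.base)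
    then show ?thesis by (rule dist_from_rho[OF v]) (use that in simp)
  qed
  then show ?thesis using f faces dist_from_sinks[OF v] by (simp add: quad_def D_def)
qed

end

context height_quad
begin

text \<open>
  The connectedness of a closed surface comes for free: every component would contain a sink, and
  there is only one.
\<close>

abbreviation moves where "moves \<equiv> {(x, y). x \<in> S \<and> (y = f x \<or> y = gl x)}"

lemma moves_orbit_f:
  assumes "t \<in> orbit f s" "s \<in> S" shows "(s, t) \<in> moves\<^sup>*"
  using assms(1)
proof induction
  case base then show ?case using assms by auto
next
  case (step t)
  then have "t \<in> S" using permutes_orbit_subset[OF f assms(2)] by auto
  then have "(t, f t) \<in> moves" by auto
  with step.IH show ?case by (rule rtrancl_into_rtrancl)
qed

lemma moves_orbit_rho:
  assumes "t \<in> orbit \<rho> s" "s \<in> S" shows "(s, t) \<in> moves\<^sup>*"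
proof -
  have two: "(t, \<rho> t) \<in> moves\<^sup>*" if "t \<in> S" for t
  proof -
    have "(t, gl t) \<in> moves" "(gl t, f (gl t)) \<in> moves" using that gl_in_S by auto
    then show ?thesis by (auto intro: converse_rtrancl_into_rtrancl)
  qed
  from assms(1) show ?thesis
  proof induction
    case base show ?case by (rule two[OF assms(2)])
  next
    case (step t)
    have "t \<in> S" using step permutes_orbit_subset[OF permutes_compose[OF gl f] assms(2)] by auto
    with step.IH show ?case using two[of t] by (auto intro: rtrancl_trans)
  qed
qed

lemma moves_sym:
  assumes "(x, y) \<in> moves\<^sup>*" shows "(y, x) \<in> moves\<^sup>*"
  using assms
proof (induction rule: rtrancl_induct)
  case (step y z)
  then have y: "y \<in> S" "z = f y \<or> z = gl y" by auto
  have "y \<in> orbit f (f y)"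
    by (rule orbit_perm_sym[OF permutation_S[OF f] orbit.base])
  then have "(f y, y) \<in> moves\<^sup>*" using y by (intro moves_orbit_f) (auto simp: f_in_S)
  moreover have "(gl y, y) \<in> moves" using y gl_in_S gl_gl' by auto
  ultimately have "(z, y) \<in> moves\<^sup>*" using y(2) by blast
  then show ?case using step.IH by (rule rtrancl_trans)
qed simp

lemma moves_to_sink:
  assumes "s \<in> S"
  shows "\<exists>t\<in>S. orbit \<rho> t \<inter> D = {} \<and> (s, t) \<in> moves\<^sup>*"
  using assms
proof (induction "nat (h s - Min (h ` S))" arbitrary: s rule: less_induct)
  case less
  show ?case
  proof (cases "orbit \<rho> s \<inter> D = {}")
    case True
    then show ?thesis using less.prems by blast
  next
    case False
    then obtain t where t: "t \<in> orbit \<rho> s" "t \<in> D" by auto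
    have tS: "t \<in> S" "gl t \<in> S" using t(2) down_S gl_in_S by auto
    have "h t = h s" using t(1) by (induction rule: orbit.induct) (use height_rho in auto)
    then have "h (gl t) < h s" using down[OF t(2)] by simp
    moreover have "Min (h ` S) \<le> h (gl t)" using finite_S tS by auto
    ultimately have "nat (h (gl t) - Min (h ` S)) < nat (h s - Min (h ` S))" by linarith
    from less.hyps[OF this tS(2)] obtain u where u: "u \<in> S" "orbit \<rho> u \<inter> D = {}" "(gl t, u) \<in> moves\<^sup>*"
      by auto
    have "(s, t) \<in> moves\<^sup>*" by (rule moves_orbit_rho[OF t(1) less.prems])
    moreover have "(t, gl t) \<in> moves" using tS by auto
    ultimately have "(s, u) \<in> moves\<^sup>*"
      using u(3) by (blast intro: converse_rtrancl_into_rtrancl rtrancl_trans)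
    then show ?thesis using u by blast
  qed
qed

lemma connected_moves:
  assumes "s \<in> S" "t \<in> S" shows "(s, t) \<in> moves\<^sup>*"
proof -
  obtain a where a: "a \<in> S" "orbit \<rho> a \<inter> D = {}" "(s, a) \<in> moves\<^sup>*"
    using moves_to_sink[OF assms(1)] by auto
  obtain b where b: "b \<in> S" "orbit \<rho> b \<inter> D = {}" "(t, b) \<in> moves\<^sup>*"
    using moves_to_sink[OF assms(2)] by auto
  have "orbit \<rho> a = orbit \<rho> b" using orbit_singleton_card[OF sink] a b by blast
  then have "b \<in> orbit \<rho> a" using permutation_self_in_orbit[OF rho] by auto
  then have "(a, b) \<in> moves\<^sup>*" using moves_orbit_rho a by auto
  then show ?thesis using a(3) moves_sym[OF b(3)] by (blast intro: rtrancl_trans)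
qed

end


section \<open>Pointed quadrangulations on a fixed set of sides\<close>

lemma rooted_bicoloured_eqI:
  fixes M N :: rooted_bicoloured
  assumes "sides M = sides N" "nxt M = nxt N" "glue M = glue N" "black M = black N"
    "root_edge M = root_edge N"
  shows "M = N"
  using assms by (cases M; cases N) simp

lemma card_orbits_4:
  assumes p: "p permutes S" "finite S" and c: "\<And>s. s \<in> S \<Longrightarrow> card (orbit p s) = 4"
  shows "card S = 4 * card (orbit p ` S)"
proof -
  have perm: "permutation p" using p permutation_permutes by auto
  have U: "\<Union> (orbit p ` S) = S"
    using permutes_orbit_subset[OF p(1)] permutation_self_in_orbit[OF perm] by blast
  have "4 * card (orbit p ` S) = card (\<Union> (orbit p ` S))"
  proof (rule card_partition)
    fix X Y assume XY: "X \<in> orbit p ` S" "Y \<in> orbit p ` S" "X \<noteq> Y"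
    show "X \<inter> Y = {}"
    proof (rule ccontr)
      assume "X \<inter> Y \<noteq> {}"
      then obtain z where "z \<in> X" "z \<in> Y" by auto
      then have "X = orbit p z" "Y = orbit p z" using XY orbit_perm_eq[OF perm] by auto
      then show False using XY(3) by simp
    qed
  qed (use U p c in auto)
  then show ?thesis using U by simp
qed

lemma card_pairs_involution:
  assumes "finite S" "\<And>s. s \<in> S \<Longrightarrow> a s \<in> S" "\<And>s. s \<in> S \<Longrightarrow> a (a s) = s" "\<And>s. s \<in> S \<Longrightarrow> a s \<noteq> s"
  shows "card S = 2 * card ((\<lambda>s. {s, a s}) ` S)"
proof -
  have U: "\<Union> ((\<lambda>s. {s, a s}) ` S) = S" using assms(2) by auto
  have "2 * card ((\<lambda>s. {s, a s}) ` S) = card (\<Union> ((\<lambda>s. {s, a s}) ` S))"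
  proof (rule card_partition)
    fix X assume "X \<in> (\<lambda>s. {s, a s}) ` S"
    then show "card X = 2" using assms(4) by (force simp: card_2_iff)
  next
    fix X Y assume "X \<in> (\<lambda>s. {s, a s}) ` S" "Y \<in> (\<lambda>s. {s, a s}) ` S" "X \<noteq> Y"
    moreover have "a s = a t \<longleftrightarrow> s = t" if "s \<in> S" "t \<in> S" for s t
      using assms(3) that by metis
    ultimately show "X \<inter> Y = {}" using assms(3) by auto
  qed (use U assms(1) in auto)
  then show ?thesis using U by simp
qed

lemma quadrangulationD:
  assumes "M \<in> quadrangulations n g"
  shows "finite (sides M)" "sides M \<noteq> {}" "nxt M permutes sides M" "glue M permutes sides M"
    "\<And>s. s \<in> sides M \<Longrightarrow> glue M (glue M s) = s" "\<And>s. s \<in> sides M \<Longrightarrow> glue M s \<noteq> s"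
    "\<And>s. s \<in> sides M \<Longrightarrow> card (orbit (nxt M) s) = 4"
    "connected_gluing M" "black M \<subseteq> vertices M" "root_edge M \<in> edges M"
    "\<And>s. s \<in> sides M \<Longrightarrow> vertex_of M s \<in> black M \<longleftrightarrow> vertex_of M (nxt M s) \<notin> black M"
    "card (faces M) = n" "has_genus M g" "rooted_bipartite_map M"
  using assms
  by (auto simp: quadrangulations_def bipartite_quadrangulation_def rooted_bipartite_map_def
      is_map_def polygon_gluing_def faces_def)

lemma card_sides:
  assumes "M \<in> quadrangulations n g" shows "card (sides M) = 4 * n"
  using card_orbits_4[of "nxt M" "sides M"] quadrangulationD[OF assms] by (simp add: faces_def)

lemma card_edges_glue:
  assumes "finite S" "a permutes S" "\<And>s. s \<in> S \<Longrightarrow> a (a s) = s" "\<And>s. s \<in> S \<Longrightarrow> a s \<noteq> s"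
    "card S = 4 * n"
  shows "card ((\<lambda>s. {s, a s}) ` S) = 2 * n"
  using card_pairs_involution[of S a] permutes_in_image[OF assms(2)] assms by simp

lemma card_vertices:
  assumes M: "M \<in> quadrangulations n g" shows "card (vertices M) + 2 * g = n + 2"
proof -
  note q = quadrangulationD[OF M]
  have "card (edges M) = 2 * n"
    unfolding edges_def by (rule card_edges_glue) (use q card_sides[OF M] in auto)
  then show ?thesis using q(12,13) by (simp add: has_genus_def euler_char_def)
qed

definition colour :: "rooted_bicoloured \<Rightarrow> nat set" where
  "colour M = {s \<in> sides M. vertex_of M s \<in> black M}"

lemma black_colour:
  assumes "M \<in> quadrangulations n g"
  shows "black M = orbit (nxt M \<circ> glue M) ` colour M"
  using quadrangulationD(9)[OF assms] by (auto simp: colour_def vertices_def vertex_of_def)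

lemma bipartite_gluing_of:
  assumes M: "M \<in> quadrangulations n g"
  shows "bipartite_gluing (sides M) (nxt M) (glue M) (colour M)"
proof
  note q = quadrangulationD[OF M]
  have perm: "permutation (nxt M \<circ> glue M)"
    using permutes_compose[OF q(4,3)] q(1) permutation_permutes by auto
  have in_S: "nxt M s \<in> sides M \<longleftrightarrow> s \<in> sides M" "glue M s \<in> sides M \<longleftrightarrow> s \<in> sides M" for s
    by (rule permutes_in_image[OF q(3)], rule permutes_in_image[OF q(4)])
  have v: "vertex_of M (nxt M (glue M s)) = vertex_of M s" for s
    using permutation_orbit_step[OF perm, of s] by (simp add: vertex_of_def)
  show "nxt M (glue M s) \<in> colour M \<longleftrightarrow> s \<in> colour M" if "s \<in> sides M" for s
    using v[of s] in_S that by (simp add: colour_def)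
  show "glue M s \<in> colour M \<longleftrightarrow> s \<notin> colour M" if "s \<in> sides M" for s
    using v[of "glue M s"] q(5,11)[OF that] in_S that by (auto simp: colour_def)
  show "(s, t) \<in> {(x, y). x \<in> sides M \<and> (y = nxt M x \<or> y = glue M x)}\<^sup>*"
    if "s \<in> sides M" "t \<in> sides M" for s t
    using q(8) that by (simp add: connected_gluing_def)
qed (use quadrangulationD[OF M] in auto)

definition labelled_quads :: "nat \<Rightarrow> nat \<Rightarrow> rooted_bicoloured set" where
  "labelled_quads n g = {M \<in> quadrangulations n g. sides M = {0..<4 * n}}"

definition pointed_quads :: "nat \<Rightarrow> nat \<Rightarrow> (rooted_bicoloured \<times> nat set) set" where
  "pointed_quads n g = (SIGMA M : labelled_quads n g. vertices M)"

definition height :: "rooted_bicoloured \<Rightarrow> nat set \<Rightarrow> nat \<Rightarrow> int" where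
  "height M = bipartite_gluing.dist_from (sides M) (nxt M) (glue M)"

text \<open>
  The part of a pointed quadrangulation that opening, cutting and closing leave alone.  With the
  sides fixed, only \<open>nxt\<close> is left to vary; the black vertices are recovered from the parity of the
  labels and the colour of the point.
\<close>

definition frame :: "rooted_bicoloured \<times> nat set \<Rightarrow> (nat \<Rightarrow> nat) \<times> (nat \<Rightarrow> int) \<times> bool \<times> nat set" where
  "frame = (\<lambda>(M, v). (glue M, height M v, v \<in> black M, root_edge M))"

lemma finite_labelled_quads: "finite (labelled_quads n g)"
proof -
  let ?S = "{0..<4 * n}"
  let ?P = "{p. p permutes ?S}"
  let ?f = "\<lambda>M :: rooted_bicoloured. (nxt M, glue M, black M, root_edge M)"
  have inj: "inj_on ?f (labelled_quads n g)"
  proof (rule inj_onI)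
    fix M N assume "M \<in> labelled_quads n g" "N \<in> labelled_quads n g" "?f M = ?f N"
    then show "M = N" by (intro rooted_bicoloured_eqI) (auto simp: labelled_quads_def)
  qed
  have sub: "?f ` labelled_quads n g \<subseteq> ?P \<times> ?P \<times> Pow (Pow ?S) \<times> Pow ?S"
  proof
    fix y assume "y \<in> ?f ` labelled_quads n g"
    then obtain M where M: "M \<in> quadrangulations n g" "sides M = ?S" "y = ?f M"
      by (auto simp: labelled_quads_def)
    show "y \<in> ?P \<times> ?P \<times> Pow (Pow ?S) \<times> Pow ?S"
      using quadrangulationD[OF M(1)] rooted_bipartite_map_sets[of M] M(2,3) by auto
  qed
  have "finite (?P \<times> ?P \<times> Pow (Pow ?S) \<times> Pow ?S)"
    by (intro finite_cartesian_product) (simp_all add: finite_permutations)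
  with sub have "finite (?f ` labelled_quads n g)" by (rule finite_subset)
  then show ?thesis using inj by (rule finite_imageD)
qed

lemma card_pointed:
  assumes "k + 2 * g = n + 2"
  shows "card (pointed_quads n g) = k * card (labelled_quads n g)" "finite (pointed_quads n g)"
proof -
  have v: "finite (vertices M)" "card (vertices M) = k" if "M \<in> labelled_quads n g" for M
    using that quadrangulationD(1)[of M n g] card_vertices[of M n g] assms
    by (auto simp: labelled_quads_def vertices_def)
  show "finite (pointed_quads n g)"
    unfolding pointed_quads_def using finite_labelled_quads v by (intro finite_SigmaI) auto
  show "card (pointed_quads n g) = k * card (labelled_quads n g)"
    unfolding pointed_quads_def using v finite_labelled_quads
    by (subst card_SigmaI) auto
qed

lemma pointed_quadsD:
  assumes "(M, v) \<in> pointed_quads n g" "frame (M, v) = (gl, h, c, e)"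
  shows "M \<in> quadrangulations n g" "sides M = {0..<4 * n}" "glue M = gl" "root_edge M = e"
    "v \<in> orbit (nxt M \<circ> gl) ` {0..<4 * n}" "v \<in> black M \<longleftrightarrow> c"
    "bipartite_gluing.dist_from {0..<4 * n} (nxt M) gl v = h"
    "bipartite_gluing {0..<4 * n} (nxt M) gl (colour M)"
proof -
  show M: "M \<in> quadrangulations n g" "sides M = {0..<4 * n}" "glue M = gl" "root_edge M = e"
    "v \<in> black M \<longleftrightarrow> c"
    using assms by (auto simp: pointed_quads_def labelled_quads_def frame_def)
  have "v \<in> vertices M" using assms(1) by (simp add: pointed_quads_def)
  then show "v \<in> orbit (nxt M \<circ> gl) ` {0..<4 * n}"
    using M(2,3) by (simp add: vertices_def vertex_of_def[abs_def])
  show "bipartite_gluing.dist_from {0..<4 * n} (nxt M) gl v = h"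
    using assms(2) M(2,3) by (simp add: frame_def height_def)
  show "bipartite_gluing {0..<4 * n} (nxt M) gl (colour M)"
    using bipartite_gluing_of[OF M(1)] M(2,3) by simp
qed

lemma pointed_quads_eqI:
  assumes M: "(M, v) \<in> pointed_quads n g" "frame (M, v) = (gl, h, c, e)"
    and N: "(N, w) \<in> pointed_quads n g" "frame (N, w) = (gl, h, c, e)"
    and nxt: "nxt M = nxt N"
  shows "(M, v) = (N, w)"
proof -
  let ?S = "{0..<4 * n}"
  note M = pointed_quadsD[OF M] and N = pointed_quadsD[OF N, folded nxt]
  have vw: "v = w"
    using bipartite_gluing.dist_from_sinks[OF M(8,5)] bipartite_gluing.dist_from_sinks[OF M(8) N(5)]
    unfolding M(7) N(7) by simp
  obtain z where z: "z \<in> ?S" "v = orbit (nxt M \<circ> gl) z" using M(5) by auto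
  have zv: "z \<in> v" unfolding z(2) by (rule bipartite_gluing.self_orbit[OF M(8)])
  have "vertex_of M z = v" "vertex_of N z = v"
    using z(2) M(3) N(3) nxt by (simp_all add: vertex_of_def)
  then have c: "z \<in> colour M \<longleftrightarrow> c" "z \<in> colour N \<longleftrightarrow> c"
    using M(2,6) N(2,6) vw z(1) by (simp_all add: colour_def)
  have "s \<in> colour M \<longleftrightarrow> s \<in> colour N" if "s \<in> ?S" for s
    using bipartite_gluing.dist_from_colour[OF M(8,5) zv that]
      bipartite_gluing.dist_from_colour[OF N(8) M(5) zv that] c by simp
  moreover have "colour M \<subseteq> ?S" "colour N \<subseteq> ?S" using M(2) N(2) by (auto simp: colour_def)
  ultimately have "colour M = colour N" by blast
  then have "black M = black N"
    using black_colour[OF M(1)] black_colour[OF N(1)] M(3) N(3) nxt by simp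
  then show ?thesis
    using M(2-4) N(2-4) nxt vw rooted_bicoloured_eqI[of M N] by simp
qed

lemma fibre_card_le:
  assumes x: "x \<in> pointed_quads n g0" "frame x = (gl, h, c, e)" and k: "k + 2 * g = n + 2"
  shows "card {x \<in> pointed_quads n g. frame x = (gl, h, c, e)} \<le>
    card (height_sides.quads {0..<4 * n} gl h k)"
proof -
  let ?S = "{0..<4 * n}"
  let ?X = "{x \<in> pointed_quads n g. frame x = (gl, h, c, e)}"
  obtain M0 v0 where M0v0: "x = (M0, v0)" by (cases x)
  note M0 = pointed_quadsD[OF x[unfolded M0v0]]
  have "height_sides ?S gl h"
    using bipartite_gluing.height_sides_dist[OF M0(8,5)] unfolding M0(7) .
  then interpret height_sides ?S gl h .
  show ?thesis
  proof (rule card_inj_on_le[OF _ _ finite_quads])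
    show "inj_on (nxt \<circ> fst) ?X"
    proof (rule inj_onI)
      fix y z assume "y \<in> ?X" "z \<in> ?X" "(nxt \<circ> fst) y = (nxt \<circ> fst) z"
      then show "y = z"
        using pointed_quads_eqI[of "fst y" "snd y" n g gl h c e "fst z" "snd z"] by simp
    qed
    have "nxt M \<in> quads k" if "(M, v) \<in> pointed_quads n g" "frame (M, v) = (gl, h, c, e)" for M v
    proof -
      note M = pointed_quadsD[OF that]
      have "quad (nxt M)"
        using bipartite_gluing.quad_dist[OF M(8,5)] quadrangulationD(7)[OF M(1)] M(2)
        unfolding M(7) by simp
      moreover have "ncyc (nxt M \<circ> gl) ?S = k"
        using card_vertices[OF M(1)] M(2,3) k
        by (simp add: ncyc_def vertices_def vertex_of_def[abs_def])
      ultimately show ?thesis by (simp add: quads_def)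
    qed
    then show "(nxt \<circ> fst) ` ?X \<subseteq> quads k" by auto
  qed
qed

text \<open>
  The point \<open>x\<close> only serves to know that the labels in the frame are admissible: minimum zero, zero
  outside the sides, and steps of one along edges.  Closing up a scheme changes none of this, so the
  labels of the new quadrangulation are again distances.
\<close>

lemma fibre_card_ge:
  assumes x: "x \<in> pointed_quads n g0" "frame x = (gl, h, c, e)" and k: "k + 2 * g = n + 2"
  shows "card (height_sides.quads {0..<4 * n} gl h k) \<le>
    card {x \<in> pointed_quads n g. frame x = (gl, h, c, e)}"
proof -
  let ?S = "{0..<4 * n}"
  let ?Y = "{x \<in> pointed_quads n g. frame x = (gl, h, c, e)}"
  obtain M0 v0 where M0v0: "x = (M0, v0)" by (cases x)
  note M0 = pointed_quadsD[OF x[unfolded M0v0]]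
  note q0 = quadrangulationD[OF M0(1)]
  interpret M0: bipartite_gluing ?S "nxt M0" gl "colour M0" by (rule M0(8))
  interpret height_sides ?S gl h
    using M0.height_sides_dist[OF M0(5)] unfolding M0(7) .
  have outside: "h s = 0" if "s \<notin> ?S" for s
    unfolding M0(7)[symmetric] M0.dist_from_def using that by simp
  have nonneg: "0 \<le> h s" if "s \<in> ?S" for s
    using M0.dist_from_within(2)[OF M0(5) that] unfolding M0(7) .
  obtain z0 where z0: "z0 \<in> ?S" "v0 = orbit (nxt M0 \<circ> gl) z0" using M0(5) by auto
  have "z0 \<in> v0" unfolding z0(2) by (rule M0.self_orbit)
  then have "h z0 = 0" using M0.dist_from_zero[OF M0(5)] unfolding M0(7) by simp
  then have zero: "\<exists>s\<in>?S. h s = 0" using z0(1) by blast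
  define mk :: "(nat \<Rightarrow> nat) \<Rightarrow> rooted_bicoloured" where
    "mk f = \<lparr>sides = ?S, nxt = f, glue = gl,
       black = orbit (f \<circ> gl) ` {s \<in> ?S. even (h s) \<longleftrightarrow> c}, root_edge = e\<rparr>" for f
  have "\<exists>v. (mk f, v) \<in> ?Y" if fk: "f \<in> quads k" for f
  proof -
    have fq: "quad f" "ncyc (f \<circ> gl) ?S = k" using fk by (auto simp: quads_def)
    interpret F: height_quad ?S gl h f by unfold_locales (rule fq)
    have h_orbit: "h t = h s" if "t \<in> orbit F.\<rho> s" for s t
      using that by (induction rule: orbit.induct) (use F.height_rho in auto)
    have self: "s \<in> orbit F.\<rho> s" for s by (rule permutation_self_in_orbit[OF F.rho])
    have blk: "orbit F.\<rho> s \<in> black (mk f) \<longleftrightarrow> (even (h s) \<longleftrightarrow> c)" if "s \<in> ?S" for s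
    proof
      assume "orbit F.\<rho> s \<in> black (mk f)"
      then obtain t where "orbit F.\<rho> s = orbit F.\<rho> t" "even (h t) \<longleftrightarrow> c" by (auto simp: mk_def)
      then show "even (h s) \<longleftrightarrow> c" using h_orbit[of s t] self[of s] by simp
    qed (use that in \<open>auto simp: mk_def\<close>)
    have "card ?S = 4 * card (orbit f ` ?S)"
      by (rule card_orbits_4[OF F.f]) (use F.card_face in auto)
    then have faces: "card (faces (mk f)) = n" by (simp add: faces_def mk_def)
    have e_in: "e \<in> edges (mk f)" using q0(10) M0 by (simp add: edges_def mk_def)
    have "card ((\<lambda>s. {s, gl s}) ` ?S) = 2 * n"
      by (rule card_edges_glue) (use q0 M0 in auto)
    then have edges: "card (edges (mk f)) = 2 * n" by (simp add: edges_def mk_def)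
    have verts: "card (vertices (mk f)) = k"
      using fq(2) by (simp add: vertices_def vertex_of_def ncyc_def mk_def)
    have step: "even (h (gl s)) \<noteq> even (h s)" if "s \<in> ?S" for s
    proof -
      have "h (gl s) = h s + 1 \<or> h (gl s) = h s - 1" using height_gl[OF that] by linarith
      then show ?thesis by auto
    qed
    have "polygon_gluing (mk f)"
      using F.f q0(2,4,5,6) M0 by (auto simp: polygon_gluing_def mk_def)
    moreover have "connected_gluing (mk f)"
      using F.connected_moves by (simp add: connected_gluing_def mk_def)
    moreover have "black (mk f) \<subseteq> vertices (mk f)"
      by (auto simp: mk_def vertices_def vertex_of_def)
    moreover have "vertex_of (mk f) s \<in> black (mk f) \<longleftrightarrow> vertex_of (mk f) (nxt (mk f) s) \<notin> black (mk f)"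
      if "s \<in> sides (mk f)" for s
    proof -
      have s: "s \<in> ?S" "f s \<in> ?S" using that F.f_in_S by (auto simp: mk_def)
      have "vertex_of (mk f) s = orbit F.\<rho> s" "vertex_of (mk f) (nxt (mk f) s) = orbit F.\<rho> (f s)"
        by (simp_all add: vertex_of_def mk_def)
      then show ?thesis using blk[OF s(1)] blk[OF s(2)] F.height_f[OF s(1)] step[OF s(1)] by auto
    qed
    ultimately have "rooted_bipartite_map (mk f)"
      using e_in by (simp add: rooted_bipartite_map_def is_map_def) (simp add: mk_def)
    moreover have "\<forall>X\<in>faces (mk f). card X = 4" using F.card_face by (simp add: faces_def mk_def)
    moreover have "has_genus (mk f) g"
      using faces edges verts k by (simp add: has_genus_def euler_char_def)
    ultimately have Q: "mk f \<in> quadrangulations n g"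
      using faces by (simp add: quadrangulations_def bipartite_quadrangulation_def)
    have sel: "sides (mk f) = ?S" "nxt (mk f) = f" "glue (mk f) = gl" "root_edge (mk f) = e"
      by (simp_all add: mk_def)
    interpret N: bipartite_gluing ?S f gl "colour (mk f)"
      using bipartite_gluing_of[OF Q] unfolding sel .
    \<comment> \<open>The labels survive, so the new distinguished vertex is the sink of the new quadrangulation.\<close>
    obtain v where sink: "{C \<in> orbit F.\<rho> ` ?S. C \<inter> D = {}} = {v}"
      using F.sink by (rule card_1_singletonE)
    then have v: "v \<in> orbit F.\<rho> ` ?S" by blast
    have h_eq: "h = N.dist_from v"
    proof (rule N.dist_from_unique[OF v _ height_gl nonneg zero outside])
      show "h (f (gl s)) = h s" for s using F.height_rho[of s] by simp
    qed (use sink in \<open>auto simp: D_def\<close>)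
    obtain s0 where s0: "s0 \<in> ?S" "v = orbit F.\<rho> s0" using v by auto
    have "h s0 = 0" unfolding h_eq by (rule N.dist_from_zero[OF v]) (use s0 self in simp)
    then have "v \<in> black (mk f) \<longleftrightarrow> c" using blk[OF s0(1)] s0(2) by simp
    moreover have "height (mk f) v = h" unfolding height_def sel by (rule h_eq[symmetric])
    moreover have "v \<in> vertices (mk f)" using v by (simp add: vertices_def vertex_of_def[abs_def] sel)
    ultimately have "(mk f, v) \<in> ?Y"
      using Q sel by (simp add: pointed_quads_def labelled_quads_def frame_def)
    then show ?thesis by blast
  qed
  then have "\<forall>f\<in>quads k. \<exists>v. (mk f, v) \<in> ?Y" by blast
  then obtain pt where pt: "\<forall>f\<in>quads k. (mk f, pt f) \<in> ?Y" unfolding bchoice_iff ..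
  show ?thesis
  proof (rule card_inj_on_le)
    show "inj_on (\<lambda>f. (mk f, pt f)) (quads k)" by (rule inj_onI) (simp add: mk_def)
    show "(\<lambda>f. (mk f, pt f)) ` quads k \<subseteq> ?Y" using pt by blast
    show "finite ?Y" using card_pointed(2)[OF k] by simp
  qed
qed

lemma card_labelled_step:
  assumes k: "k + 2 * g = n + 2" and g: "g \<ge> 1"
  shows "3 * (2 * g) * (k * card (labelled_quads n g)) \<le>
    (2 * n) ^ 3 * ((k + 2) * card (labelled_quads n (g - 1)))"
proof -
  let ?P = "pointed_quads n g" and ?P' = "pointed_quads n (g - 1)"
  let ?F = "\<lambda>\<delta>. {x \<in> ?P. frame x = \<delta>}" and ?F' = "\<lambda>\<delta>. {x \<in> ?P'. frame x = \<delta>}"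
  have k': "k + 2 + 2 * (g - 1) = n + 2" using k g by simp
  have fin: "finite ?P" "finite ?P'" using card_pointed(2)[OF k] card_pointed(2)[OF k'] by auto
  have le: "3 * (2 * g) * card (?F \<delta>) \<le> (2 * n) ^ 3 * card (?F' \<delta>)" if \<delta>P: "\<delta> \<in> frame ` ?P" for \<delta>
  proof -
    obtain gl h c e where \<delta>: "\<delta> = (gl, h, c, e)" by (cases \<delta>)
    obtain M v where x: "(M, v) \<in> ?P" "frame (M, v) = (gl, h, c, e)" using \<delta>P \<delta> by force
    note M = pointed_quadsD[OF x]
    interpret height_sides "{0..<4 * n}" gl h
      using bipartite_gluing.height_sides_dist[OF M(8,5)] unfolding M(7) .
    have "bij_betw gl D ({0..<4 * n} - D)"
      by (rule bij_betw_byWitness[where f' = gl]) (use gl_gl' gl_up gl_down gl_in_S down_S in auto)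
    then have "card D = card ({0..<4 * n} - D)" by (rule bij_betw_same_card)
    then have "card D = 4 * n - card D" using D_subset finite_D by (simp add: card_Diff_subset)
    then have D: "card D = 2 * n" by simp
    have "3 * (2 * g) * card (?F \<delta>) \<le> 3 * (2 * g) * card (quads k)"
      using fibre_card_le[OF x k] unfolding \<delta> by simp
    also have "\<dots> = 3 * (n + 2 - k) * card (quads k)"
    proof -
      have "n + 2 - k = 2 * g" using k by simp
      then show ?thesis by simp
    qed
    also have "\<dots> \<le> (2 * n) ^ 3 * card (quads (k + 2))" by (rule card_quads_step[OF D])
    also have "\<dots> \<le> (2 * n) ^ 3 * card (?F' \<delta>)"
      using fibre_card_ge[OF x k'] unfolding \<delta> by simp
    finally show ?thesis .
  qed
  have "card ?P = (\<Sum>\<delta>\<in>frame ` ?P. card (?F \<delta>))"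
    using sum.image_gen[OF fin(1), of "\<lambda>_. 1::nat" frame] by simp
  then have "3 * (2 * g) * card ?P = (\<Sum>\<delta>\<in>frame ` ?P. 3 * (2 * g) * card (?F \<delta>))"
    by (simp only: sum_distrib_left)
  also have "\<dots> \<le> (\<Sum>\<delta>\<in>frame ` ?P. (2 * n) ^ 3 * card (?F' \<delta>))" by (rule sum_mono) (rule le)
  also have "\<dots> = (2 * n) ^ 3 * (\<Sum>\<delta>\<in>frame ` ?P. card (?F' \<delta>))" by (simp only: sum_distrib_left)
  also have "(\<Sum>\<delta>\<in>frame ` ?P. card (?F' \<delta>)) = card (\<Union>\<delta>\<in>frame ` ?P. ?F' \<delta>)"
    by (rule card_UN_disjoint[symmetric]) (use fin in auto)
  also have "card (\<Union>\<delta>\<in>frame ` ?P. ?F' \<delta>) \<le> card ?P'" by (rule card_mono) (use fin in auto)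
  finally have "3 * (2 * g) * card ?P \<le> (2 * n) ^ 3 * card ?P'" by simp
  then show ?thesis using card_pointed(1)[OF k] card_pointed(1)[OF k'] by simp
qed

text \<open>
  A quadrangulation of genus \<open>g\<close> has \<open>k\<close> pointings and one of genus \<open>g - 1\<close> has \<open>k + 2\<close>; the quotient
  is at most \<open>3\<close>, which is the factor gained from the rotated triples.
\<close>

lemma labelled_inequality:
  assumes g: "g \<ge> 1"
  shows "2 * g * card (labelled_quads n g) \<le> (2 * n) ^ 3 * card (labelled_quads n (g - 1))"
proof (cases "labelled_quads n g = {}")
  case True
  then show ?thesis by simp
next
  case False
  then obtain M where M: "M \<in> quadrangulations n g" by (auto simp: labelled_quads_def)
  define k where "k = card (vertices M)"
  have k: "k + 2 * g = n + 2" unfolding k_def by (rule card_vertices[OF M])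
  have k1: "1 \<le> k"
    using quadrangulationD(1,2)[OF M] by (simp add: k_def vertices_def Suc_le_eq card_gt_0_iff)
  let ?R = "card (labelled_quads n g)" and ?R' = "card (labelled_quads n (g - 1))"
  have "3 * k * (2 * g * ?R) \<le> (2 * n) ^ 3 * ((k + 2) * ?R')"
    using card_labelled_step[OF k g] by (simp add: mult_ac)
  also have "\<dots> \<le> (2 * n) ^ 3 * (3 * k * ?R')" using k1 by (intro mult_left_mono mult_right_mono) auto
  finally have "3 * k * (2 * g * ?R) \<le> 3 * k * ((2 * n) ^ 3 * ?R')" by (simp add: mult_ac)
  then show ?thesis using k1 by simp
qed


section \<open>Relabelling the sides\<close>

definition relabel :: "(nat \<Rightarrow> nat) \<Rightarrow> rooted_bicoloured \<Rightarrow> rooted_bicoloured" where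
  "relabel p M = \<lparr>sides = p ` sides M, nxt = map_permutation (sides M) p (nxt M),
     glue = map_permutation (sides M) p (glue M), black = (`) p ` black M,
     root_edge = p ` root_edge M\<rparr>"

context
  fixes M :: rooted_bicoloured and n g :: nat and p :: "nat \<Rightarrow> nat"
  assumes M: "M \<in> quadrangulations n g" and inj: "inj_on p (sides M)"
begin

lemmas quad_facts = quadrangulationD[OF M]

lemma sides_closed: "s \<in> sides M \<Longrightarrow> nxt M s \<in> sides M" "s \<in> sides M \<Longrightarrow> glue M s \<in> sides M"
  using permutes_in_image[OF quad_facts(3)] permutes_in_image[OF quad_facts(4)] by auto

lemma relabel_sel: "sides (relabel p M) = p ` sides M" "black (relabel p M) = (`) p ` black M"
  "root_edge (relabel p M) = p ` root_edge M"
  by (simp_all add: relabel_def)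

lemma relabel_apply:
  "s \<in> sides M \<Longrightarrow> nxt (relabel p M) (p s) = p (nxt M s)"
  "s \<in> sides M \<Longrightarrow> glue (relabel p M) (p s) = p (glue M s)"
  by (simp_all add: relabel_def map_permutation_apply[OF inj])

lemma relabel_permutes:
  "nxt (relabel p M) permutes p ` sides M" "glue (relabel p M) permutes p ` sides M"
proof -
  have "bij_betw p (sides M) (p ` sides M)" using inj by (rule inj_on_imp_bij_betw)
  then show "nxt (relabel p M) permutes p ` sides M" "glue (relabel p M) permutes p ` sides M"
    using map_permutation_permutes quad_facts(3,4) by (simp_all add: relabel_def)
qed

lemma relabel_orbit:
  assumes s: "s \<in> sides M" and f: "f permutes sides M"
    and f': "\<And>s. s \<in> sides M \<Longrightarrow> f' (p s) = p (f s)"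
  shows "orbit f' (p s) = p ` orbit f s"
proof (rule orbit_inverse[symmetric])
  show "s \<in> orbit f s"
    by (rule permutation_self_in_orbit) (use f quad_facts(1) permutation_permutes in auto)
  show "f' (p x) = p (f x)" if "x \<in> orbit f s" for x
    by (rule f') (use that permutes_orbit_subset[OF f s] in auto)
qed

lemma relabel_face: "s \<in> sides M \<Longrightarrow> orbit (nxt (relabel p M)) (p s) = p ` orbit (nxt M) s"
  by (rule relabel_orbit[OF _ quad_facts(3)]) (use relabel_apply in auto)

lemma relabel_vertex: "s \<in> sides M \<Longrightarrow> vertex_of (relabel p M) (p s) = p ` vertex_of M s"
  unfolding vertex_of_def
  by (rule relabel_orbit[OF _ permutes_compose[OF quad_facts(4,3)]]) (use relabel_apply sides_closed in auto)

lemma relabel_faces: "faces (relabel p M) = (`) p ` faces M"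
  unfolding faces_def relabel_sel image_image by (rule image_cong) (use relabel_face in auto)

lemma relabel_vertices: "vertices (relabel p M) = (`) p ` vertices M"
  unfolding vertices_def relabel_sel image_image by (rule image_cong) (use relabel_vertex in auto)

lemma relabel_edges: "edges (relabel p M) = (`) p ` edges M"
  unfolding edges_def relabel_sel image_image by (rule image_cong) (use relabel_apply in auto)

lemma cells_subset: "faces M \<subseteq> Pow (sides M)" "vertices M \<subseteq> Pow (sides M)" "edges M \<subseteq> Pow (sides M)"
proof -
  show "faces M \<subseteq> Pow (sides M)"
    unfolding faces_def using permutes_orbit_subset[OF quad_facts(3)] by blast
  show "vertices M \<subseteq> Pow (sides M)"
    unfolding vertices_def vertex_of_def using permutes_orbit_subset[OF permutes_compose[OF quad_facts(4,3)]] by blast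
  show "edges M \<subseteq> Pow (sides M)"
    unfolding edges_def using sides_closed(2) by blast
qed

lemma image_inj: "inj_on ((`) p) (Pow (sides M))"
  using inj by (rule inj_on_image_Pow)

lemma relabel_card_cells:
  "card (faces (relabel p M)) = card (faces M)" "card (vertices (relabel p M)) = card (vertices M)"
  "card (edges (relabel p M)) = card (edges M)"
  unfolding relabel_faces relabel_vertices relabel_edges
  by (rule card_image, rule inj_on_subset[OF image_inj cells_subset(1)])
    (rule card_image, rule inj_on_subset[OF image_inj cells_subset(2)],
     rule card_image, rule inj_on_subset[OF image_inj cells_subset(3)])

lemma relabel_black:
  assumes "s \<in> sides M"
  shows "vertex_of (relabel p M) (p s) \<in> black (relabel p M) \<longleftrightarrow> vertex_of M s \<in> black M"
proof -
  have "vertex_of M s \<in> vertices M" using assms by (simp add: vertices_def)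
  then show ?thesis
    unfolding relabel_vertex[OF assms] relabel_sel
    using inj_on_image_mem_iff[OF image_inj, of "vertex_of M s" "black M"] cells_subset(2) quad_facts(9)
    by auto
qed

lemma relabel_iso: "map_isomorphism p M (relabel p M)"
  using inj relabel_apply by (simp add: map_isomorphism_def relabel_sel inj_on_imp_bij_betw)

lemma relabel_connected: "connected_gluing (relabel p M)"
  unfolding connected_gluing_def relabel_sel
proof (intro ballI)
  let ?R = "{(x, y). x \<in> p ` sides M \<and> (y = nxt (relabel p M) x \<or> y = glue (relabel p M) x)}"
  let ?T = "{(x, y). x \<in> sides M \<and> (y = nxt M x \<or> y = glue M x)}"
  fix x y assume "x \<in> p ` sides M" "y \<in> p ` sides M"
  then obtain s t where st: "s \<in> sides M" "t \<in> sides M" "x = p s" "y = p t" by auto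
  have "(s, t) \<in> ?T\<^sup>*" using quad_facts(8) st(1,2) by (simp add: connected_gluing_def)
  then have "(p s, p t) \<in> ?R\<^sup>*"
  proof (induction rule: rtrancl_induct)
    case (step y z)
    then have "(p y, p z) \<in> ?R" using relabel_apply by auto
    with step.IH show ?case by (rule rtrancl_into_rtrancl)
  qed simp
  then show "(x, y) \<in> ?R\<^sup>*" using st by simp
qed

lemma relabel_quadrangulation: "relabel p M \<in> quadrangulations n g"
proof -
  let ?N = "relabel p M"
  have "polygon_gluing ?N"
  proof -
    have "glue ?N x \<noteq> x \<and> glue ?N (glue ?N x) = x" if x: "x \<in> p ` sides M" for x
    proof -
      obtain s where s: "s \<in> sides M" "x = p s" using x by auto
      have "p (glue M s) \<noteq> p s" using inj_onD[OF inj] quad_facts(6)[OF s(1)] sides_closed(2)[OF s(1)] s(1) by metis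
      then show ?thesis using s quad_facts(5)[OF s(1)] sides_closed(2)[OF s(1)] by (simp add: relabel_apply)
    qed
    then show ?thesis
      using quad_facts(1,2) relabel_permutes by (simp add: polygon_gluing_def relabel_sel)
  qed
  moreover have "vertex_of ?N x \<in> black ?N \<longleftrightarrow> vertex_of ?N (nxt ?N x) \<notin> black ?N" if x: "x \<in> sides ?N" for x
  proof -
    obtain s where s: "s \<in> sides M" "x = p s" using x by (auto simp: relabel_sel)
    have "nxt ?N x = p (nxt M s)" using relabel_apply s by simp
    then show ?thesis using relabel_black s quad_facts(11)[OF s(1)] sides_closed(1)[OF s(1)] by simp
  qed
  moreover have "black ?N \<subseteq> vertices ?N" "root_edge ?N \<in> edges ?N"
    unfolding relabel_vertices relabel_edges relabel_sel using quad_facts(9,10) by auto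
  ultimately have "rooted_bipartite_map ?N"
    using relabel_connected by (simp add: rooted_bipartite_map_def is_map_def)
  moreover have "card X = 4" if X: "X \<in> faces ?N" for X
  proof -
    obtain s where s: "s \<in> sides M" "X = orbit (nxt ?N) (p s)" using X by (auto simp: faces_def relabel_sel)
    have "inj_on p (orbit (nxt M) s)"
      using inj permutes_orbit_subset[OF quad_facts(3) s(1)] by (rule inj_on_subset)
    then show ?thesis using s quad_facts(7)[OF s(1)] relabel_face by (simp add: card_image)
  qed
  moreover have "has_genus ?N g" using quad_facts(13) by (simp add: has_genus_def euler_char_def relabel_card_cells)
  ultimately show ?thesis
    using quad_facts(12) by (simp add: quadrangulations_def bipartite_quadrangulation_def relabel_card_cells)
qed

text \<open>
  Together with \<open>iso_unique\<close> this makes the relabellings of one map correspond to the permutations of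
  its sides.
\<close>

lemma iso_target:
  assumes N: "N \<in> quadrangulations n g'" and iso: "map_isomorphism p M N"
  shows "N = relabel p M"
proof (rule rooted_bicoloured_eqI)
  note qN = quadrangulationD[OF N]
  have sides: "sides N = p ` sides M" using iso by (auto simp: map_isomorphism_def bij_betw_def)
  have ap: "nxt N (p s) = p (nxt M s)" "glue N (p s) = p (glue M s)" if "s \<in> sides M" for s
    using iso that by (auto simp: map_isomorphism_def)
  show "sides N = sides (relabel p M)" using sides by (simp add: relabel_sel)
  show "black N = black (relabel p M)" "root_edge N = root_edge (relabel p M)"
    using iso by (auto simp: map_isomorphism_def relabel_sel)
  show "nxt N = nxt (relabel p M)"
  proof
    fix x show "nxt N x = nxt (relabel p M) x"
      using permutes_not_in[OF qN(3), of x] permutes_not_in[OF relabel_permutes(1), of x]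
      by (cases "x \<in> p ` sides M") (auto simp: ap relabel_apply sides)
  qed
  show "glue N = glue (relabel p M)"
  proof
    fix x show "glue N x = glue (relabel p M) x"
      using permutes_not_in[OF qN(4), of x] permutes_not_in[OF relabel_permutes(2), of x]
      by (cases "x \<in> p ` sides M") (auto simp: ap relabel_apply sides)
  qed
qed

end

lemma relabel_cong:
  assumes "M \<in> quadrangulations n g" "\<And>s. s \<in> sides M \<Longrightarrow> p s = p' s" "inj_on p (sides M)"
    "inj_on p' (sides M)"
  shows "relabel p M = relabel p' M"
proof (rule iso_target[OF assms(1,4) relabel_quadrangulation[OF assms(1,3)]])
  note q = quadrangulationD[OF assms(1)]
  have sub: "A \<subseteq> sides M \<Longrightarrow> p ` A = p' ` A" for A using assms(2) by (auto intro!: image_cong)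
  have "rooted_bipartite_map M" by (rule q(14))
  note b = rooted_bipartite_map_sets[OF this]
  have "(`) p' ` black M = (`) p ` black M" using b(1) by (intro image_cong refl sub[symmetric]) auto
  moreover have "p' ` root_edge M = p ` root_edge M" using b(2) sub by auto
  moreover have "nxt M s \<in> sides M" "glue M s \<in> sides M" if "s \<in> sides M" for s
    using that permutes_in_image[OF q(3)] permutes_in_image[OF q(4)] by auto
  ultimately show "map_isomorphism p' M (relabel p M)"
    using relabel_iso[OF assms(1,3)] assms(2) bij_betw_cong[of "sides M" p p']
    by (simp add: map_isomorphism_def)
qed

text \<open>
  The colours orient the root edge, so the two relabellings agree on its black end; agreement then
  spreads along \<open>nxt\<close> and \<open>glue\<close> by connectedness.
\<close>

lemma iso_unique:
  assumes M: "M \<in> quadrangulations n g" and inj: "inj_on p (sides M)" "inj_on p' (sides M)"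
    and eq: "relabel p M = relabel p' M" and s: "s \<in> sides M"
  shows "p s = p' s"
proof -
  note q = quadrangulationD[OF M]
  interpret B: bipartite_gluing "sides M" "nxt M" "glue M" "colour M" by (rule bipartite_gluing_of[OF M])
  obtain r where r: "r \<in> sides M" "root_edge M = {r, glue M r}"
    using q(10) by (auto simp: edges_def)
  have gr: "glue M r \<in> sides M" using r by simp
  have black: "vertex_of (relabel p M) (p t) \<in> black (relabel p M) \<longleftrightarrow> t \<in> colour M"
    "vertex_of (relabel p M) (p' t) \<in> black (relabel p M) \<longleftrightarrow> t \<in> colour M" if "t \<in> sides M" for t
    using relabel_black[OF M inj(1) that] relabel_black[OF M inj(2) that] that
    by (simp_all add: eq colour_def)
  have "{p r, p (glue M r)} = {p' r, p' (glue M r)}"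
    using relabel_sel(3)[OF M inj(1)] relabel_sel(3)[OF M inj(2)] r(2) eq by simp
  moreover have "p r \<noteq> p' (glue M r)"
    using black(1)[OF r(1)] black(2)[OF gr] B.B_gl[OF r(1)] by auto
  ultimately have root: "p r = p' r" by (auto simp: doubleton_eq_iff)
  have ap: "nxt (relabel p M) (p t) = p (nxt M t)" "nxt (relabel p M) (p' t) = p' (nxt M t)"
    "glue (relabel p M) (p t) = p (glue M t)" "glue (relabel p M) (p' t) = p' (glue M t)"
    if "t \<in> sides M" for t
    using relabel_apply[OF M inj(1) that] relabel_apply[OF M inj(2) that] by (simp_all add: eq)
  from B.connected[OF r(1) s] show ?thesis
  proof (induction rule: rtrancl_induct)
    case base show ?case by (rule root)
  next
    case (step y z)
    then have "y \<in> sides M" "z = nxt M y \<or> z = glue M y" by auto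
    then show ?case using ap[of y] step.IH by metis
  qed
qed

text \<open>
  Each isomorphism class has a representative with the side set \<open>{0..<4 * n}\<close>, and its relabellings by
  the permutations of this set are pairwise different by \<open>iso_unique\<close>.
\<close>

lemma card_labelled_quads: "card (labelled_quads n g) = num_quadrangulations n g * fact (4 * n)"
proof -
  let ?S = "{0..<4 * n}"
  let ?Q = "quadrangulations n g // map_iso_rel"
  let ?P = "{p. p permutes ?S}"
  have rel_refl: "(M, M) \<in> map_iso_rel" if "M \<in> quadrangulations n g" for M
    using quadrangulationD(14)[OF that] equiv_map_iso_rel by (auto simp: equiv_def refl_on_def)
  have rep: "\<exists>M. M \<in> labelled_quads n g \<and> X = map_iso_rel `` {M}" if X: "X \<in> ?Q" for X
  proof -
    obtain M where M: "M \<in> quadrangulations n g" "X = map_iso_rel `` {M}"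
      using X by (auto simp: quotient_def)
    have "card (sides M) = card ?S" using card_sides[OF M(1)] by simp
    then obtain p where p: "bij_betw p (sides M) ?S"
      using finite_same_card_bij quadrangulationD(1)[OF M(1)] by blast
    then have inj: "inj_on p (sides M)" and im: "p ` sides M = ?S" by (auto simp: bij_betw_def)
    have N: "relabel p M \<in> quadrangulations n g" by (rule relabel_quadrangulation[OF M(1) inj])
    have "(M, relabel p M) \<in> map_iso_rel"
      using relabel_iso[OF M(1) inj] quadrangulationD(14)[OF M(1)] quadrangulationD(14)[OF N]
      by (auto simp: map_iso_rel_def)
    then have "X = map_iso_rel `` {relabel p M}"
      unfolding M(2) by (rule equiv_class_eq[OF equiv_map_iso_rel])
    moreover have "relabel p M \<in> labelled_quads n g"
      using N im relabel_sel(1)[OF M(1) inj] by (simp add: labelled_quads_def)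
    ultimately show ?thesis by blast
  qed
  define r where "r X = (SOME M. M \<in> labelled_quads n g \<and> X = map_iso_rel `` {M})" for X
  have r: "r X \<in> quadrangulations n g" "sides (r X) = ?S" "X = map_iso_rel `` {r X}" if "X \<in> ?Q" for X
    using someI_ex[OF rep[OF that]] unfolding r_def[symmetric] by (auto simp: labelled_quads_def)
  have rel: "(r X, relabel p (r X)) \<in> map_iso_rel \<and> relabel p (r X) \<in> labelled_quads n g"
    if "X \<in> ?Q" "p \<in> ?P" for X p
  proof -
    note rX = r(1,2)[OF that(1)]
    have inj: "inj_on p (sides (r X))" using that(2) by (auto intro: permutes_inj_on)
    have N: "relabel p (r X) \<in> quadrangulations n g" by (rule relabel_quadrangulation[OF rX(1) inj])
    moreover have "sides (relabel p (r X)) = ?S"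
      using relabel_sel(1)[OF rX(1) inj] rX(2) that(2) permutes_image[of p ?S] by simp
    ultimately show ?thesis
      using relabel_iso[OF rX(1) inj] quadrangulationD(14)[OF rX(1)] quadrangulationD(14)[OF N]
      by (auto simp: map_iso_rel_def labelled_quads_def)
  qed
  have "bij_betw (\<lambda>(X, p). relabel p (r X)) (?Q \<times> ?P) (labelled_quads n g)"
  proof (rule bij_betw_imageI)
    show "inj_on (\<lambda>(X, p). relabel p (r X)) (?Q \<times> ?P)"
    proof (rule inj_onI)
      fix a b assume "a \<in> ?Q \<times> ?P" "b \<in> ?Q \<times> ?P"
        "(case a of (X, p) \<Rightarrow> relabel p (r X)) = (case b of (X, p) \<Rightarrow> relabel p (r X))"
      then obtain X p Y p' where ab: "a = (X, p)" "b = (Y, p')" "X \<in> ?Q" "Y \<in> ?Q" "p \<in> ?P" "p' \<in> ?P"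
        and e: "relabel p (r X) = relabel p' (r Y)" by auto
      have "(r X, r Y) \<in> map_iso_rel"
        using rel[OF ab(3,5)] rel[OF ab(4,6)] e equiv_map_iso_rel
        by (metis equiv_def symD transD)
      then have XY: "X = Y"
        using r(3)[OF ab(3)] r(3)[OF ab(4)] equiv_class_eq[OF equiv_map_iso_rel] by metis
      have inj: "inj_on p (sides (r X))" "inj_on p' (sides (r X))"
        using ab(5,6) by (auto intro: permutes_inj_on)
      have "p s = p' s" for s
      proof (cases "s \<in> ?S")
        case True
        then have "s \<in> sides (r X)" using r(2)[OF ab(3)] by simp
        then show ?thesis using iso_unique[OF r(1)[OF ab(3)] inj] e XY by simp
      next
        case False
        then show ?thesis using ab(5,6) by (simp add: permutes_not_in)
      qed
      then have "p = p'" by (rule ext)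
      then show "a = b" using ab XY by simp
    qed
    show "(\<lambda>(X, p). relabel p (r X)) ` (?Q \<times> ?P) = labelled_quads n g"
    proof (intro equalityI subsetI)
      fix N assume "N \<in> (\<lambda>(X, p). relabel p (r X)) ` (?Q \<times> ?P)"
      then show "N \<in> labelled_quads n g" using rel by auto
    next
      fix N assume "N \<in> labelled_quads n g"
      then have N: "N \<in> quadrangulations n g" "sides N = ?S" by (auto simp: labelled_quads_def)
      define X where "X = map_iso_rel `` {N}"
      have X: "X \<in> ?Q" unfolding X_def by (rule quotientI[OF N(1)])
      note rX = r[OF X]
      have "N \<in> X" using rel_refl[OF N(1)] by (simp add: X_def)
      then have "(r X, N) \<in> map_iso_rel" using rX(3) by blast
      then obtain k where k: "map_isomorphism k (r X) N" by (auto simp: map_iso_rel_def)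
      then have bij: "bij_betw k ?S ?S" using rX(2) N(2) by (simp add: map_isomorphism_def)
      define p where "p = restrict_id k ?S"
      have p: "p permutes ?S" unfolding p_def by (rule permutes_restrict_id[OF bij])
      have inj: "inj_on k (sides (r X))" "inj_on p (sides (r X))"
        using bij p rX(2) by (auto simp: bij_betw_def intro: permutes_inj_on)
      have "N = relabel k (r X)" by (rule iso_target[OF rX(1) inj(1) N(1) k])
      also have "\<dots> = relabel p (r X)"
        by (rule relabel_cong[OF rX(1) _ inj]) (simp add: p_def rX(2))
      finally show "N \<in> (\<lambda>(X, p). relabel p (r X)) ` (?Q \<times> ?P)" using X p by force
    qed
  qed
  then have "card (?Q \<times> ?P) = card (labelled_quads n g)" by (rule bij_betw_same_card)
  moreover have "card ?P = fact (4 * n)" by (rule card_permutations) auto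
  ultimately show ?thesis by (simp add: num_quadrangulations_def card_cartesian_product)
qed

section \<open>The inequality\<close>

theorem proposition1:
  fixes n g :: nat
  assumes "n \<ge> 1" and "g \<ge> 1"
  shows "2 * g * num_quadrangulations n g \<le> (2 * n) ^ 3 * num_quadrangulations n (g - 1)"
proof -
  have "(2 * g * num_quadrangulations n g) * fact (4 * n) \<le>
      ((2 * n) ^ 3 * num_quadrangulations n (g - 1)) * fact (4 * n)"
    using labelled_inequality[OF assms(2), of n] by (simp only: card_labelled_quads mult.assoc)
  then show ?thesis by (simp only: mult_le_cancel2 fact_gt_zero simp_thms)
qed

end
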